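(* Suppose that $\boldsymbol{w}=(w_1,\dots,w_p)'$ has i.i.d. positive entries with $\mathbb{E}w_1=\mu>0$, $\mathbb{E}(w_1-\mu)^2=\sigma^2>0$ and $\mathbb{E}|w_1-\mu|^4<\infty$, and let $\boldsymbol{r}=\frac{1}{\sqrt n}\bigl(\frac{w_1}{\overline w}-1,\dots,\frac{w_p}{\overline w}-1\bigr)'$. Let $\epsilon>0$ be a constant. For every $q\ge2$ there is a positive constant $K_q$, depending on $q$ but not on $n$, $p$ or $\boldsymbol{A}$, such that for any (nonrandom) $p\times p$ matrix $\boldsymbol{A}$, $$\begin{aligned} \mathbb{E}\Bigl|\boldsymbol{r}'\boldsymbol{A}\boldsymbol{r}-\frac1n\nu_2\,\mathrm{tr}\boldsymbol{A}\Bigr|^q\le K_q\Bigl[&n^{-q}\Bigl(\bigl(\mathbb{E}|w_1|^4\,\mathrm{tr}(\boldsymbol{A}\boldsymbol{A}')\bigr)^{q/2}+\mathbb{E}|w_1|^{2q}\,\mathrm{tr}\bigl((\boldsymbol{A}\boldsymbol{A}')^{q/2}\bigr)\Bigr)\\ &+n^q\,\mathbb{P}\bigl(B_p^c(\epsilon)\bigr)\|\boldsymbol{A}\|^q+n^{-q}\|\boldsymbol{A}\|^q|h_1|^q\Bigr], \end{aligned}$$ and for constants $k,q_1>0$, $$\mathbb{P}(B_p^c(\epsilon))\le K\epsilon^{-kq_1}\bigl(\sigma^{kq_1}p^{-kq_1/2}+p^{-kq_1+1}\mathbb{E}|w_1|^{kq_1}\bigr)$$ with a constant $K$ not depending on $\epsilon$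 and $p$ (it may depend on $kq_1$). Furthermore, if $\|\boldsymbol{A}\|\le K$ and $|w_j-\mu|<\delta_n\sqrt n$ for all $j=1,\dots,p$ (here the law of $w_1$ may depend on $n$, with $\mu,\sigma^2$ fixed and $\mathbb{E}|w_1-\mu|^4$ bounded uniformly in $n$), then for any $q\ge2$, $$\mathbb{E}\Bigl|\boldsymbol{r}'\boldsymbol{A}\boldsymbol{r}-\frac1n\nu_2\,\mathrm{tr}\boldsymbol{A}\Bigr|^q\le K_q\,n^{-1}\delta_n^{2q-4}.$$
   Context: $\overline w=\frac1p\sum_{j=1}^pw_j$, $\nu_2=\mathbb{E}(\frac{w_1}{\overline w}-1)^2$, $h_1=-2\frac{\mathbb{E}w_1^3}{\mu^3}+3(\frac{\sigma^2}{\mu^2})^2+5\frac{\sigma^2}{\mu^2}+2$. $B_p(\epsilon)=\{|\overline w-\mu|\le\epsilon\}$ and $B_p^c(\epsilon)$ is its complement. $\|\boldsymbol{A}\|=\sqrt{\lambda_1(\boldsymbol{A}\boldsymbol{A}')}$ is the spectral norm (for complex $\boldsymbol{A}$, read $\boldsymbol{A}\boldsymbol{A}'$ in the bound and in the norm with the conjugate transpose). Standing: $p=p(n)$ with $p/n\to c\in(0,\infty)$ as $n\to\infty$. $(\delta_n)$ is a positive sequence with $\delta_n\to0$ and $\delta_nn^{1/4}\to\infty$. Constants denoted $K$, $K_q$ may depend on the fixed parameters of the distribution (and on $q$, $\epsilon$, the bound on $\|\boldsymbol{A}\|$, as applicable), but not on $n,p$, and may differ at each occurrence. *)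

theory Defs
  imports
    "HOL-Probability.Probability"
    "Jordan_Normal_Form.Spectral_Radius"
    "Jordan_Normal_Form.Schur_Decomposition"
begin

definition mtrace :: "complex mat \<Rightarrow> complex" where
  "mtrace A = (\<Sum>i<dim_row A. A $$ (i, i))"

text \<open>The largest eigenvalue of a Hermitian matrix, all of whose eigenvalues are real.\<close>

definition largest_eigenvalue :: "complex mat \<Rightarrow> real" where
  "largest_eigenvalue B = Max {x :: real. eigenvalue B (complex_of_real x)}"

definition spectral_norm :: "complex mat \<Rightarrow> real" where
  "spectral_norm A = sqrt (largest_eigenvalue (A * mat_adjoint A))"

text \<open>
  Real powers of a positive semidefinite Hermitian matrix by functional calculus:
  if \<open>B = U diag(d) U\<^sup>*\<close> with \<open>U\<close> unitary and \<open>d \<ge> 0\<close>, then \<open>B\<^sup>s = U diag(d\<^sup>s) U\<^sup>*\<close>.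
  Such a decomposition exists by the spectral theorem, and the resulting matrix does not
  depend on which one is taken, so the choice operator picks the only candidate.
  (Exponents are positive here, in agreement with \<open>0 powr s = 0\<close>.)
\<close>

definition is_psd_power :: "complex mat \<Rightarrow> real \<Rightarrow> complex mat \<Rightarrow> bool" where
  "is_psd_power B s C \<longleftrightarrow>
     (let m = dim_row B in
      \<exists>U \<in> carrier_mat m m. \<exists>d :: nat \<Rightarrow> real.
        U * mat_adjoint U = 1\<^sub>m m \<and> mat_adjoint U * U = 1\<^sub>m m \<and>
        (\<forall>i<m. 0 \<le> d i) \<and>
        B = U * mat_diag m (\<lambda>i. complex_of_real (d i)) * mat_adjoint U \<and>
        C = U * mat_diag m (\<lambda>i. complex_of_real (d i powr s)) * mat_adjoint U)"

definition psd_power :: "complex mat \<Rightarrow> real \<Rightarrow> complex mat" where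
  "psd_power B s = (SOME C. is_psd_power B s C)"

text \<open>
  The entries \<open>w\<^sub>1, \<dots>, w\<^sub>p\<close> are \<open>w 0, \<dots>, w (p - 1)\<close>, matching the 0-based indices of
  vectors and matrices; in particular \<open>w\<^sub>1\<close> is \<open>w 0\<close>.
\<close>

definition iid_positive :: "'a measure \<Rightarrow> nat \<Rightarrow> (nat \<Rightarrow> 'a \<Rightarrow> real) \<Rightarrow> bool" where
  "iid_positive M p w \<longleftrightarrow>
     prob_space M \<and>
     prob_space.indep_vars M (\<lambda>_. borel) w {..<p} \<and>
     (\<forall>j<p. distr M borel (w j) = distr M borel (w 0)) \<and>
     (\<forall>j<p. AE x in M. 0 < w j x)"

definition wbar :: "nat \<Rightarrow> (nat \<Rightarrow> 'a \<Rightarrow> real) \<Rightarrow> 'a \<Rightarrow> real" where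
  "wbar p w x = (\<Sum>j<p. w j x) / real p"

definition rvec :: "nat \<Rightarrow> nat \<Rightarrow> (nat \<Rightarrow> 'a \<Rightarrow> real) \<Rightarrow> 'a \<Rightarrow> complex Matrix.vec" where
  "rvec n p w x =
     Matrix.vec p (\<lambda>j. complex_of_real (1 / sqrt (real n) * (w j x / wbar p w x - 1)))"

definition nu2 :: "'a measure \<Rightarrow> nat \<Rightarrow> (nat \<Rightarrow> 'a \<Rightarrow> real) \<Rightarrow> real" where
  "nu2 M p w = (\<integral>x. (w 0 x / wbar p w x - 1)\<^sup>2 \<partial>M)"

definition h1 :: "'a measure \<Rightarrow> (nat \<Rightarrow> 'a \<Rightarrow> real) \<Rightarrow> real \<Rightarrow> real \<Rightarrow> real" where
  "h1 M w mu sd =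
     - 2 * ((\<integral>x. (w 0 x) ^ 3 \<partial>M) / mu ^ 3) + 3 * (sd\<^sup>2 / mu\<^sup>2)\<^sup>2 + 5 * (sd\<^sup>2 / mu\<^sup>2) + 2"

definition B_event ::
  "'a measure \<Rightarrow> nat \<Rightarrow> (nat \<Rightarrow> 'a \<Rightarrow> real) \<Rightarrow> real \<Rightarrow> real \<Rightarrow> 'a set" where
  "B_event M p w mu eps = {x \<in> space M. \<bar>wbar p w x - mu\<bar> \<le> eps}"

definition prob_Bc ::
  "'a measure \<Rightarrow> nat \<Rightarrow> (nat \<Rightarrow> 'a \<Rightarrow> real) \<Rightarrow> real \<Rightarrow> real \<Rightarrow> real" where
  "prob_Bc M p w mu eps = measure M (space M - B_event M p w mu eps)"

text \<open>
  Absolute moments are taken in \<open>[0, \<infinity>]\<close>: moments of high order may be infinite, and the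
  Bochner integral would then be \<open>0\<close>.
\<close>

definition abs_moment :: "'a measure \<Rightarrow> ('a \<Rightarrow> real) \<Rightarrow> real \<Rightarrow> ennreal" where
  "abs_moment M X s = (\<integral>\<^sup>+x. ennreal (\<bar>X x\<bar> powr s) \<partial>M)"

text \<open>\<open>scalar_prod\<close> is bilinear, so this is \<open>r' A r\<close> (transpose, no conjugation).\<close>

definition quad_dev ::
  "'a measure \<Rightarrow> nat \<Rightarrow> nat \<Rightarrow> (nat \<Rightarrow> 'a \<Rightarrow> real) \<Rightarrow> complex mat \<Rightarrow> 'a \<Rightarrow> complex" where
  "quad_dev M n p w A x =
     scalar_prod (rvec n p w x) (A *\<^sub>v rvec n p w x)
       - complex_of_real (1 / real n * nu2 M p w) * mtrace A"

end

theory Submission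
  imports Defs
begin

text \<open>
  Write \<open>y = w - \<mu>\<close> and \<open>t = wbar - \<mu>\<close>. On the event \<open>wbar \<ge> \<mu> / 2\<close> the form \<open>n r' A r\<close> is
  \<open>(\<mu> + t)\<^sup>-\<^sup>2 (y - t 1)' A (y - t 1)\<close>, which differs from \<open>y' A y / \<mu>\<^sup>2\<close> by terms controlled by linear
  forms in \<open>y\<close>. The complementary event has probability exponentially small in \<open>p\<close> because the
  \<open>w\<^sub>j\<close> are positive, and there \<open>r\<close> is polynomially bounded. The contribution of that event, like the
  error \<open>|\<nu>\<^sub>2 - \<sigma>\<^sup>2 / \<mu>\<^sup>2| = O(p\<^sup>-\<^sup>1\<^sup>/\<^sup>2)\<close> in the centring, is absorbed by the Frobenius norm term.

  Linear and diagonal forms are estimated by Rosenthal's inequality, which follows from the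
  second-order expansion of \<open>|a + b|\<^sup>q\<close> by induction on the number of summands. Off-diagonal forms
  are first decoupled by averaging over all splittings of the index set into two parts: given one
  part, the form is linear in the other. For a fixed law the resulting bound in terms of the
  Frobenius norm suffices, the case of an infinite moment of order \<open>2q\<close> being trivial; for truncated
  variables the bound in terms of the operator norm is used.
\<close>

section \<open>Rosenthal's inequality\<close>

text \<open>Both the fixed-law and the truncated estimate come out of one argument, although in the
  second the law moves with n and the moment \<open>m\<close> of order 2q may grow like (\<delta>
  sqrt n)^(2q-4). So the constants of the core argument are explicit functions of q, \<mu>, s and C
  only, and \<open>m\<close> stays visible until the two cases separate. Self-normalisation is paid
  for in powers of p t^2, which is of order 1 because t is a mean of p centred variables. For a
  fixed law F^q is comparable with the first term of the bound because E w^4 is positive. If the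
  moment of order 2q is infinite, the right-hand side has to be infinite for every nonzero A, so the
  trace of the matrix power must be strictly positive; this is one use of the spectral theorem, the
  other being the passage from \<open>spectral_norm\<close> to an inequality for sums. Integrals to
  be bounded live in [0, \<infinity>], so no integrability of the quadratic form has to be known
  beforehand.\<close>

lemma powr_taylor_one:
  fixes q t :: real
  assumes q: "2 \<le> q" and t: "\<bar>t\<bar> < 1/2"
  shows "\<bar>1 + t\<bar> powr q \<le> 1 + q * t + q * q * 2 powr q * t\<^sup>2"
proof (cases "t = 0")
  case True
  then show ?thesis by simp
next
  case False
  \<comment> \<open>The derivatives of orders 0, 1 and 2 of x powr q. On the interval from 1/2 to
    3/2 the base stays positive, so the power rule applies.\<close>
  define D where "D m x = (if m = 0 then x powr q else if m = 1 then q * x powr (q - 1)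
    else q * ((q - 1) * x powr (q - 2)))" for m :: nat and x :: real
  have "\<forall>m s. m < 2 \<and> 1/2 \<le> s \<and> s \<le> 3/2 \<longrightarrow> DERIV (D m) s :> D (Suc m) s"
  proof (intro allI impI)
    fix m :: nat and s :: real
    assume "m < 2 \<and> 1/2 \<le> s \<and> s \<le> 3/2"
    then have s: "s > 0" and m: "m = 0 \<or> m = 1" by auto
    have "DERIV (\<lambda>x. x powr q) s :> q * s powr (q - 1)"
      "DERIV (\<lambda>x. q * x powr (q - 1)) s :> q * ((q - 1) * s powr (q - 2))"
      using has_real_derivative_powr[OF s, of q]
        DERIV_cmult[OF has_real_derivative_powr[OF s, of "q - 1"], of q]
      by (simp_all add: mult.assoc)
    then show "DERIV (D m) s :> D (Suc m) s"
      using m unfolding D_def by auto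
  qed
  from Taylor[of 2 D "\<lambda>x. x powr q" "1/2" "3/2" 1 "1 + t", OF _ _ this] t False abs_less_iff[of t "1/2"]
  obtain \<xi> where \<xi>: "if t < 0 then 1 + t < \<xi> \<and> \<xi> < 1 else 1 < \<xi> \<and> \<xi> < 1 + t"
    and eq: "(1 + t) powr q = (\<Sum>m<2. (D m 1 / fact m) * t ^ m) + (D 2 \<xi> / fact 2) * t ^ 2"
    unfolding D_def by (auto simp: fun_eq_iff)
  have \<xi>2: "0 < \<xi>" "\<xi> \<le> 2" using \<xi> t by (auto split: if_splits)
  have "\<xi> powr (q - 2) \<le> 2 powr (q - 2)" using \<xi>2 q by (intro powr_mono2) auto
  also have "\<dots> \<le> 2 powr q" by (intro powr_mono) auto
  finally have *: "\<xi> powr (q - 2) \<le> 2 powr q" .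
  have "q * ((q - 1) * \<xi> powr (q - 2)) / 2 \<le> q * (q * 2 powr q) / 1"
    using * q by (intro frac_le mult_left_mono mult_mono) auto
  then have "q * ((q - 1) * \<xi> powr (q - 2)) / 2 * t\<^sup>2 \<le> q * q * 2 powr q * t\<^sup>2"
    by (intro mult_right_mono) auto
  moreover have "\<bar>1 + t\<bar> = 1 + t" using t by auto
  ultimately show ?thesis using eq by (simp add: D_def numeral_2_eq_2)
qed

lemma powr_taylor_unit:
  fixes q t :: real
  assumes q: "2 \<le> q"
  shows "\<bar>1 + t\<bar> powr q \<le> 1 + q * t + (q * q * 2 powr q + 3 powr q) * (t\<^sup>2 + \<bar>t\<bar> powr q)"
proof (cases "\<bar>t\<bar> < 1/2")
  case True
  have "q * q * 2 powr q * t\<^sup>2 \<le> (q * q * 2 powr q + 3 powr q) * (t\<^sup>2 + \<bar>t\<bar> powr q)"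
    by (intro mult_mono) auto
  then show ?thesis using powr_taylor_one[OF q True] by linarith
next
  case False
  have "\<bar>1 + t\<bar> powr q \<le> (3 * \<bar>t\<bar>) powr q" using False q by (intro powr_mono2) auto
  also have "\<dots> = 3 powr q * \<bar>t\<bar> powr q" by (simp add: powr_mult)
  finally have 1: "\<bar>1 + t\<bar> powr q \<le> 3 powr q * \<bar>t\<bar> powr q" .
  have "2 * \<bar>t\<bar> = (2 * \<bar>t\<bar>) powr 1" by simp
  also have "\<dots> \<le> (2 * \<bar>t\<bar>) powr q" using False q by (intro powr_mono) auto
  also have "\<dots> = 2 powr q * \<bar>t\<bar> powr q" by (simp add: powr_mult)
  finally have "\<bar>t\<bar> \<le> 2 powr q * \<bar>t\<bar> powr q" by simp
  then have "q * \<bar>t\<bar> \<le> q * (q * (2 powr q * \<bar>t\<bar> powr q))"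
    using q by (intro mult_left_mono) (auto intro: order_trans[OF _ mult_right_mono[of 1 q]])
  moreover have "- (q * \<bar>t\<bar>) \<le> q * t" using q by (simp add: abs_if)
  moreover have "0 \<le> (q * q * 2 powr q + 3 powr q) * t\<^sup>2" by simp
  ultimately show ?thesis using 1 by (simp add: algebra_simps)
qed

text \<open>Homogeneity reduces this to t = b / a. The linear term is kept exactly rather than in
  absolute value, since it is to vanish in expectation when b is centred and independent of
  a.\<close>

lemma powr_taylor:
  fixes q a b :: real
  assumes q: "2 \<le> q"
  defines "C \<equiv> q * q * 2 powr q + 3 powr q"
  shows "\<bar>a + b\<bar> powr q \<le> \<bar>a\<bar> powr q + q * sgn a * \<bar>a\<bar> powr (q - 1) * b
           + C * (\<bar>a\<bar> powr (q - 2) * b\<^sup>2 + \<bar>b\<bar> powr q)"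
proof (cases "a = 0")
  case True
  \<comment> \<open>For a = 0 every term in |a| is 0, also for q = 2, where
    \<open>0 powr 0 = 0\<close>. Only C |b|^q is left, so C has to be at least 1.\<close>
  have "1 \<le> 3 powr q" using q by (intro ge_one_powr_ge_zero) auto
  then have "1 \<le> C" unfolding C_def by (intro add_increasing) auto
  then have "1 * \<bar>b\<bar> powr q \<le> C * \<bar>b\<bar> powr q" by (intro mult_right_mono) auto
  then show ?thesis using True by simp
next
  case False
  have "\<bar>a + b\<bar> = \<bar>a\<bar> * \<bar>1 + b / a\<bar>" using False by (simp add: abs_mult[symmetric] field_simps)
  then have "\<bar>a + b\<bar> powr q = \<bar>a\<bar> powr q * \<bar>1 + b / a\<bar> powr q" by (simp add: powr_mult)
  also have "\<dots> \<le> \<bar>a\<bar> powr q * (1 + q * (b / a) + C * ((b / a)\<^sup>2 + \<bar>b / a\<bar> powr q))"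
    unfolding C_def by (intro mult_left_mono powr_taylor_unit q) auto
  also have "\<dots> = \<bar>a\<bar> powr q + q * (\<bar>a\<bar> powr q / a) * b
      + C * (\<bar>a\<bar> powr q / a\<^sup>2 * b\<^sup>2 + \<bar>a\<bar> powr q * \<bar>b / a\<bar> powr q)"
    by (simp add: field_simps)
  also have "\<bar>a\<bar> powr q / a = sgn a * \<bar>a\<bar> powr (q - 1)"
    using False by (simp add: powr_diff sgn_if abs_if)
  also have "\<bar>a\<bar> powr q / a\<^sup>2 = \<bar>a\<bar> powr (q - 2)"
    using False by (simp add: powr_diff)
  also have "\<bar>a\<bar> powr q * \<bar>b / a\<bar> powr q = \<bar>b\<bar> powr q"
    using False by (simp add: powr_mult[symmetric])
  finally show ?thesis by (simp add: mult.assoc)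
qed

lemma powr_add_le:
  fixes a b q :: real
  assumes "0 \<le> a" "0 \<le> b" "0 \<le> q"
  shows "(a + b) powr q \<le> 2 powr q * (a powr q + b powr q)"
proof -
  have "(a + b) powr q \<le> (2 * max a b) powr q" using assms by (intro powr_mono2) auto
  also have "\<dots> = 2 powr q * max a b powr q" using assms by (simp add: powr_mult)
  also have "\<dots> \<le> 2 powr q * (a powr q + b powr q)"
    by (intro mult_left_mono) (auto simp: max_def)
  finally show ?thesis .
qed

lemma abs_add_powr_le:
  fixes a b q :: real
  assumes "0 \<le> q"
  shows "\<bar>a + b\<bar> powr q \<le> 2 powr q * (\<bar>a\<bar> powr q + \<bar>b\<bar> powr q)"
proof -
  have "\<bar>a + b\<bar> powr q \<le> (\<bar>a\<bar> + \<bar>b\<bar>) powr q" using assms by (intro powr_mono2) auto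
  also have "\<dots> \<le> 2 powr q * (\<bar>a\<bar> powr q + \<bar>b\<bar> powr q)" using assms by (intro powr_add_le) auto
  finally show ?thesis .
qed

lemma powr_le_one_add_powr:
  fixes x s t :: real
  assumes "0 \<le> x" "0 \<le> s" "s \<le> t"
  shows "x powr s \<le> 1 + x powr t"
proof (cases "x \<le> 1")
  case True
  then have "x powr s \<le> 1 powr s" using assms by (intro powr_mono2) auto
  then show ?thesis by (simp add: add_increasing2)
next
  case False
  then have "x powr s \<le> x powr t" using assms by (intro powr_mono) auto
  then show ?thesis by simp
qed

text \<open>The interpolation that turns the mixed term of \<open>powr_taylor\<close> into a Gronwall-type recursion.\<close>

lemma powr_interpolate:
  fixes q x B :: real
  assumes "2 \<le> q" "0 \<le> x" "0 < B"
  shows "x powr (q - 2) \<le> (x powr q + B powr (q / 2)) / B"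
proof -
  have "B * x powr (q - 2) \<le> x powr q + B powr (q / 2)"
  proof (cases "B \<le> x\<^sup>2")
    case True
    then have "x > 0" using assms by (cases "x = 0") auto
    then have "x powr q = x\<^sup>2 * x powr (q - 2)" by (simp add: powr_diff)
    then show ?thesis using True by (auto intro!: add_increasing2 mult_right_mono)
  next
    case False
    then have "x \<le> B powr (1/2)" using assms
      by (simp add: powr_half_sqrt real_le_rsqrt)
    then have "x powr (q - 2) \<le> (B powr (1/2)) powr (q - 2)" using assms by (intro powr_mono2) auto
    also have "\<dots> = B powr (q/2) / B" using assms by (simp add: powr_powr powr_diff diff_divide_distrib)
    finally show ?thesis using assms by (simp add: field_simps add_increasing)
  qed
  then show ?thesis using assms by (simp add: field_simps)
qed

lemma (in finite_measure) integrable_powr_mono: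
  fixes X :: "'a \<Rightarrow> real"
  assumes [measurable]: "X \<in> borel_measurable M"
    and int: "integrable M (\<lambda>x. \<bar>X x\<bar> powr t)" and "0 \<le> s" "s \<le> t"
  shows "integrable M (\<lambda>x. \<bar>X x\<bar> powr s)"
  by (rule Bochner_Integration.integrable_bound[of _ "\<lambda>x. 1 + \<bar>X x\<bar> powr t"])
     (use int assms powr_le_one_add_powr in auto)

text \<open>By independence the linear Taylor term has expectation 0 and the quadratic one
  factorises. After interpolation the latter involves E|S|^q again, so adding one summand is a
  linear recursion with growth factor 1 + C E X^2 / B. The scale B is free here and later dominates
  the total variance.\<close>

lemma (in prob_space) rosenthal_step:
  fixes S X :: "'a \<Rightarrow> real"
  assumes q: "2 \<le> q" and B: "0 < B" and indep: "indep_var borel X borel S"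
    and iS: "integrable M (\<lambda>x. \<bar>S x\<bar> powr q)"
    and iX: "integrable M (\<lambda>x. \<bar>X x\<bar> powr q)" and X0: "expectation X = 0"
  defines "C \<equiv> q * q * 2 powr q + 3 powr q"
  shows "integrable M (\<lambda>x. \<bar>S x + X x\<bar> powr q)"
    and "expectation (\<lambda>x. \<bar>S x + X x\<bar> powr q) \<le>
      expectation (\<lambda>x. \<bar>S x\<bar> powr q)
      + C * (expectation (\<lambda>x. (X x)\<^sup>2) / B * (expectation (\<lambda>x. \<bar>S x\<bar> powr q) + B powr (q / 2))
             + expectation (\<lambda>x. \<bar>X x\<bar> powr q))"
proof -
  have [measurable]: "X \<in> borel_measurable M" "S \<in> borel_measurable M"
    using indep by (auto dest: indep_var_rv1 indep_var_rv2)
  have C0: "0 \<le> C" unfolding C_def using q by simp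
  show i1: "integrable M (\<lambda>x. \<bar>S x + X x\<bar> powr q)"
    by (rule Bochner_Integration.integrable_bound[of _ "\<lambda>x. 2 powr q * (\<bar>S x\<bar> powr q + \<bar>X x\<bar> powr q)"])
       (use iS iX q abs_add_powr_le[of q] in auto)
  have "integrable M (\<lambda>x. \<bar>X x\<bar> powr 2)" "integrable M (\<lambda>x. \<bar>X x\<bar> powr 1)"
    using q by (intro integrable_powr_mono[OF _ iX]; simp)+
  then have X2: "integrable M (\<lambda>x. (X x)\<^sup>2)" and X1: "integrable M X"
    by (auto simp: integrable_abs_iff)
  define G where "G a = q * sgn a * \<bar>a\<bar> powr (q - 1)" for a :: real
  have [measurable]: "G \<in> borel_measurable borel" unfolding G_def by measurable
  have G: "integrable M (\<lambda>x. G (S x))"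
  proof (rule Bochner_Integration.integrable_bound[of _ "\<lambda>x. q * \<bar>S x\<bar> powr (q - 1)"])
    show "integrable M (\<lambda>x. q * \<bar>S x\<bar> powr (q - 1))"
      using q by (intro integrable_mult_right integrable_powr_mono[OF _ iS]) auto
  qed (use q in \<open>auto simp: G_def abs_mult sgn_if\<close>)
  have iG: "indep_var borel X borel (\<lambda>x. G (S x))"
    using indep_var_compose[OF indep, of id borel G borel] by (simp add: comp_def)
  have iH: "indep_var borel (\<lambda>x. (X x)\<^sup>2) borel (\<lambda>x. (\<bar>S x\<bar> powr q + B powr (q / 2)) / B)"
    using indep_var_compose[OF indep, of "\<lambda>x. x\<^sup>2" borel "\<lambda>x. (\<bar>x\<bar> powr q + B powr (q / 2)) / B" borel]
    by (simp add: comp_def)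
  have GX: "integrable M (\<lambda>x. G (S x) * X x)" "expectation (\<lambda>x. G (S x) * X x) = 0"
    using indep_var_integrable[OF iG X1 G] indep_var_lebesgue_integral[OF iG X1 G] X0
    by (simp_all add: mult.commute)
  have H: "integrable M (\<lambda>x. (\<bar>S x\<bar> powr q + B powr (q / 2)) / B)" using iS by auto
  have HX: "integrable M (\<lambda>x. (X x)\<^sup>2 * ((\<bar>S x\<bar> powr q + B powr (q / 2)) / B))"
      "expectation (\<lambda>x. (X x)\<^sup>2 * ((\<bar>S x\<bar> powr q + B powr (q / 2)) / B))
       = expectation (\<lambda>x. (X x)\<^sup>2) / B * (expectation (\<lambda>x. \<bar>S x\<bar> powr q) + B powr (q / 2))"
    using indep_var_integrable[OF iH X2 H] indep_var_lebesgue_integral[OF iH X2 H] iS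
    by (auto simp: prob_space)
  have "expectation (\<lambda>x. \<bar>S x + X x\<bar> powr q) \<le> expectation (\<lambda>x. \<bar>S x\<bar> powr q + G (S x) * X x
      + C * ((X x)\<^sup>2 * ((\<bar>S x\<bar> powr q + B powr (q / 2)) / B) + \<bar>X x\<bar> powr q))"
  proof (intro integral_mono)
    fix x
    have "\<bar>S x + X x\<bar> powr q \<le> \<bar>S x\<bar> powr q + G (S x) * X x
           + C * (\<bar>S x\<bar> powr (q - 2) * (X x)\<^sup>2 + \<bar>X x\<bar> powr q)"
      unfolding G_def C_def by (rule powr_taylor[OF q])
    also have "\<dots> \<le> \<bar>S x\<bar> powr q + G (S x) * X x
      + C * ((X x)\<^sup>2 * ((\<bar>S x\<bar> powr q + B powr (q / 2)) / B) + \<bar>X x\<bar> powr q)"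
      using powr_interpolate[of q "\<bar>S x\<bar>" B] q B C0
      by (subst mult.commute[of _ "(X x)\<^sup>2"]) (intro add_left_mono add_right_mono mult_left_mono, auto)
    finally show "\<bar>S x + X x\<bar> powr q \<le> \<dots>" .
  qed (use i1 iS iX GX HX in auto)
  also have "\<dots> = expectation (\<lambda>x. \<bar>S x\<bar> powr q)
      + C * (expectation (\<lambda>x. (X x)\<^sup>2) / B * (expectation (\<lambda>x. \<bar>S x\<bar> powr q) + B powr (q / 2))
             + expectation (\<lambda>x. \<bar>X x\<bar> powr q))"
    using iS iX GX HX by simp
  finally show "expectation (\<lambda>x. \<bar>S x + X x\<bar> powr q) \<le> \<dots>" .
qed

text \<open>With C the Taylor constant, this is C exp C: the exponential is the accumulated growth
  factor once the variances add up to at most B.\<close>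

definition rosenthal_const :: "real \<Rightarrow> real" where
  "rosenthal_const q = (q * q * 2 powr q + 3 powr q) * exp (q * q * 2 powr q + 3 powr q)"

lemma rosenthal_const_nonneg: "0 \<le> rosenthal_const q"
  unfolding rosenthal_const_def by simp

lemma (in prob_space) rosenthal_integrable:
  fixes X :: "'i \<Rightarrow> 'a \<Rightarrow> real"
  assumes q: "2 \<le> q" and "finite I" and "\<And>i. i \<in> I \<Longrightarrow> X i \<in> borel_measurable M"
    and "\<And>i. i \<in> I \<Longrightarrow> integrable M (\<lambda>x. \<bar>X i x\<bar> powr q)"
  shows "integrable M (\<lambda>x. \<bar>\<Sum>i\<in>I. X i x\<bar> powr q)"
  using assms(2-)
proof (induction I rule: finite_induct)
  case empty
  then show ?case using q by simp
next
  case (insert j J)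
  show ?case
    by (rule Bochner_Integration.integrable_bound
        [of _ "\<lambda>x. 2 powr q * (\<bar>X j x\<bar> powr q + \<bar>\<Sum>i\<in>J. X i x\<bar> powr q)"])
       (use insert q abs_add_powr_le[of q] in auto)
qed

text \<open>A discrete Gronwall argument: the growth factors 1 + C v_i / B of the single steps
  multiply to at most the exponential of their sum.\<close>

lemma (in prob_space) rosenthal_aux:
  fixes X :: "'i \<Rightarrow> 'a \<Rightarrow> real"
  assumes q: "2 \<le> q" and B: "0 < B" and fin: "finite I"
    and indep: "indep_vars (\<lambda>_. borel) X I"
    and int: "\<And>i. i \<in> I \<Longrightarrow> integrable M (\<lambda>x. \<bar>X i x\<bar> powr q)"
    and mean: "\<And>i. i \<in> I \<Longrightarrow> expectation (X i) = 0"
  defines "C \<equiv> q * q * 2 powr q + 3 powr q"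
  shows "expectation (\<lambda>x. \<bar>\<Sum>i\<in>I. X i x\<bar> powr q) \<le>
    exp (C * (\<Sum>i\<in>I. expectation (\<lambda>x. (X i x)\<^sup>2) / B)) *
    (C * (\<Sum>i\<in>I. expectation (\<lambda>x. (X i x)\<^sup>2) / B * B powr (q / 2) + expectation (\<lambda>x. \<bar>X i x\<bar> powr q)))"
  using fin indep int mean
proof (induction I rule: finite_induct)
  case empty
  then show ?case using q by simp
next
  case (insert j J)
  have C0: "0 \<le> C" unfolding C_def using q by simp
  have meas: "X i \<in> borel_measurable M" if "i \<in> insert j J" for i
    using insert.prems(1) that by (auto simp: indep_vars_def)
  have iS: "integrable M (\<lambda>x. \<bar>\<Sum>i\<in>J. X i x\<bar> powr q)"
    using insert meas by (intro rosenthal_integrable q) auto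
  let ?m = "expectation (\<lambda>x. \<bar>\<Sum>i\<in>J. X i x\<bar> powr q)"
  let ?v = "\<lambda>i. expectation (\<lambda>x. (X i x)\<^sup>2) / B"
  let ?e = "\<lambda>i. expectation (\<lambda>x. \<bar>X i x\<bar> powr q)"
  let ?T = "C * (\<Sum>i\<in>J. ?v i * B powr (q / 2) + ?e i)"
  let ?t = "C * (?v j * B powr (q / 2) + ?e j)"
  have v: "0 \<le> ?v i" and e: "0 \<le> ?e i" for i using B by auto
  have IH: "?m \<le> exp (C * (\<Sum>i\<in>J. ?v i)) * ?T"
    using insert.IH indep_vars_subset[OF insert.prems(1)] insert.prems by auto
  have "expectation (\<lambda>x. \<bar>\<Sum>i\<in>insert j J. X i x\<bar> powr q)
      = expectation (\<lambda>x. \<bar>(\<Sum>i\<in>J. X i x) + X j x\<bar> powr q)"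
    using insert by (simp add: add.commute)
  also have "\<dots> \<le> ?m + C * (?v j * (?m + B powr (q / 2)) + ?e j)"
    unfolding C_def
    by (intro rosenthal_step(2) q B iS indep_vars_sum insert) auto
  also have "\<dots> = (1 + C * ?v j) * ?m + ?t" by (simp add: algebra_simps)
  \<comment> \<open>The old bound takes up one more factor through 1 + x \<le> exp x; the new
    inhomogeneous term is merely enlarged by a factor of at least 1.\<close>
  also have "\<dots> \<le> exp (C * ?v j) * (exp (C * (\<Sum>i\<in>J. ?v i)) * ?T)
      + exp (C * (\<Sum>i\<in>insert j J. ?v i)) * ?t"
  proof (rule add_mono)
    have "1 * ?t \<le> exp (C * (\<Sum>i\<in>insert j J. ?v i)) * ?t"
      using C0 v e B
      by (intro mult_right_mono mult_nonneg_nonneg add_nonneg_nonneg)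
         (auto intro!: mult_nonneg_nonneg sum_nonneg)
    then show "?t \<le> exp (C * (\<Sum>i\<in>insert j J. ?v i)) * ?t" by simp
    show "(1 + C * ?v j) * ?m \<le> exp (C * ?v j) * (exp (C * (\<Sum>i\<in>J. ?v i)) * ?T)"
      by (intro mult_mono IH exp_ge_add_one_self) auto
  qed
  also have "\<dots> = exp (C * (\<Sum>i\<in>insert j J. ?v i)) * (C * (\<Sum>i\<in>insert j J. ?v i * B powr (q / 2) + ?e i))"
    using insert by (simp add: distrib_left exp_add mult.assoc)
  finally show ?case .
qed

text \<open>With B above the total variance the Gronwall exponent is at most C. The recursion
  divides by B, so B = 0 is reached as a limit of positive scales.\<close>

lemma (in prob_space) rosenthal:
  fixes X :: "'i \<Rightarrow> 'a \<Rightarrow> real"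
  assumes q: "2 \<le> q" and fin: "finite I"
    and indep: "indep_vars (\<lambda>_. borel) X I"
    and int: "\<And>i. i \<in> I \<Longrightarrow> integrable M (\<lambda>x. \<bar>X i x\<bar> powr q)"
    and mean: "\<And>i. i \<in> I \<Longrightarrow> expectation (X i) = 0"
    and B: "(\<Sum>i\<in>I. expectation (\<lambda>x. (X i x)\<^sup>2)) \<le> B"
  shows "expectation (\<lambda>x. \<bar>\<Sum>i\<in>I. X i x\<bar> powr q) \<le>
    rosenthal_const q * (B powr (q / 2) + (\<Sum>i\<in>I. expectation (\<lambda>x. \<bar>X i x\<bar> powr q)))"
proof -
  define C where "C = q * q * 2 powr q + 3 powr q"
  define e where "e = (\<Sum>i\<in>I. expectation (\<lambda>x. \<bar>X i x\<bar> powr q))"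
  define v where "v = (\<Sum>i\<in>I. expectation (\<lambda>x. (X i x)\<^sup>2))"
  have C0: "0 \<le> C" unfolding C_def using q by simp
  have e0: "0 \<le> e" unfolding e_def by (intro sum_nonneg) auto
  have v0: "0 \<le> v" unfolding v_def by (intro sum_nonneg) auto
  have main: "expectation (\<lambda>x. \<bar>\<Sum>i\<in>I. X i x\<bar> powr q) \<le> rosenthal_const q * (B' powr (q / 2) + e)"
    if B': "0 < B'" "B \<le> B'" for B'
  proof -
    have vB: "v / B' \<le> 1" using B' B v_def by simp
    have "expectation (\<lambda>x. \<bar>\<Sum>i\<in>I. X i x\<bar> powr q) \<le>
      exp (C * (v / B')) * (C * (v / B' * B' powr (q / 2) + e))"
      using rosenthal_aux[OF q B'(1) fin indep int mean]
      by (simp add: v_def e_def C_def sum_divide_distrib sum.distrib sum_distrib_right)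
    also have "\<dots> \<le> exp (C * 1) * (C * (1 * B' powr (q / 2) + e))"
      using C0 e0 v0 B' vB
      by (intro mult_mono add_mono iffD2[OF exp_le_cancel_iff] mult_left_mono)
         (auto intro!: mult_nonneg_nonneg add_nonneg_nonneg)
    finally show ?thesis by (simp add: rosenthal_const_def C_def mult_ac)
  qed
  show ?thesis
  proof (cases "0 < B")
    case True
    then show ?thesis using main[of B] by (simp add: e_def)
  next
    case False
    then have B0: "B = 0" using B v0 v_def by simp
    show ?thesis
    proof (rule field_le_epsilon)
      fix t :: real assume t: "0 < t"
      \<comment> \<open>The scale (t / K) powr (2 / q) is chosen so that its power q / 2 is t / K,
        which costs at most t. Adding 1 keeps the divisor positive.\<close>
      define K where "K = rosenthal_const q + 1"
      have K: "0 < K" "rosenthal_const q \<le> K" unfolding K_def using rosenthal_const_nonneg[of q] by auto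
      have "expectation (\<lambda>x. \<bar>\<Sum>i\<in>I. X i x\<bar> powr q)
          \<le> rosenthal_const q * (((t / K) powr (2 / q)) powr (q / 2) + e)"
        using t K B0 by (intro main) auto
      also have "((t / K) powr (2 / q)) powr (q / 2) = t / K" using t K q by (simp add: powr_powr)
      also have "rosenthal_const q * (t / K + e) \<le> t + rosenthal_const q * e"
      proof -
        have "rosenthal_const q * (t / K) \<le> K * (t / K)" using K t by (intro mult_right_mono) auto
        then show ?thesis using K by (simp add: distrib_left)
      qed
      finally show "expectation (\<lambda>x. \<bar>\<Sum>i\<in>I. X i x\<bar> powr q) \<le>
        rosenthal_const q * (B powr (q / 2) + (\<Sum>i\<in>I. expectation (\<lambda>x. \<bar>X i x\<bar> powr q))) + t"
        using B0 by (simp add: e_def)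
    qed
  qed
qed

section \<open>Quadratic forms in independent variables\<close>

lemma sum_powr_le_powr_sum:
  fixes x :: "'i \<Rightarrow> real"
  assumes fin: "finite I" and nonneg: "\<And>i. i \<in> I \<Longrightarrow> 0 \<le> x i" and r: "1 \<le> r"
  shows "(\<Sum>i\<in>I. x i powr r) \<le> (\<Sum>i\<in>I. x i) powr r"
proof -
  let ?S = "\<Sum>i\<in>I. x i"
  have S0: "0 \<le> ?S" using nonneg by (rule sum_nonneg)
  have split: "t powr r = t * t powr (r - 1)" if "0 \<le> t" for t :: real
    using that by (cases "t = 0") (auto simp: powr_diff)
  have "(\<Sum>i\<in>I. x i powr r) = (\<Sum>i\<in>I. x i * x i powr (r - 1))"
    by (intro sum.cong refl split nonneg)
  also have "\<dots> \<le> (\<Sum>i\<in>I. x i * ?S powr (r - 1))"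
    using nonneg r by (intro sum_mono mult_left_mono powr_mono2 member_le_sum fin) auto
  also have "\<dots> = ?S powr r" by (simp add: sum_distrib_right[symmetric] split[OF S0])
  finally show ?thesis .
qed

lemma abs_powr_eq_square_powr:
  fixes u t :: real
  shows "\<bar>u\<bar> powr t = (u\<^sup>2) powr (t / 2)"
proof -
  have "u\<^sup>2 = \<bar>u\<bar> powr 2" by simp
  then show ?thesis by (simp only: powr_powr) simp
qed

text \<open>Bernoulli's inequality, read off from Young's inequality for the product of x and 1 with
  exponents r and r / (r - 1).\<close>

lemma powr_ge_tangent:
  fixes x r :: real
  assumes "0 \<le> x" "1 \<le> r"
  shows "1 + r * (x - 1) \<le> x powr r"
proof (cases "r = 1")
  case False
  then have r: "r > 1" using assms by simp
  have "x * 1 \<le> x powr r / r + 1 powr (r / (r - 1)) / (r / (r - 1))"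
    by (rule Youngs_inequality) (use r assms in \<open>auto simp: field_simps\<close>)
  then have "r * (1 + r * (x - 1)) \<le> r * x powr r" using r by (simp add: field_simps)
  then show ?thesis using r by simp
qed (use assms in simp)

text \<open>Jensen's inequality for weights that are not normalised: each x i is compared with the
  tangent at the weighted mean c.\<close>

lemma weighted_power_mean:
  fixes w x :: "'i \<Rightarrow> real"
  assumes fin: "finite I" and w: "\<And>i. i \<in> I \<Longrightarrow> 0 \<le> w i" and x: "\<And>i. i \<in> I \<Longrightarrow> 0 \<le> x i"
    and r: "1 \<le> r"
  shows "(\<Sum>i\<in>I. w i * x i) powr r \<le> (\<Sum>i\<in>I. w i) powr (r - 1) * (\<Sum>i\<in>I. w i * x i powr r)"
proof (cases "(\<Sum>i\<in>I. w i * x i) = 0")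
  case True
  then show ?thesis using w x by (auto intro!: sum_nonneg mult_nonneg_nonneg)
next
  case False
  define W where "W = (\<Sum>i\<in>I. w i)"
  have "0 \<le> W" unfolding W_def using w by (rule sum_nonneg)
  moreover have "W \<noteq> 0"
  proof
    assume "W = 0"
    then have "\<forall>i\<in>I. w i = 0" using w fin by (simp add: W_def sum_nonneg_eq_0_iff)
    then show False using False by simp
  qed
  ultimately have W: "0 < W" by simp
  define c where "c = (\<Sum>i\<in>I. w i * x i) / W"
  have "0 \<le> (\<Sum>i\<in>I. w i * x i)" using w x by (auto intro!: sum_nonneg)
  then have c: "0 < c" using False W by (simp add: c_def)
  have Wc: "(\<Sum>i\<in>I. w i * x i) = W * c" using W by (simp add: c_def)
  \<comment> \<open>The weighted deviations from c cancel, so the linear parts of the tangents drop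
    out.\<close>
  have "W * c powr r = (\<Sum>i\<in>I. w i * (c powr r * (1 + r * (x i / c - 1))))"
  proof -
    have "(\<Sum>i\<in>I. w i * (c powr r * (1 + r * (x i / c - 1))))
        = c powr r * ((1 - r) * W + r / c * (\<Sum>i\<in>I. w i * x i))"
      unfolding W_def sum_distrib_left sum.distrib[symmetric]
      by (intro sum.cong refl) (simp add: algebra_simps)
    then show ?thesis unfolding Wc using c by (simp add: algebra_simps)
  qed
  also have "\<dots> \<le> (\<Sum>i\<in>I. w i * (c powr r * (x i / c) powr r))"
    using w x c r by (intro sum_mono mult_left_mono powr_ge_tangent) auto
  also have "\<dots> = (\<Sum>i\<in>I. w i * x i powr r)"
    using x c by (intro sum.cong refl) (simp add: powr_divide)
  finally have *: "W * c powr r \<le> (\<Sum>i\<in>I. w i * x i powr r)" .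
  have "(\<Sum>i\<in>I. w i * x i) powr r = W powr (r - 1) * (W * c powr r)"
    unfolding Wc using W c by (simp add: powr_mult powr_diff)
  also have "\<dots> \<le> W powr (r - 1) * (\<Sum>i\<in>I. w i * x i powr r)"
    using * by (intro mult_left_mono) auto
  finally show ?thesis by (simp add: W_def)
qed

text \<open>The origin of the decoupling factor 4: with i inside and j outside prescribed, the other
  points of I are free, which leaves a quarter of all subsets.\<close>

lemma card_subsets_separating:
  assumes "finite I" "i \<in> I" "j \<in> I" "i \<noteq> j"
  shows "4 * card {T \<in> Pow I. i \<in> T \<and> j \<notin> T} = 2 ^ card I"
proof -
  have "bij_betw (insert i) (Pow (I - {i, j})) {T \<in> Pow I. i \<in> T \<and> j \<notin> T}"
    by (rule bij_betwI[where g = "\<lambda>T. T - {i}"]) (use assms in auto)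
  then have "card {T \<in> Pow I. i \<in> T \<and> j \<notin> T} = 2 ^ card (I - {i, j})"
    using assms by (simp add: bij_betw_same_card[symmetric] card_Pow)
  moreover have "card I = Suc (Suc (card (I - {i, j})))"
  proof -
    have "card I = card (insert i (insert j (I - {i, j})))"
      using assms by (intro arg_cong[of _ _ card]) auto
    then show ?thesis using assms by simp
  qed
  ultimately show ?thesis by simp
qed

text \<open>Decoupling by averaging over all ways of splitting the index set in two.\<close>

lemma off_diagonal_sum_eq_average:
  fixes g :: "'i \<Rightarrow> 'i \<Rightarrow> real"
  assumes fin: "finite I"
  shows "2 ^ card I * (\<Sum>i\<in>I. \<Sum>j\<in>I - {i}. g i j) = 4 * (\<Sum>T\<in>Pow I. \<Sum>i\<in>T. \<Sum>j\<in>I - T. g i j)"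
proof -
  have "(\<Sum>T\<in>Pow I. \<Sum>i\<in>T. \<Sum>j\<in>I - T. g i j)
      = (\<Sum>T\<in>Pow I. \<Sum>i\<in>I. \<Sum>j\<in>I - {i}. if i \<in> T \<and> j \<notin> T then g i j else 0)"
  proof (rule sum.cong[OF refl])
    fix T assume "T \<in> Pow I"
    then have T: "T \<subseteq> I" by simp
    have "(\<Sum>i\<in>I. \<Sum>j\<in>I - {i}. if i \<in> T \<and> j \<notin> T then g i j else 0)
        = (\<Sum>i\<in>I. if i \<in> T then \<Sum>j\<in>I - T. g i j else 0)"
    proof (intro sum.cong refl)
      fix i assume "i \<in> I"
      show "(\<Sum>j\<in>I - {i}. if i \<in> T \<and> j \<notin> T then g i j else 0)
          = (if i \<in> T then \<Sum>j\<in>I - T. g i j else 0)"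
      proof (cases "i \<in> T")
        case True
        have "(\<Sum>j\<in>I - {i}. if j \<notin> T then g i j else 0) = (\<Sum>j\<in>{j\<in>I - {i}. j \<notin> T}. g i j)"
          using fin by (intro sum.inter_filter[symmetric]) auto
        also have "{j\<in>I - {i}. j \<notin> T} = I - T" using True by auto
        finally show ?thesis using True by simp
      qed simp
    qed
    also have "\<dots> = (\<Sum>i\<in>{i\<in>I. i \<in> T}. \<Sum>j\<in>I - T. g i j)"
      using fin by (intro sum.inter_filter[symmetric])
    also have "{i\<in>I. i \<in> T} = T" using T by auto
    finally show "(\<Sum>i\<in>T. \<Sum>j\<in>I - T. g i j)
      = (\<Sum>i\<in>I. \<Sum>j\<in>I - {i}. if i \<in> T \<and> j \<notin> T then g i j else 0)" by simp
  qed
  also have "\<dots> = (\<Sum>i\<in>I. \<Sum>j\<in>I - {i}. \<Sum>T\<in>Pow I. if i \<in> T \<and> j \<notin> T then g i j else 0)"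
    by (rule trans[OF sum.swap], rule sum.cong[OF refl], rule sum.swap)
  also have "\<dots> = (\<Sum>i\<in>I. \<Sum>j\<in>I - {i}. real (card {T \<in> Pow I. i \<in> T \<and> j \<notin> T}) * g i j)"
    using fin by (intro sum.cong refl) (simp add: sum.inter_filter[symmetric])
  finally have "4 * (\<Sum>T\<in>Pow I. \<Sum>i\<in>T. \<Sum>j\<in>I - T. g i j)
      = (\<Sum>i\<in>I. \<Sum>j\<in>I - {i}. real (4 * card {T \<in> Pow I. i \<in> T \<and> j \<notin> T}) * g i j)"
    by (simp add: sum_distrib_left mult.assoc)
  also have "\<dots> = (\<Sum>i\<in>I. \<Sum>j\<in>I - {i}. 2 ^ card I * g i j)"
    by (intro sum.cong refl, subst card_subsets_separating) (use fin in auto)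
  finally show ?thesis by (simp add: sum_distrib_left)
qed

text \<open>Jensen's inequality for the uniform distribution on the splittings. A moment bound that
  holds uniformly in T therefore carries over to the whole off-diagonal form.\<close>

lemma off_diagonal_powr_le_average:
  fixes g :: "'i \<Rightarrow> 'i \<Rightarrow> real"
  assumes fin: "finite I" and q: "1 \<le> q"
  shows "\<bar>\<Sum>i\<in>I. \<Sum>j\<in>I - {i}. g i j\<bar> powr q
    \<le> 4 powr q / 2 ^ card I * (\<Sum>T\<in>Pow I. \<bar>\<Sum>i\<in>T. \<Sum>j\<in>I - T. g i j\<bar> powr q)"
proof -
  define N :: real where "N = 2 ^ card I"
  have N: "0 < N" "(\<Sum>T\<in>Pow I. 1 / N) = 1" using fin by (auto simp: N_def card_Pow)
  let ?f = "\<lambda>T. \<Sum>i\<in>T. \<Sum>j\<in>I - T. g i j"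
  have "(\<Sum>i\<in>I. \<Sum>j\<in>I - {i}. g i j) = 4 * (\<Sum>T\<in>Pow I. 1 / N * ?f T)"
    using off_diagonal_sum_eq_average[OF fin, of g] N
    unfolding N_def[symmetric] sum_distrib_left[symmetric] by (simp add: field_simps)
  also have "\<bar>\<dots>\<bar> \<le> 4 * (\<Sum>T\<in>Pow I. \<bar>1 / N * ?f T\<bar>)"
    unfolding abs_mult by (intro mult_mono order_trans[OF sum_abs]) simp_all
  also have "(\<Sum>T\<in>Pow I. \<bar>1 / N * ?f T\<bar>) = (\<Sum>T\<in>Pow I. 1 / N * \<bar>?f T\<bar>)"
    using N by (simp add: abs_mult)
  finally have "\<bar>\<Sum>i\<in>I. \<Sum>j\<in>I - {i}. g i j\<bar> powr q \<le> (4 * (\<Sum>T\<in>Pow I. 1 / N * \<bar>?f T\<bar>)) powr q"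
    using q by (intro powr_mono2) auto
  also have "\<dots> = 4 powr q * (\<Sum>T\<in>Pow I. 1 / N * \<bar>?f T\<bar>) powr q"
    by (rule powr_mult)
  also have "\<dots> \<le> 4 powr q * ((\<Sum>T\<in>Pow I. 1 / N) powr (q - 1) * (\<Sum>T\<in>Pow I. 1 / N * \<bar>?f T\<bar> powr q))"
    using N q fin by (intro mult_left_mono weighted_power_mean) auto
  also have "\<dots> = 4 powr q / N * (\<Sum>T\<in>Pow I. \<bar>?f T\<bar> powr q)"
    unfolding N by (simp add: sum_distrib_left)
  finally show ?thesis by (simp add: N_def)
qed

text \<open>Fubini's theorem on the product law, pulled back to the original space. It stands in for
  conditioning on Y: the point \<omega>' is frozen in the inner integral.\<close>

lemma (in prob_space) nn_integral_indep_var: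
  assumes indep: "indep_var S X T Y"
    and f[measurable]: "case_prod f \<in> borel_measurable (S \<Otimes>\<^sub>M T)"
  shows "(\<integral>\<^sup>+\<omega>. f (X \<omega>) (Y \<omega>) \<partial>M) = (\<integral>\<^sup>+\<omega>'. (\<integral>\<^sup>+\<omega>. f (X \<omega>) (Y \<omega>') \<partial>M) \<partial>M)"
proof -
  have X[measurable]: "X \<in> measurable M S" and Y[measurable]: "Y \<in> measurable M T"
    and eq: "distr M S X \<Otimes>\<^sub>M distr M T Y = distr M (S \<Otimes>\<^sub>M T) (\<lambda>x. (X x, Y x))"
    using indep by (auto simp: indep_var_distribution_eq)
  interpret DX: prob_space "distr M S X" by (rule prob_space_distr) fact
  interpret DY: prob_space "distr M T Y" by (rule prob_space_distr) fact
  interpret P: pair_sigma_finite "distr M S X" "distr M T Y" ..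
  have "(\<integral>\<^sup>+\<omega>. f (X \<omega>) (Y \<omega>) \<partial>M) = (\<integral>\<^sup>+z. case_prod f z \<partial>distr M (S \<Otimes>\<^sub>M T) (\<lambda>x. (X x, Y x)))"
    by (simp add: nn_integral_distr)
  also have "\<dots> = (\<integral>\<^sup>+v. \<integral>\<^sup>+u. f u v \<partial>distr M S X \<partial>distr M T Y)"
    unfolding eq[symmetric] by (subst P.nn_integral_snd[symmetric]) auto
  also have "\<dots> = (\<integral>\<^sup>+v. \<integral>\<^sup>+\<omega>. f (X \<omega>) v \<partial>M \<partial>distr M T Y)"
    by (intro nn_integral_cong) (simp add: nn_integral_distr)
  also have "\<dots> = (\<integral>\<^sup>+\<omega>'. (\<integral>\<^sup>+\<omega>. f (X \<omega>) (Y \<omega>') \<partial>M) \<partial>M)"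
    by (simp add: nn_integral_distr)
  finally show ?thesis .
qed

text \<open>Inside the bracket the first two summands come from the variance and the q-th moment of
  the diagonal part, the others from the outer and the inner linear form of the decoupled part; 4^q
  is the decoupling factor. The moment of order 2q is left out on purpose.\<close>

definition quad_const :: "real \<Rightarrow> real \<Rightarrow> real \<Rightarrow> real" where
  "quad_const q s C = 2 powr q * rosenthal_const q * (C powr (q / 2) + 2 powr q * (1 + s powr q)
     + 4 powr q * s powr (q / 2) + 4 powr q * rosenthal_const q * (s powr (q / 2) + 1))"

definition norm_const :: "real \<Rightarrow> real \<Rightarrow> real \<Rightarrow> real" where
  "norm_const q s C = 1 + 2 powr q * (rosenthal_const q * (C powr (q / 2) + 2 powr q * (1 + s powr q)) + s powr q)"

lemma quad_const_nonneg: "0 \<le> quad_const q s C"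
  unfolding quad_const_def using rosenthal_const_nonneg[of q]
  by (intro mult_nonneg_nonneg add_nonneg_nonneg) auto

text \<open>The laws enter only through s, C and m. The variance s is exact because it appears in
  the centring of the form; C and m are upper bounds, so that laws varying with n can share one
  C.\<close>

locale centred_family = prob_space M for M :: "'a measure" +
  fixes p :: nat and y :: "nat \<Rightarrow> 'a \<Rightarrow> real" and q s C m :: real
  assumes q: "2 \<le> q" and p: "0 < p"
    and indep: "indep_vars (\<lambda>_. borel) y {..<p}"
    and int: "\<And>j. j < p \<Longrightarrow> integrable M (\<lambda>x. \<bar>y j x\<bar> powr (2 * q))"
    and mean: "\<And>j. j < p \<Longrightarrow> expectation (y j) = 0"
    and var: "\<And>j. j < p \<Longrightarrow> expectation (\<lambda>x. (y j x)\<^sup>2) = s"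
    and fourth: "\<And>j. j < p \<Longrightarrow> expectation (\<lambda>x. (y j x) ^ 4) \<le> C"
    and moment: "\<And>j. j < p \<Longrightarrow> expectation (\<lambda>x. \<bar>y j x\<bar> powr (2 * q)) \<le> m"
begin

abbreviation centred_form :: "(nat \<Rightarrow> nat \<Rightarrow> real) \<Rightarrow> 'a \<Rightarrow> real" where
  "centred_form a x \<equiv> (\<Sum>i<p. \<Sum>j<p. a i j * (y i x * y j x)) - s * (\<Sum>i<p. a i i)"

lemma meas[measurable]: "j < p \<Longrightarrow> y j \<in> borel_measurable M"
  using indep by (auto simp: indep_vars_def)

lemma int_powr: "j < p \<Longrightarrow> 0 \<le> t \<Longrightarrow> t \<le> 2 * q \<Longrightarrow> integrable M (\<lambda>x. \<bar>y j x\<bar> powr t)"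
  by (intro integrable_powr_mono[OF _ int] meas)

lemma int_sq: "j < p \<Longrightarrow> integrable M (\<lambda>x. (y j x)\<^sup>2)"
  using int_powr[of j 2] q by simp

lemma int_fourth: "j < p \<Longrightarrow> integrable M (\<lambda>x. (y j x) ^ 4)"
  using int_powr[of j 4] q by (simp add: powr_numeral)

lemma int_abs: "j < p \<Longrightarrow> integrable M (y j)"
  using int_powr[of j 1] q meas[of j] by (simp add: integrable_abs_iff)

lemma s_nonneg: "0 \<le> s"
  by (subst var[OF p, symmetric]) simp

lemma C_nonneg: "0 \<le> C"
  by (rule order_trans[OF _ fourth[OF p]]) simp

lemma m_nonneg: "0 \<le> m"
  by (rule order_trans[OF _ moment[OF p]]) simp

text \<open>The Cauchy-Schwarz inequality, in the form that the variance of |y|^q is nonnegative.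
  Two such square roots meet in \<open>bilinear_form\<close> and give m to the first power.\<close>

lemma moment_q:
  assumes j: "j < p"
  shows "expectation (\<lambda>x. \<bar>y j x\<bar> powr q) \<le> sqrt m"
proof -
  note [measurable] = meas[OF j]
  have sq: "(\<bar>y j x\<bar> powr q)\<^sup>2 = \<bar>y j x\<bar> powr (2 * q)" for x
    by (simp add: powr_powr power2_eq_square powr_add[symmetric])
  have i: "integrable M (\<lambda>x. \<bar>y j x\<bar> powr q)" "integrable M (\<lambda>x. (\<bar>y j x\<bar> powr q)\<^sup>2)"
    unfolding sq using int_powr[OF j] q by auto
  have "0 \<le> variance (\<lambda>x. \<bar>y j x\<bar> powr q)" by (rule variance_positive)
  then have "(expectation (\<lambda>x. \<bar>y j x\<bar> powr q))\<^sup>2 \<le> expectation (\<lambda>x. (\<bar>y j x\<bar> powr q)\<^sup>2)"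
    using variance_eq[OF i] by simp
  also have "\<dots> \<le> m" unfolding sq by (rule moment[OF j])
  finally show ?thesis by (rule real_le_rsqrt)
qed

lemma sqrt_m_le: "sqrt m \<le> 1 + m"
proof -
  have "sqrt m \<le> sqrt ((1 + m)\<^sup>2)" using m_nonneg
    by (intro real_sqrt_le_mono) (simp add: power2_eq_square algebra_simps)
  then show ?thesis using m_nonneg by simp
qed

text \<open>The order t is free: q serves the decoupled forms, 2q the squares of linear forms, 2 the
  variance of the mean. The two norms of v are kept apart because for v = 1 the second is only p,
  and not p^(t/2); this produces the factor p^(1-q) in \<open>\<theta>\<close>.\<close>

lemma linear_form:
  assumes t: "2 \<le> t" "t \<le> 2 * q" and J: "J \<subseteq> {..<p}"
    and mt: "\<And>j. j < p \<Longrightarrow> expectation (\<lambda>x. \<bar>y j x\<bar> powr t) \<le> mt"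
  shows "integrable M (\<lambda>x. \<bar>\<Sum>j\<in>J. v j * y j x\<bar> powr t)"
    and "expectation (\<lambda>x. \<bar>\<Sum>j\<in>J. v j * y j x\<bar> powr t)
      \<le> rosenthal_const t * (s powr (t / 2) * (\<Sum>j\<in>J. (v j)\<^sup>2) powr (t / 2) + mt * (\<Sum>j\<in>J. \<bar>v j\<bar> powr t))"
proof -
  have fin: "finite J" using J by (rule finite_subset) simp
  have Jp: "j < p" if "j \<in> J" for j using that J by auto
  have ind: "indep_vars (\<lambda>_. borel) (\<lambda>j x. v j * y j x) J"
    using indep_vars_subset[OF indep J] by (rule indep_vars_compose2) auto
  have eq: "\<bar>v j * y j x\<bar> powr t = \<bar>v j\<bar> powr t * \<bar>y j x\<bar> powr t" for j x
    by (simp add: abs_mult powr_mult)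
  have i: "integrable M (\<lambda>x. \<bar>v j * y j x\<bar> powr t)" if "j \<in> J" for j
    unfolding eq using Jp[OF that] t by (intro integrable_mult_right int_powr) auto
  show "integrable M (\<lambda>x. \<bar>\<Sum>j\<in>J. v j * y j x\<bar> powr t)"
    using Jp by (intro rosenthal_integrable t fin i) auto
  have "expectation (\<lambda>x. \<bar>\<Sum>j\<in>J. v j * y j x\<bar> powr t)
     \<le> rosenthal_const t * ((s * (\<Sum>j\<in>J. (v j)\<^sup>2)) powr (t / 2)
          + (\<Sum>j\<in>J. expectation (\<lambda>x. \<bar>v j * y j x\<bar> powr t)))"
  proof (intro rosenthal t fin ind i)
    show "expectation (\<lambda>x. v j * y j x) = 0" if "j \<in> J" for j
      using mean[OF Jp[OF that]] by simp
    show "(\<Sum>j\<in>J. expectation (\<lambda>x. (v j * y j x)\<^sup>2)) \<le> s * (\<Sum>j\<in>J. (v j)\<^sup>2)"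
      using Jp var by (simp add: power_mult_distrib sum_distrib_left mult.commute)
  qed
  also have "\<dots> \<le> rosenthal_const t * (s powr (t / 2) * (\<Sum>j\<in>J. (v j)\<^sup>2) powr (t / 2) + mt * (\<Sum>j\<in>J. \<bar>v j\<bar> powr t))"
  proof (intro mult_left_mono add_mono rosenthal_const_nonneg)
    show "(s * (\<Sum>j\<in>J. (v j)\<^sup>2)) powr (t / 2) \<le> s powr (t / 2) * (\<Sum>j\<in>J. (v j)\<^sup>2) powr (t / 2)"
      using s_nonneg by (simp add: powr_mult sum_nonneg)
    show "(\<Sum>j\<in>J. expectation (\<lambda>x. \<bar>v j * y j x\<bar> powr t)) \<le> mt * (\<Sum>j\<in>J. \<bar>v j\<bar> powr t)"
      unfolding eq sum_distrib_left
      using Jp mt by (intro sum_mono) (subst mult.commute[of mt], auto intro!: mult_left_mono)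
  qed
  finally show "expectation (\<lambda>x. \<bar>\<Sum>j\<in>J. v j * y j x\<bar> powr t) \<le> \<dots>" .
qed

text \<open>For t at least 2 the t-norm of the coefficients is below their 2-norm, so that both
  terms of Rosenthal's bound merge.\<close>

lemma linear_form_l2:
  assumes t: "2 \<le> t" "t \<le> 2 * q" and J: "J \<subseteq> {..<p}" and mt0: "0 \<le> mt"
    and mt: "\<And>j. j < p \<Longrightarrow> expectation (\<lambda>x. \<bar>y j x\<bar> powr t) \<le> mt"
    and V: "(\<Sum>j\<in>J. (v j)\<^sup>2) \<le> V"
  shows "expectation (\<lambda>x. \<bar>\<Sum>j\<in>J. v j * y j x\<bar> powr t) \<le> rosenthal_const t * (s powr (t / 2) + mt) * V powr (t / 2)"
proof -
  have fin: "finite J" using J by (rule finite_subset) simp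
  have V': "(\<Sum>j\<in>J. (v j)\<^sup>2) powr (t / 2) \<le> V powr (t / 2)"
    using V t by (intro powr_mono2 sum_nonneg) auto
  have "(\<Sum>j\<in>J. \<bar>v j\<bar> powr t) \<le> (\<Sum>j\<in>J. (v j)\<^sup>2) powr (t / 2)"
    unfolding abs_powr_eq_square_powr[of _ t] using t by (intro sum_powr_le_powr_sum fin) auto
  with V' have "(\<Sum>j\<in>J. \<bar>v j\<bar> powr t) \<le> V powr (t / 2)" by simp
  with V' have "rosenthal_const t * (s powr (t / 2) * (\<Sum>j\<in>J. (v j)\<^sup>2) powr (t / 2) + mt * (\<Sum>j\<in>J. \<bar>v j\<bar> powr t))
     \<le> rosenthal_const t * (s powr (t / 2) * V powr (t / 2) + mt * V powr (t / 2))"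
    using mt0 by (intro mult_left_mono add_mono rosenthal_const_nonneg) auto
  then show ?thesis using linear_form(2)[OF t J mt, of v] by (simp add: algebra_simps)
qed

text \<open>Rosenthal's inequality for the centred squares: their variances are at most the fourth
  moments, and their q-th moments are paid for with moments of order 2q.\<close>

lemma diagonal_form:
  shows "integrable M (\<lambda>x. \<bar>\<Sum>i<p. d i * ((y i x)\<^sup>2 - s)\<bar> powr q)"
    and "expectation (\<lambda>x. \<bar>\<Sum>i<p. d i * ((y i x)\<^sup>2 - s)\<bar> powr q)
      \<le> rosenthal_const q * (C powr (q / 2) * (\<Sum>i<p. (d i)\<^sup>2) powr (q / 2)
           + 2 powr q * (m + s powr q) * (\<Sum>i<p. \<bar>d i\<bar> powr q))"
proof -
  have ind: "indep_vars (\<lambda>_. borel) (\<lambda>i x. d i * ((y i x)\<^sup>2 - s)) {..<p}"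
    using indep by (rule indep_vars_compose2) auto
  have eq: "\<bar>d i * ((y i x)\<^sup>2 - s)\<bar> powr q = \<bar>d i\<bar> powr q * \<bar>(y i x)\<^sup>2 - s\<bar> powr q" for i x
    by (simp add: abs_mult powr_mult)
  have bd: "\<bar>(y i x)\<^sup>2 - s\<bar> powr q \<le> 2 powr q * (\<bar>y i x\<bar> powr (2 * q) + s powr q)" for i x
    using abs_add_powr_le[of q "(y i x)\<^sup>2" "- s"] abs_powr_eq_square_powr[of "y i x" "2 * q"] q s_nonneg by simp
  have i0: "integrable M (\<lambda>x. \<bar>(y i x)\<^sup>2 - s\<bar> powr q)" if i: "i < p" for i
    by (rule Bochner_Integration.integrable_bound[of _ "\<lambda>x. 2 powr q * (\<bar>y i x\<bar> powr (2 * q) + s powr q)"])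
       (use bd int[OF i] meas[OF i] in auto)
  have i: "integrable M (\<lambda>x. \<bar>d i * ((y i x)\<^sup>2 - s)\<bar> powr q)" if "i < p" for i
    unfolding eq using i0[OF that] by simp
  show "integrable M (\<lambda>x. \<bar>\<Sum>i<p. d i * ((y i x)\<^sup>2 - s)\<bar> powr q)"
    by (intro rosenthal_integrable q i) auto
  have e2: "expectation (\<lambda>x. ((y i x)\<^sup>2 - s)\<^sup>2) \<le> C" if i: "i < p" for i
  proof -
    have "expectation (\<lambda>x. ((y i x)\<^sup>2 - s)\<^sup>2) = expectation (\<lambda>x. (y i x) ^ 4 - 2 * s * (y i x)\<^sup>2 + s\<^sup>2)"
      by (intro Bochner_Integration.integral_cong refl) (simp add: power2_eq_square power4_eq_xxxx algebra_simps)
    also have "\<dots> = expectation (\<lambda>x. (y i x) ^ 4) - s\<^sup>2"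
      using int_sq[OF i] int_fourth[OF i] var[OF i] by (simp add: prob_space power2_eq_square)
    also have "\<dots> \<le> C" using order_trans[OF _ fourth[OF i], of "expectation (\<lambda>x. (y i x) ^ 4) - s\<^sup>2"] by simp
    finally show ?thesis .
  qed
  have "expectation (\<lambda>x. \<bar>\<Sum>i<p. d i * ((y i x)\<^sup>2 - s)\<bar> powr q)
     \<le> rosenthal_const q * ((C * (\<Sum>i<p. (d i)\<^sup>2)) powr (q / 2)
          + (\<Sum>i<p. expectation (\<lambda>x. \<bar>d i * ((y i x)\<^sup>2 - s)\<bar> powr q)))"
  proof (intro rosenthal q ind i)
    show "expectation (\<lambda>x. d i * ((y i x)\<^sup>2 - s)) = 0" if "i \<in> {..<p}" for i
      using that var int_sq by (simp add: prob_space)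
    show "(\<Sum>i<p. expectation (\<lambda>x. (d i * ((y i x)\<^sup>2 - s))\<^sup>2)) \<le> C * (\<Sum>i<p. (d i)\<^sup>2)"
      unfolding power_mult_distrib sum_distrib_left
      by (intro sum_mono) (simp, subst mult.commute[of C], intro mult_left_mono e2, auto)
  qed auto
  also have "\<dots> \<le> rosenthal_const q * (C powr (q / 2) * (\<Sum>i<p. (d i)\<^sup>2) powr (q / 2)
           + 2 powr q * (m + s powr q) * (\<Sum>i<p. \<bar>d i\<bar> powr q))"
  proof (intro mult_left_mono add_mono rosenthal_const_nonneg)
    show "(C * (\<Sum>i<p. (d i)\<^sup>2)) powr (q / 2) \<le> C powr (q / 2) * (\<Sum>i<p. (d i)\<^sup>2) powr (q / 2)"
      using C_nonneg by (simp add: powr_mult sum_nonneg)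
    have e: "expectation (\<lambda>x. \<bar>(y i x)\<^sup>2 - s\<bar> powr q) \<le> 2 powr q * (m + s powr q)" if i: "i < p" for i
    proof -
      have "expectation (\<lambda>x. \<bar>(y i x)\<^sup>2 - s\<bar> powr q)
          \<le> expectation (\<lambda>x. 2 powr q * (\<bar>y i x\<bar> powr (2 * q) + s powr q))"
        using i0[OF i] int[OF i] bd by (intro integral_mono) auto
      also have "\<dots> \<le> 2 powr q * (m + s powr q)"
        using int[OF i] moment[OF i] by (simp add: prob_space)
      finally show ?thesis .
    qed
    show "(\<Sum>i<p. expectation (\<lambda>x. \<bar>d i * ((y i x)\<^sup>2 - s)\<bar> powr q))
        \<le> 2 powr q * (m + s powr q) * (\<Sum>i<p. \<bar>d i\<bar> powr q)"
      unfolding eq sum_distrib_left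
      by (intro sum_mono) (simp, subst mult.commute[of "\<bar>_\<bar> powr q"], intro mult_right_mono e, auto)
  qed
  finally show "expectation (\<lambda>x. \<bar>\<Sum>i<p. d i * ((y i x)\<^sup>2 - s)\<bar> powr q) \<le> \<dots>" .
qed

text \<open>With the variables outside T frozen this is a linear form in those inside, and its
  coefficients V i are themselves linear forms; Rosenthal's inequality is used at both levels. The
  q-th moment of the 2-norm of V stays a parameter W, because the Frobenius and the operator bound
  estimate it differently.\<close>

lemma bilinear_form:
  fixes a :: "nat \<Rightarrow> nat \<Rightarrow> real"
  assumes T: "T \<subseteq> {..<p}"
    and W_int: "integrable M (\<lambda>x. (\<Sum>i\<in>T. (\<Sum>j\<in>{..<p} - T. a i j * y j x)\<^sup>2) powr (q / 2))"
    and W: "expectation (\<lambda>x. (\<Sum>i\<in>T. (\<Sum>j\<in>{..<p} - T. a i j * y j x)\<^sup>2) powr (q / 2)) \<le> W"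
  shows "(\<integral>\<^sup>+x. \<bar>\<Sum>i\<in>T. \<Sum>j\<in>{..<p} - T. a i j * (y i x * y j x)\<bar> powr q \<partial>M)
    \<le> ennreal (rosenthal_const q * (s powr (q / 2) * W
        + sqrt m * (rosenthal_const q * (s powr (q / 2) + sqrt m) * (\<Sum>i<p. (\<Sum>j<p. (a i j)\<^sup>2) powr (q / 2)))))"
proof -
  define U where "U = {..<p} - T"
  have U: "U \<subseteq> {..<p}" by (auto simp: U_def)
  define V where "V i x = (\<Sum>j\<in>U. a i j * y j x)" for i x
  have Up: "j < p" if "j \<in> U" for j using that U by auto
  have V_meas[measurable]: "V i \<in> borel_measurable M" for i
    unfolding V_def using meas Up by (intro borel_measurable_sum borel_measurable_times) auto
  define X where "X x = (\<lambda>i\<in>T. y i x)" for x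
  define Y where "Y x = (\<lambda>j\<in>U. y j x)" for x
  define f where "f u v = ennreal (\<bar>\<Sum>i\<in>T. u i * (\<Sum>j\<in>U. a i j * v j)\<bar> powr q)" for u v :: "nat \<Rightarrow> real"
  have ind: "indep_var (PiM T (\<lambda>_. borel)) X (PiM U (\<lambda>_. borel)) Y"
    unfolding X_def Y_def using T U by (intro indep_var_restrict[OF indep]) (auto simp: U_def)
  have [measurable]: "case_prod f \<in> borel_measurable (PiM T (\<lambda>_. borel) \<Otimes>\<^sub>M PiM U (\<lambda>_. borel))"
    unfolding f_def by measurable
  have fY: "f (X x) (Y x') = ennreal (\<bar>\<Sum>i\<in>T. V i x' * y i x\<bar> powr q)" for x x'
    unfolding f_def X_def Y_def V_def by (simp cong: sum.cong add: mult.commute)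
  have iVq: "integrable M (\<lambda>x. \<bar>V i x\<bar> powr q)" for i
    unfolding V_def using q moment_q by (intro linear_form U) auto
  have W_int': "integrable M (\<lambda>x. (\<Sum>i\<in>T. (V i x)\<^sup>2) powr (q / 2))"
    using W_int unfolding V_def U_def .
  have "(\<integral>\<^sup>+x. \<bar>\<Sum>i\<in>T. \<Sum>j\<in>{..<p} - T. a i j * (y i x * y j x)\<bar> powr q \<partial>M)
      = (\<integral>\<^sup>+x. f (X x) (Y x) \<partial>M)"
    unfolding fY U_def[symmetric] by (simp add: V_def sum_distrib_left sum_distrib_right mult_ac)
  also have "\<dots> = (\<integral>\<^sup>+x'. (\<integral>\<^sup>+x. f (X x) (Y x') \<partial>M) \<partial>M)"
    by (intro nn_integral_indep_var[OF ind]) measurable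
  \<comment> \<open>Outer level: for frozen x' the V i x' are constants.\<close>
  also have "\<dots> \<le> (\<integral>\<^sup>+x'. ennreal (rosenthal_const q * (s powr (q / 2) * (\<Sum>i\<in>T. (V i x')\<^sup>2) powr (q / 2)
       + sqrt m * (\<Sum>i\<in>T. \<bar>V i x'\<bar> powr q))) \<partial>M)"
  proof (intro nn_integral_mono)
    fix x'
    have "(\<integral>\<^sup>+x. f (X x) (Y x') \<partial>M) = ennreal (expectation (\<lambda>x. \<bar>\<Sum>i\<in>T. V i x' * y i x\<bar> powr q))"
      unfolding fY using q moment_q by (intro nn_integral_eq_integral linear_form(1) T) auto
    also have "\<dots> \<le> ennreal (rosenthal_const q * (s powr (q / 2) * (\<Sum>i\<in>T. (V i x')\<^sup>2) powr (q / 2)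
       + sqrt m * (\<Sum>i\<in>T. \<bar>V i x'\<bar> powr q)))"
      using q moment_q by (intro ennreal_leI linear_form(2) T) auto
    finally show "(\<integral>\<^sup>+x. f (X x) (Y x') \<partial>M) \<le> \<dots>" .
  qed
  also have "\<dots> = ennreal (expectation (\<lambda>x. rosenthal_const q * (s powr (q / 2) * (\<Sum>i\<in>T. (V i x)\<^sup>2) powr (q / 2)
       + sqrt m * (\<Sum>i\<in>T. \<bar>V i x\<bar> powr q))))"
    using W_int' iVq m_nonneg rosenthal_const_nonneg[of q]
    by (intro nn_integral_eq_integral) (auto intro!: AE_I2 mult_nonneg_nonneg add_nonneg_nonneg sum_nonneg)
  also have "expectation (\<lambda>x. rosenthal_const q * (s powr (q / 2) * (\<Sum>i\<in>T. (V i x)\<^sup>2) powr (q / 2)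
       + sqrt m * (\<Sum>i\<in>T. \<bar>V i x\<bar> powr q)))
     = rosenthal_const q * (s powr (q / 2) * expectation (\<lambda>x. (\<Sum>i\<in>T. (V i x)\<^sup>2) powr (q / 2))
       + sqrt m * (\<Sum>i\<in>T. expectation (\<lambda>x. \<bar>V i x\<bar> powr q)))"
    using W_int' iVq by simp
  also have "\<dots> \<le> rosenthal_const q * (s powr (q / 2) * W
        + sqrt m * (rosenthal_const q * (s powr (q / 2) + sqrt m) * (\<Sum>i<p. (\<Sum>j<p. (a i j)\<^sup>2) powr (q / 2))))"
  proof (intro mult_left_mono add_mono rosenthal_const_nonneg)
    show "expectation (\<lambda>x. (\<Sum>i\<in>T. (V i x)\<^sup>2) powr (q / 2)) \<le> W"
      using W unfolding V_def U_def .
    \<comment> \<open>Inner level: V i has coefficients from row i, so only the 2-norm of that row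
      matters.\<close>
    have "(\<Sum>i\<in>T. expectation (\<lambda>x. \<bar>V i x\<bar> powr q))
        \<le> (\<Sum>i\<in>T. rosenthal_const q * (s powr (q / 2) + sqrt m) * (\<Sum>j<p. (a i j)\<^sup>2) powr (q / 2))"
      unfolding V_def using q moment_q m_nonneg U
      by (intro sum_mono linear_form_l2 sum_mono2) auto
    also have "\<dots> \<le> (\<Sum>i<p. rosenthal_const q * (s powr (q / 2) + sqrt m) * (\<Sum>j<p. (a i j)\<^sup>2) powr (q / 2))"
      using T m_nonneg by (intro sum_mono2 mult_nonneg_nonneg rosenthal_const_nonneg) auto
    finally show "(\<Sum>i\<in>T. expectation (\<lambda>x. \<bar>V i x\<bar> powr q))
        \<le> rosenthal_const q * (s powr (q / 2) + sqrt m) * (\<Sum>i<p. (\<Sum>j<p. (a i j)\<^sup>2) powr (q / 2))"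
      by (simp add: sum_distrib_left)
  qed (use m_nonneg in auto)
  finally show ?thesis by (simp add: ennreal_leI)
qed

text \<open>The common source of the Frobenius and the operator bound, which differ only in what
  they insert for W, \<Phi> and F.\<close>

lemma quadratic_form:
  fixes a :: "nat \<Rightarrow> nat \<Rightarrow> real"
  assumes W_int: "\<And>T. T \<subseteq> {..<p} \<Longrightarrow>
      integrable M (\<lambda>x. (\<Sum>i\<in>T. (\<Sum>j\<in>{..<p} - T. a i j * y j x)\<^sup>2) powr (q / 2))"
    and W: "\<And>T. T \<subseteq> {..<p} \<Longrightarrow>
      expectation (\<lambda>x. (\<Sum>i\<in>T. (\<Sum>j\<in>{..<p} - T. a i j * y j x)\<^sup>2) powr (q / 2)) \<le> W"
    and \<Phi>: "(\<Sum>i<p. (\<Sum>j<p. (a i j)\<^sup>2) powr (q / 2)) \<le> \<Phi>"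
    and F: "(\<Sum>i<p. \<Sum>j<p. (a i j)\<^sup>2) \<le> F"
  shows "(\<integral>\<^sup>+x. \<bar>centred_form a x\<bar> powr q \<partial>M)
    \<le> ennreal (quad_const q s C * (F powr (q / 2) + (1 + m) * \<Phi> + W))"
proof -
  let ?D = "\<lambda>x. \<Sum>i<p. a i i * ((y i x)\<^sup>2 - s)"
  let ?g = "\<lambda>x i j. a i j * (y i x * y j x)"
  let ?O = "\<lambda>x. \<Sum>i<p. \<Sum>j\<in>{..<p} - {i}. ?g x i j"
  let ?R = "rosenthal_const q"
  let ?\<phi> = "\<Sum>i<p. (\<Sum>j<p. (a i j)\<^sup>2) powr (q / 2)"
  let ?c = "s powr (q / 2)"
  define E where "E = ?R * (?c * W + sqrt m * (?R * (?c + sqrt m) * ?\<phi>))"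
  have \<phi>0: "0 \<le> ?\<phi>" by (intro sum_nonneg) auto
  \<comment> \<open>The splitting with empty T shows that W is nonnegative.\<close>
  have "0 \<le> expectation (\<lambda>x. (\<Sum>i\<in>{}. (\<Sum>j\<in>{..<p} - {}. a i j * y j x)\<^sup>2) powr (q / 2))"
    by simp
  also have "\<dots> \<le> W" by (rule W) simp
  finally have W0: "0 \<le> W" .
  have E0: "0 \<le> E" unfolding E_def
    using W0 \<phi>0 m_nonneg by (intro mult_nonneg_nonneg add_nonneg_nonneg rosenthal_const_nonneg) auto
  have split: "centred_form a x = ?D x + ?O x" for x
  proof -
    have "(\<Sum>i<p. \<Sum>j<p. ?g x i j) = (\<Sum>i<p. ?g x i i + (\<Sum>j\<in>{..<p} - {i}. ?g x i j))"
      by (intro sum.cong refl sum.remove) auto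
    also have "\<dots> = (\<Sum>i<p. ?g x i i) + ?O x" by (rule sum.distrib)
    also have "(\<Sum>i<p. ?g x i i) = ?D x + s * (\<Sum>i<p. a i i)"
      unfolding sum_distrib_left sum.distrib[symmetric]
      by (intro sum.cong refl) (simp add: power2_eq_square algebra_simps)
    finally show ?thesis by simp
  qed
  have diag: "expectation (\<lambda>x. \<bar>?D x\<bar> powr q)
      \<le> ?R * (C powr (q / 2) * F powr (q / 2) + 2 powr q * (m + s powr q) * \<Phi>)"
  proof (rule order_trans[OF diagonal_form(2)], intro mult_left_mono add_mono rosenthal_const_nonneg)
    \<comment> \<open>A diagonal entry is dominated by its row, so the diagonal part needs no norms
      beyond F and \<Phi>.\<close>
    have le: "(a i i)\<^sup>2 \<le> (\<Sum>j<p. (a i j)\<^sup>2)" if "i < p" for i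
      using that by (intro member_le_sum[of i]) auto
    then have "(\<Sum>i<p. (a i i)\<^sup>2) \<le> F" by (intro order_trans[OF sum_mono F]) auto
    then show "(\<Sum>i<p. (a i i)\<^sup>2) powr (q / 2) \<le> F powr (q / 2)"
      using q by (intro powr_mono2 sum_nonneg) auto
    have "(\<Sum>i<p. \<bar>a i i\<bar> powr q) \<le> ?\<phi>"
      unfolding abs_powr_eq_square_powr[of _ q] using q le by (intro sum_mono powr_mono2) auto
    then show "(\<Sum>i<p. \<bar>a i i\<bar> powr q) \<le> \<Phi>" using \<Phi> by linarith
  qed (use m_nonneg in auto)
  have off: "(\<integral>\<^sup>+x. \<bar>?O x\<bar> powr q \<partial>M) \<le> ennreal (4 powr q * E)"
  proof -
    let ?f = "\<lambda>T x. \<bar>\<Sum>i\<in>T. \<Sum>j\<in>{..<p} - T. ?g x i j\<bar> powr q"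
    have [measurable]: "?f T \<in> borel_measurable M" if "T \<in> Pow {..<p}" for T
      using that meas by (intro powr_real_measurable borel_measurable_abs borel_measurable_sum
          borel_measurable_times borel_measurable_const) auto
    have "(\<integral>\<^sup>+x. \<bar>?O x\<bar> powr q \<partial>M)
        \<le> (\<integral>\<^sup>+x. ennreal (4 powr q / 2 ^ p) * (\<Sum>T\<in>Pow {..<p}. ennreal (?f T x)) \<partial>M)"
    proof (intro nn_integral_mono)
      fix x
      have "\<bar>?O x\<bar> powr q \<le> 4 powr q / 2 ^ p * (\<Sum>T\<in>Pow {..<p}. ?f T x)"
        using off_diagonal_powr_le_average[of "{..<p}" q "?g x"] q by simp
      then have "ennreal (\<bar>?O x\<bar> powr q) \<le> ennreal (4 powr q / 2 ^ p * (\<Sum>T\<in>Pow {..<p}. ?f T x))"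
        by (rule ennreal_leI)
      also have "\<dots> = ennreal (4 powr q / 2 ^ p) * (\<Sum>T\<in>Pow {..<p}. ennreal (?f T x))"
        by (subst ennreal_mult) (auto intro!: sum_nonneg)
      finally show "ennreal (\<bar>?O x\<bar> powr q) \<le> \<dots>" .
    qed
    also have "\<dots> = ennreal (4 powr q / 2 ^ p) * (\<Sum>T\<in>Pow {..<p}. \<integral>\<^sup>+x. ?f T x \<partial>M)"
    proof (subst nn_integral_cmult)
      show "(\<lambda>x. \<Sum>T\<in>Pow {..<p}. ennreal (?f T x)) \<in> borel_measurable M"
        by (intro borel_measurable_sum) measurable
    qed (subst nn_integral_sum, auto simp del: sum_ennreal)
    also have "\<dots> \<le> ennreal (4 powr q / 2 ^ p) * (\<Sum>T\<in>Pow {..<p}. ennreal E)"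
      unfolding E_def using W_int W by (intro mult_left_mono sum_mono bilinear_form) auto
    also have "\<dots> = ennreal (4 powr q * E)"
    proof -
      have "(\<Sum>T\<in>Pow {..<p}. ennreal E) = ennreal (\<Sum>T\<in>Pow {..<p}. E)"
        using E0 by (intro sum_ennreal) auto
      then show ?thesis using E0 by (simp add: card_Pow ennreal_mult[symmetric])
    qed
    finally show ?thesis .
  qed
  have "(\<integral>\<^sup>+x. \<bar>?D x + ?O x\<bar> powr q \<partial>M)
      \<le> (\<integral>\<^sup>+x. ennreal (2 powr q) * (ennreal (\<bar>?D x\<bar> powr q) + ennreal (\<bar>?O x\<bar> powr q)) \<partial>M)"
    using q by (intro nn_integral_mono)
      (simp add: ennreal_plus[symmetric] ennreal_mult[symmetric] abs_add_powr_le del: ennreal_plus)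
  also have "\<dots> = ennreal (2 powr q) * ((\<integral>\<^sup>+x. \<bar>?D x\<bar> powr q \<partial>M) + (\<integral>\<^sup>+x. \<bar>?O x\<bar> powr q \<partial>M))"
  proof -
    have [measurable]: "?D \<in> borel_measurable M" "?O \<in> borel_measurable M"
      using meas by (auto intro!: borel_measurable_sum)
    show ?thesis by (simp add: nn_integral_cmult nn_integral_add)
  qed
  also have "(\<integral>\<^sup>+x. \<bar>?D x\<bar> powr q \<partial>M) = ennreal (expectation (\<lambda>x. \<bar>?D x\<bar> powr q))"
    using diagonal_form(1) by (intro nn_integral_eq_integral) auto
  also have "ennreal (2 powr q) * (ennreal (expectation (\<lambda>x. \<bar>?D x\<bar> powr q)) + (\<integral>\<^sup>+x. \<bar>?O x\<bar> powr q \<partial>M))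
     \<le> ennreal (2 powr q) * (ennreal (expectation (\<lambda>x. \<bar>?D x\<bar> powr q)) + ennreal (4 powr q * E))"
    by (intro mult_left_mono add_left_mono off) auto
  also have "\<dots> = ennreal (2 powr q * (expectation (\<lambda>x. \<bar>?D x\<bar> powr q) + 4 powr q * E))"
    using E0 by (simp add: ennreal_mult)
  also have "\<dots> \<le> ennreal (quad_const q s C * (F powr (q / 2) + (1 + m) * \<Phi> + W))"
  proof (rule ennreal_leI)
    have R: "0 \<le> ?R" by (rule rosenthal_const_nonneg)
    have \<Phi>0: "0 \<le> \<Phi>" using \<phi>0 \<Phi> by linarith
    let ?x = "F powr (q / 2)" and ?y = "(1 + m) * \<Phi>"
    have y0: "0 \<le> ?y" using \<Phi>0 m_nonneg by simp
    \<comment> \<open>Half powers of m are replaced by 1 + m, which makes the final bound linear in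
      m.\<close>
    have "sqrt m * (?c + sqrt m) \<le> (1 + m) * (?c + 1)"
      using sqrt_m_le m_nonneg mult_right_mono[OF sqrt_m_le, of ?c] by (simp add: algebra_simps)
    then have "sqrt m * (?c + sqrt m) * ?\<phi> \<le> (1 + m) * (?c + 1) * \<Phi>"
      using \<Phi> by (rule mult_mono) (use \<phi>0 m_nonneg in auto)
    then have "?R * (sqrt m * (?c + sqrt m) * ?\<phi>) \<le> ?R * ((1 + m) * (?c + 1) * \<Phi>)"
      using R by (intro mult_left_mono)
    then have "E \<le> ?R * (?c * W + ?R * (?c + 1) * ?y)"
      unfolding E_def by (intro mult_left_mono R) (simp add: mult_ac)
    then have E: "4 powr q * E \<le> 4 powr q * (?R * (?c * W + ?R * (?c + 1) * ?y))" by simp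
    have "m + s powr q \<le> (1 + s powr q) * (1 + m)" using m_nonneg by (simp add: algebra_simps)
    then have "2 powr q * ((m + s powr q) * \<Phi>) \<le> 2 powr q * ((1 + s powr q) * (1 + m) * \<Phi>)"
      using \<Phi>0 by (intro mult_left_mono mult_right_mono) auto
    then have "?R * (C powr (q / 2) * ?x + 2 powr q * (m + s powr q) * \<Phi>)
        \<le> ?R * (C powr (q / 2) * ?x + 2 powr q * (1 + s powr q) * ?y)"
      by (intro mult_left_mono R) (simp add: mult_ac)
    from add_mono[OF order_trans[OF diag this] E]
    have "2 powr q * (expectation (\<lambda>x. \<bar>?D x\<bar> powr q) + 4 powr q * E)
      \<le> 2 powr q * (?R * (C powr (q / 2) * ?x + 2 powr q * (1 + s powr q) * ?y)
          + 4 powr q * (?R * (?c * W + ?R * (?c + 1) * ?y)))"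
      by (rule mult_left_mono) simp
    also have "\<dots> = 2 powr q * ?R * (C powr (q / 2)) * ?x + 2 powr q * ?R * (4 powr q * ?c) * W
        + 2 powr q * ?R * (2 powr q * (1 + s powr q) + 4 powr q * ?R * (?c + 1)) * ?y"
      by (simp add: algebra_simps)
    also have "\<dots> \<le> quad_const q s C * ?x + quad_const q s C * W + quad_const q s C * ?y"
      unfolding quad_const_def using R W0 y0
      by (intro add_mono mult_right_mono mult_left_mono) (auto intro!: mult_nonneg_nonneg add_nonneg_nonneg)
    finally show "2 powr q * (expectation (\<lambda>x. \<bar>?D x\<bar> powr q) + 4 powr q * E)
      \<le> quad_const q s C * (?x + ?y + W)" by (simp add: algebra_simps)
  qed
  finally show ?thesis unfolding split .
qed

text \<open>For W the sum of the (V i)^2 is read as a weighted sum of (V i)^2 / b i with weights b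
  i, the squared row norms. Each normalised term has a bounded moment of order q / 2, so the
  weighted power mean gives F^(q/2 - 1) times F.\<close>

lemma quadratic_form_frobenius:
  fixes a :: "nat \<Rightarrow> nat \<Rightarrow> real"
  defines "F \<equiv> \<Sum>i<p. \<Sum>j<p. (a i j)\<^sup>2"
  shows "(\<integral>\<^sup>+x. \<bar>centred_form a x\<bar> powr q \<partial>M)
    \<le> ennreal (quad_const q s C * (2 + rosenthal_const q * (s powr (q / 2) + 1)) * (1 + m) * F powr (q / 2))"
proof -
  let ?R = "rosenthal_const q"
  define b where "b i = (\<Sum>j<p. (a i j)\<^sup>2)" for i
  define W where "W = ?R * (s powr (q / 2) + sqrt m) * F powr (q / 2)"
  have b0: "0 \<le> b i" for i unfolding b_def by (intro sum_nonneg) auto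
  have F: "F = (\<Sum>i<p. b i)" unfolding F_def b_def ..
  have F0: "0 \<le> F" unfolding F using b0 by (intro sum_nonneg) auto
  have W: "integrable M (\<lambda>x. (\<Sum>i\<in>T. (\<Sum>j\<in>{..<p} - T. a i j * y j x)\<^sup>2) powr (q / 2)) \<and>
     expectation (\<lambda>x. (\<Sum>i\<in>T. (\<Sum>j\<in>{..<p} - T. a i j * y j x)\<^sup>2) powr (q / 2)) \<le> W"
    if T: "T \<subseteq> {..<p}" for T
  proof -
    have fT: "finite T" using T by (rule finite_subset) simp
    define V where "V i x = (\<Sum>j\<in>{..<p} - T. a i j * y j x)" for i x
    have [measurable]: "V i \<in> borel_measurable M" for i
      unfolding V_def using meas by (intro borel_measurable_sum) auto
    have iV: "integrable M (\<lambda>x. \<bar>V i x\<bar> powr q)" for i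
      unfolding V_def using q moment_q by (intro linear_form) auto
    have eV: "expectation (\<lambda>x. \<bar>V i x\<bar> powr q) \<le> ?R * (s powr (q / 2) + sqrt m) * b i powr (q / 2)" for i
      unfolding V_def b_def using q moment_q m_nonneg by (intro linear_form_l2 sum_mono2) auto
    text \<open>If \<open>b i = 0\<close>, the quotients below are junk but carry weight \<open>0\<close>.\<close>
    have V0: "V i x = 0" if "b i = 0" "i < p" for i x
      using that by (auto simp: b_def V_def sum_nonneg_eq_0_iff intro!: sum.neutral)
    have bnd: "(\<Sum>i\<in>T. (V i x)\<^sup>2) powr (q / 2)
        \<le> F powr (q / 2 - 1) * (\<Sum>i\<in>T. b i * (\<bar>V i x\<bar> powr q / b i powr (q / 2)))" for x
    proof -
      have "(\<Sum>i\<in>T. (V i x)\<^sup>2) = (\<Sum>i\<in>T. b i * ((V i x)\<^sup>2 / b i))"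
        using V0 T by (intro sum.cong refl) (auto simp: subset_eq)
      also have "\<dots> powr (q / 2) \<le> (\<Sum>i\<in>T. b i) powr (q / 2 - 1) * (\<Sum>i\<in>T. b i * ((V i x)\<^sup>2 / b i) powr (q / 2))"
        using b0 q by (intro weighted_power_mean fT) auto
      also have "\<dots> \<le> F powr (q / 2 - 1) * (\<Sum>i\<in>T. b i * ((V i x)\<^sup>2 / b i) powr (q / 2))"
        unfolding F using b0 q T
        by (intro mult_right_mono powr_mono2 sum_mono2 sum_nonneg mult_nonneg_nonneg) auto
      also have "(\<Sum>i\<in>T. b i * ((V i x)\<^sup>2 / b i) powr (q / 2)) = (\<Sum>i\<in>T. b i * (\<bar>V i x\<bar> powr q / b i powr (q / 2)))"
        unfolding abs_powr_eq_square_powr[of _ q] using b0 by (simp add: powr_divide)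
      finally show ?thesis .
    qed
    have ib: "integrable M (\<lambda>x. F powr (q / 2 - 1) * (\<Sum>i\<in>T. b i * (\<bar>V i x\<bar> powr q / b i powr (q / 2))))"
      using iV by auto
    have i: "integrable M (\<lambda>x. (\<Sum>i\<in>T. (V i x)\<^sup>2) powr (q / 2))"
      by (rule Bochner_Integration.integrable_bound[OF ib])
         (use bnd in \<open>auto intro!: AE_I2 intro: order_trans[OF _ abs_ge_self]\<close>)
    have "expectation (\<lambda>x. (\<Sum>i\<in>T. (V i x)\<^sup>2) powr (q / 2))
        \<le> expectation (\<lambda>x. F powr (q / 2 - 1) * (\<Sum>i\<in>T. b i * (\<bar>V i x\<bar> powr q / b i powr (q / 2))))"
      by (intro integral_mono i ib bnd)
    also have "\<dots> = F powr (q / 2 - 1) * (\<Sum>i\<in>T. b i * (expectation (\<lambda>x. \<bar>V i x\<bar> powr q) / b i powr (q / 2)))"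
      using iV by simp
    also have "\<dots> \<le> F powr (q / 2 - 1) * (\<Sum>i\<in>T. b i * (?R * (s powr (q / 2) + sqrt m)))"
    proof (intro mult_left_mono sum_mono b0)
      fix i
      show "expectation (\<lambda>x. \<bar>V i x\<bar> powr q) / b i powr (q / 2) \<le> ?R * (s powr (q / 2) + sqrt m)"
        using eV[of i] b0[of i] rosenthal_const_nonneg[of q] m_nonneg
        by (cases "b i = 0") (auto simp: field_simps intro!: mult_nonneg_nonneg add_nonneg_nonneg)
    qed auto
    also have "\<dots> = F powr (q / 2 - 1) * ((\<Sum>i\<in>T. b i) * (?R * (s powr (q / 2) + sqrt m)))"
      by (simp add: sum_distrib_right)
    also have "\<dots> \<le> F powr (q / 2 - 1) * (F * (?R * (s powr (q / 2) + sqrt m)))"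
      unfolding F using b0 T m_nonneg
      by (intro mult_left_mono mult_right_mono sum_mono2 mult_nonneg_nonneg rosenthal_const_nonneg) auto
    also have "\<dots> = W"
      using F0 by (cases "F = 0") (auto simp: W_def powr_diff)
    finally show ?thesis using i by (simp add: V_def)
  qed
  have "(\<integral>\<^sup>+x. \<bar>centred_form a x\<bar> powr q \<partial>M)
      \<le> ennreal (quad_const q s C * (F powr (q / 2) + (1 + m) * F powr (q / 2) + W))"
  proof (intro quadratic_form)
    show "(\<Sum>i<p. (\<Sum>j<p. (a i j)\<^sup>2) powr (q / 2)) \<le> F powr (q / 2)"
      unfolding F b_def using q by (intro sum_powr_le_powr_sum) (auto intro: sum_nonneg)
  qed (use W in \<open>auto simp: F_def\<close>)
  also have "\<dots> \<le> ennreal (quad_const q s C * (2 + ?R * (s powr (q / 2) + 1)) * (1 + m) * F powr (q / 2))"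
  proof (rule ennreal_leI)
    have "s powr (q / 2) + sqrt m \<le> (s powr (q / 2) + 1) * (1 + m)"
    proof -
      have "0 \<le> m * s powr (q / 2)" using m_nonneg by simp
      then show ?thesis using sqrt_m_le by (simp add: algebra_simps)
    qed
    then have "?R * (s powr (q / 2) + sqrt m) \<le> ?R * ((s powr (q / 2) + 1) * (1 + m))"
      by (intro mult_left_mono rosenthal_const_nonneg)
    then have "1 + (1 + m) + ?R * (s powr (q / 2) + sqrt m) \<le> (2 + ?R * (s powr (q / 2) + 1)) * (1 + m)"
      using m_nonneg by (simp add: algebra_simps)
    then have "(1 + (1 + m) + ?R * (s powr (q / 2) + sqrt m)) * F powr (q / 2)
        \<le> (2 + ?R * (s powr (q / 2) + 1)) * (1 + m) * F powr (q / 2)"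
      by (intro mult_right_mono) auto
    then show "quad_const q s C * (F powr (q / 2) + (1 + m) * F powr (q / 2) + W)
      \<le> quad_const q s C * (2 + ?R * (s powr (q / 2) + 1)) * (1 + m) * F powr (q / 2)"
      unfolding mult.assoc[of "quad_const q s C"]
      by (intro mult_left_mono quad_const_nonneg) (simp add: W_def algebra_simps)
  qed
  finally show ?thesis .
qed

text \<open>In Rosenthal's bound for a sum of p terms, p^q is joined by m p; this is the sum of the
  two relative to p^q. Under truncation it stays bounded although m does not.\<close>

definition \<theta> :: real where "\<theta> = 1 + real p powr (1 - q) * m"

lemma \<theta>_ge_1: "1 \<le> \<theta>"
  using m_nonneg by (simp add: \<theta>_def)

text \<open>The squared norm of y is its mean p s plus the diagonal form with unit
  coefficients.\<close>

lemma sum_squares_moment: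
  shows "integrable M (\<lambda>x. (\<Sum>j<p. (y j x)\<^sup>2) powr q)"
    and "expectation (\<lambda>x. (\<Sum>j<p. (y j x)\<^sup>2) powr q) \<le> norm_const q s C * \<theta> * real p powr q"
proof -
  let ?R = "rosenthal_const q"
  let ?D = "\<lambda>x. \<Sum>j<p. 1 * ((y j x)\<^sup>2 - s)"
  let ?P = "real p powr q"
  have p1: "1 \<le> real p" using p by simp
  have bnd: "(\<Sum>j<p. (y j x)\<^sup>2) powr q \<le> 2 powr q * (\<bar>?D x\<bar> powr q + (real p * s) powr q)" for x
  proof -
    have "(\<Sum>j<p. (y j x)\<^sup>2) = ?D x + real p * s" by (simp add: sum_subtractf)
    then have "(\<Sum>j<p. (y j x)\<^sup>2) powr q = \<bar>?D x + real p * s\<bar> powr q"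
      by (metis abs_of_nonneg sum_nonneg zero_le_power2)
    also have "\<dots> \<le> 2 powr q * (\<bar>?D x\<bar> powr q + \<bar>real p * s\<bar> powr q)"
      using q by (intro abs_add_powr_le) auto
    finally show ?thesis using s_nonneg by simp
  qed
  have [measurable]: "(\<lambda>x. (\<Sum>j<p. (y j x)\<^sup>2)) \<in> borel_measurable M"
    using meas by (intro borel_measurable_sum borel_measurable_power) auto
  have ib: "integrable M (\<lambda>x. 2 powr q * (\<bar>?D x\<bar> powr q + (real p * s) powr q))"
    using diagonal_form(1)[of "\<lambda>_. 1"] by simp
  show i: "integrable M (\<lambda>x. (\<Sum>j<p. (y j x)\<^sup>2) powr q)"
    by (rule Bochner_Integration.integrable_bound[OF ib])
       (use bnd in \<open>auto intro!: AE_I2 intro: order_trans[OF _ abs_ge_self]\<close>)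
  have "expectation (\<lambda>x. (\<Sum>j<p. (y j x)\<^sup>2) powr q)
      \<le> expectation (\<lambda>x. 2 powr q * (\<bar>?D x\<bar> powr q + (real p * s) powr q))"
    by (intro integral_mono i ib bnd)
  also have "\<dots> = 2 powr q * (expectation (\<lambda>x. \<bar>?D x\<bar> powr q) + ?P * s powr q)"
    using diagonal_form(1)[of "\<lambda>_. 1"] s_nonneg by (simp add: prob_space powr_mult)
  also have "\<dots> \<le> 2 powr q * (?R * (C powr (q / 2) * real p powr (q / 2) + 2 powr q * (m + s powr q) * real p) + ?P * s powr q)"
    using diagonal_form(2)[of "\<lambda>_. 1"] by simp
  also have "\<dots> \<le> norm_const q s C * \<theta> * ?P"
  proof -
    have R: "0 \<le> ?R" by (rule rosenthal_const_nonneg)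
    have \<theta>P: "\<theta> * ?P = ?P + m * real p"
      using p by (simp add: \<theta>_def algebra_simps powr_diff)
    have P: "?P \<le> \<theta> * ?P" using \<theta>_ge_1 by (simp add: mult_right_mono[of 1 \<theta> ?P, simplified])
    have "real p powr (q / 2) \<le> ?P" using p1 q by (intro powr_mono) auto
    with P have 1: "real p powr (q / 2) \<le> \<theta> * ?P" by linarith
    have "real p powr 1 \<le> ?P" using p1 q by (intro powr_mono) auto
    then have "real p \<le> ?P" by simp
    then have "(m + s powr q) * real p \<le> m * real p + s powr q * ?P"
      by (simp add: distrib_right mult_left_mono)
    also have "\<dots> \<le> (1 + s powr q) * (\<theta> * ?P)"
      unfolding \<theta>P using m_nonneg by (simp add: algebra_simps)
    finally have 2: "(m + s powr q) * real p \<le> (1 + s powr q) * (\<theta> * ?P)" .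
    have "?R * (C powr (q / 2) * real p powr (q / 2) + 2 powr q * ((m + s powr q) * real p)) + s powr q * ?P
      \<le> ?R * (C powr (q / 2) * (\<theta> * ?P) + 2 powr q * ((1 + s powr q) * (\<theta> * ?P))) + s powr q * (\<theta> * ?P)"
      using 1 2 P R by (intro add_mono mult_left_mono) auto
    then have "2 powr q * (?R * (C powr (q / 2) * real p powr (q / 2) + 2 powr q * ((m + s powr q) * real p)) + s powr q * ?P)
      \<le> 2 powr q * (?R * (C powr (q / 2) * (\<theta> * ?P) + 2 powr q * ((1 + s powr q) * (\<theta> * ?P))) + s powr q * (\<theta> * ?P))"
      by (intro mult_left_mono) auto
    moreover have "0 \<le> \<theta> * ?P" using \<theta>_ge_1 by simp
    ultimately show ?thesis unfolding norm_const_def by (simp add: algebra_simps)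
  qed
  finally show "expectation (\<lambda>x. (\<Sum>j<p. (y j x)\<^sup>2) powr q) \<le> norm_const q s C * \<theta> * real p powr q" .
qed

text \<open>Here W comes from the operator bound: the squared norm of V is at most L^2 times that of
  y. Rows have norm at most L, which settles \<Phi> and F.\<close>

lemma quadratic_form_operator:
  fixes a :: "nat \<Rightarrow> nat \<Rightarrow> real"
  assumes L0: "0 \<le> L" and op: "\<And>x. (\<Sum>i<p. (\<Sum>j<p. a i j * x j)\<^sup>2) \<le> L\<^sup>2 * (\<Sum>j<p. (x j)\<^sup>2)"
    and row: "\<And>i. i < p \<Longrightarrow> (\<Sum>j<p. (a i j)\<^sup>2) \<le> L\<^sup>2"
  shows "(\<integral>\<^sup>+x. \<bar>centred_form a x\<bar> powr q \<partial>M)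
    \<le> ennreal (quad_const q s C * (2 + norm_const q s C) * \<theta> * L powr q * (real p powr (q / 2) + (1 + m) * real p))"
proof -
  let ?N = "\<lambda>x. \<Sum>j<p. (y j x)\<^sup>2"
  let ?P = "real p powr (q / 2)"
  have L: "(L\<^sup>2) powr (q / 2) = L powr q"
    using abs_powr_eq_square_powr[of L q] L0 by simp
  have P0: "0 < ?P" using p by simp
  define W where "W = L powr q * (?P + norm_const q s C * \<theta> * ?P)"
  have W: "integrable M (\<lambda>x. (\<Sum>i\<in>T. (\<Sum>j\<in>{..<p} - T. a i j * y j x)\<^sup>2) powr (q / 2)) \<and>
     expectation (\<lambda>x. (\<Sum>i\<in>T. (\<Sum>j\<in>{..<p} - T. a i j * y j x)\<^sup>2) powr (q / 2)) \<le> W"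
    if T: "T \<subseteq> {..<p}" for T
  proof -
    let ?V = "\<lambda>x. \<Sum>i\<in>T. (\<Sum>j\<in>{..<p} - T. a i j * y j x)\<^sup>2"
    have V: "?V x \<le> L\<^sup>2 * ?N x" for x
    proof -
      \<comment> \<open>Setting the coordinates in T to zero turns the partial sums into a full
        matrix-vector product, to which \<open>op\<close> applies.\<close>
      define z where "z j = (if j \<in> T then 0 else y j x)" for j
      have z: "(\<Sum>j\<in>{..<p} - T. a i j * y j x) = (\<Sum>j<p. a i j * z j)" for i
        by (rule sum.mono_neutral_cong_left) (auto simp: z_def)
      have "?V x \<le> (\<Sum>i<p. (\<Sum>j<p. a i j * z j)\<^sup>2)"
        unfolding z using T by (intro sum_mono2) auto
      also have "\<dots> \<le> L\<^sup>2 * (\<Sum>j<p. (z j)\<^sup>2)" by (rule op)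
      also have "\<dots> \<le> L\<^sup>2 * ?N x" by (intro mult_left_mono sum_mono) (auto simp: z_def)
      finally show ?thesis .
    qed
    have bnd: "?V x powr (q / 2) \<le> L powr q * (?P + ?N x powr q / ?P)" for x
    proof -
      have "?V x powr (q / 2) \<le> (L\<^sup>2 * ?N x) powr (q / 2)"
        using V q by (intro powr_mono2 sum_nonneg) auto
      also have "\<dots> = L powr q * ?N x powr (q / 2)"
        using L by (simp add: powr_mult sum_nonneg)
      \<comment> \<open>Only the q-th moment of the squared norm, of order p^q, is available.
        Comparing at the level p^(q/2) turns it into a bound of order p^(q/2) for the moment of
        order q / 2.\<close>
      also have "?N x powr (q / 2) \<le> ?P + ?N x powr q / ?P"
      proof (cases "?N x powr (q / 2) \<le> ?P")
        case True
        then show ?thesis using P0 by (simp add: add_increasing2)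
      next
        case False
        then have "?N x powr (q / 2) * ?P \<le> ?N x powr (q / 2) * ?N x powr (q / 2)"
          by (intro mult_left_mono) auto
        also have "\<dots> = ?N x powr q" by (simp add: powr_add[symmetric])
        finally have "?N x powr (q / 2) \<le> ?N x powr q / ?P" using P0 by (simp add: pos_le_divide_eq)
        then show ?thesis using P0 by linarith
      qed
      finally show ?thesis by (simp add: mult_left_mono)
    qed
    have [measurable]: "?V \<in> borel_measurable M"
      using meas T by (intro borel_measurable_sum borel_measurable_power borel_measurable_times) auto
    have ib: "integrable M (\<lambda>x. L powr q * (?P + ?N x powr q / ?P))"
      using sum_squares_moment(1) by auto
    have i: "integrable M (\<lambda>x. ?V x powr (q / 2))"
      by (rule Bochner_Integration.integrable_bound[OF ib])
         (use bnd in \<open>auto intro!: AE_I2 intro: order_trans[OF _ abs_ge_self]\<close>)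
    have "expectation (\<lambda>x. ?V x powr (q / 2)) \<le> expectation (\<lambda>x. L powr q * (?P + ?N x powr q / ?P))"
      by (intro integral_mono i ib bnd)
    also have "\<dots> = L powr q * (?P + expectation (\<lambda>x. ?N x powr q) / ?P)"
      using sum_squares_moment(1) by (simp add: prob_space)
    also have "\<dots> \<le> L powr q * (?P + norm_const q s C * \<theta> * (real p powr q) / ?P)"
      using sum_squares_moment(2) P0 by (intro mult_left_mono add_left_mono divide_right_mono) auto
    also have "real p powr q = ?P * ?P" by (simp add: powr_add[symmetric])
    finally show ?thesis using i P0 by (simp add: W_def mult.assoc)
  qed
  have "(\<integral>\<^sup>+x. \<bar>centred_form a x\<bar> powr q \<partial>M)
      \<le> ennreal (quad_const q s C * ((real p * L\<^sup>2) powr (q / 2) + (1 + m) * (real p * L powr q) + W))"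
  proof (intro quadratic_form)
    have "(\<Sum>i<p. (\<Sum>j<p. (a i j)\<^sup>2) powr (q / 2)) \<le> (\<Sum>i<p. (L\<^sup>2) powr (q / 2))"
      using row q by (intro sum_mono powr_mono2 sum_nonneg) auto
    then show "(\<Sum>i<p. (\<Sum>j<p. (a i j)\<^sup>2) powr (q / 2)) \<le> real p * L powr q" by (simp add: L)
    have "(\<Sum>i<p. \<Sum>j<p. (a i j)\<^sup>2) \<le> (\<Sum>i<p. L\<^sup>2)" using row by (intro sum_mono) auto
    then show "(\<Sum>i<p. \<Sum>j<p. (a i j)\<^sup>2) \<le> real p * L\<^sup>2" by simp
  qed (use W in auto)
  also have "\<dots> \<le> ennreal (quad_const q s C * (2 + norm_const q s C) * \<theta> * L powr q * (?P + (1 + m) * real p))"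
  proof (rule ennreal_leI)
    have N: "0 \<le> norm_const q s C" unfolding norm_const_def using rosenthal_const_nonneg[of q]
      by (intro mult_nonneg_nonneg add_nonneg_nonneg) auto
    have "?P + (1 + m) * real p + (?P + norm_const q s C * \<theta> * ?P)
        \<le> (2 + norm_const q s C) * \<theta> * (?P + (1 + m) * real p)"
    proof -
      have m: "0 \<le> (1 + m) * real p" using m_nonneg by simp
      have "1 * ((1 + m) * real p) \<le> (2 + norm_const q s C) * \<theta> * ((1 + m) * real p)"
        using \<theta>_ge_1 N m mult_mono[of 1 "2 + norm_const q s C" 1 \<theta>] by (intro mult_right_mono) auto
      moreover have "2 * ?P + norm_const q s C * \<theta> * ?P \<le> 2 * \<theta> * ?P + norm_const q s C * \<theta> * ?P"
        using \<theta>_ge_1 P0 by (intro add_right_mono mult_right_mono) auto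
      ultimately show ?thesis by (simp add: algebra_simps)
    qed
    then have "L powr q * (?P + (1 + m) * real p + (?P + norm_const q s C * \<theta> * ?P))
        \<le> L powr q * ((2 + norm_const q s C) * \<theta> * (?P + (1 + m) * real p))"
      by (intro mult_left_mono) auto
    then show "quad_const q s C * ((real p * L\<^sup>2) powr (q / 2) + (1 + m) * (real p * L powr q) + W)
      \<le> quad_const q s C * (2 + norm_const q s C) * \<theta> * L powr q * (?P + (1 + m) * real p)"
      unfolding mult.assoc[of "quad_const q s C"]
      by (intro mult_left_mono quad_const_nonneg) (simp add: W_def powr_mult L algebra_simps)
  qed
  finally show ?thesis .
qed

end

section \<open>Self-normalisation\<close>

text \<open>Stated for real index functions and without eigenvalues, so that real and imaginary
  parts of a complex matrix, transposes and Frobenius bounds all provide instances.\<close>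

definition op_bounded :: "nat \<Rightarrow> (nat \<Rightarrow> nat \<Rightarrow> real) \<Rightarrow> real \<Rightarrow> bool" where
  "op_bounded p a L \<longleftrightarrow> (\<forall>x. (\<Sum>i<p. (\<Sum>j<p. a i j * x j)\<^sup>2) \<le> L\<^sup>2 * (\<Sum>j<p. (x j)\<^sup>2))"

lemma op_boundedD:
  "op_bounded p a L \<Longrightarrow> (\<Sum>i<p. (\<Sum>j<p. a i j * x j)\<^sup>2) \<le> L\<^sup>2 * (\<Sum>j<p. (x j)\<^sup>2)"
  by (simp add: op_bounded_def)

lemma op_bounded_bilinear:
  assumes op: "op_bounded p a L" and L: "0 \<le> L"
  shows "\<bar>\<Sum>i<p. \<Sum>j<p. a i j * u i * x j\<bar> \<le> L * sqrt (\<Sum>i<p. (u i)\<^sup>2) * sqrt (\<Sum>j<p. (x j)\<^sup>2)"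
proof -
  have "(\<Sum>i<p. \<Sum>j<p. a i j * u i * x j) = (\<Sum>i<p. u i * (\<Sum>j<p. a i j * x j))"
    by (simp add: sum_distrib_left mult_ac)
  also have "\<bar>\<dots>\<bar> \<le> sqrt ((\<Sum>i<p. (u i)\<^sup>2) * (\<Sum>i<p. (\<Sum>j<p. a i j * x j)\<^sup>2))"
    by (intro real_le_rsqrt) (simp add: Cauchy_Schwarz_ineq_sum)
  also have "\<dots> \<le> sqrt ((\<Sum>i<p. (u i)\<^sup>2) * (L\<^sup>2 * (\<Sum>j<p. (x j)\<^sup>2)))"
    by (intro real_sqrt_le_mono mult_left_mono op_boundedD op sum_nonneg) auto
  also have "\<dots> = L * sqrt (\<Sum>i<p. (u i)\<^sup>2) * sqrt (\<Sum>j<p. (x j)\<^sup>2)"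
    using L by (simp add: real_sqrt_mult)
  finally show ?thesis .
qed

text \<open>If u is the transpose applied to x, the squared norm of u is the bilinear form at x and
  u, hence at most L |x| |u|; one factor |u| cancels.\<close>

lemma op_bounded_transpose:
  assumes op: "op_bounded p a L" and L: "0 \<le> L"
  shows "op_bounded p (\<lambda>i j. a j i) L"
  unfolding op_bounded_def
proof
  fix x :: "nat \<Rightarrow> real"
  define u where "u i = (\<Sum>j<p. a j i * x j)" for i
  define N where "N = sqrt (\<Sum>i<p. (u i)\<^sup>2)"
  have N0: "0 \<le> N" and N: "N\<^sup>2 = (\<Sum>i<p. (u i)\<^sup>2)" by (auto simp: N_def sum_nonneg)
  let ?X = "sqrt (\<Sum>j<p. (x j)\<^sup>2)"
  have "N\<^sup>2 = (\<Sum>i<p. \<Sum>j<p. a j i * x j * u i)"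
    unfolding N by (simp add: power2_eq_square) (simp add: u_def sum_distrib_right)
  also have "\<dots> = (\<Sum>j<p. \<Sum>i<p. a j i * x j * u i)" by (rule sum.swap)
  also have "\<dots> \<le> L * ?X * N"
    using op_bounded_bilinear[OF op L, of x u] by (simp add: N_def)
  finally have "N * N \<le> L * ?X * N" by (simp add: power2_eq_square)
  then have "N \<le> L * ?X"
    using N0 L by (cases "N = 0") (auto simp: sum_nonneg)
  then have "N\<^sup>2 \<le> (L * ?X)\<^sup>2" using N0 by (intro power_mono)
  then show "(\<Sum>i<p. (\<Sum>j<p. a j i * x j)\<^sup>2) \<le> L\<^sup>2 * (\<Sum>j<p. (x j)\<^sup>2)"
    by (simp add: N power_mult_distrib sum_nonneg flip: u_def)
qed

text \<open>Row i is the transpose applied to the i-th unit vector.\<close>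

lemma op_bounded_row:
  assumes op: "op_bounded p a L" and L: "0 \<le> L" and i: "i < p"
  shows "(\<Sum>j<p. (a i j)\<^sup>2) \<le> L\<^sup>2"
  using op_boundedD[OF op_bounded_transpose[OF op L], of "\<lambda>j. if j = i then 1 else 0"] i
  by (simp add: if_distrib[of "\<lambda>x. _ * x"] if_distrib[of "\<lambda>x. x\<^sup>2"] sum.delta cong: if_cong)

lemma op_bounded_frobenius:
  assumes F: "(\<Sum>i<p. \<Sum>j<p. (a i j)\<^sup>2) \<le> F\<^sup>2"
  shows "op_bounded p a F"
  unfolding op_bounded_def
proof
  fix x :: "nat \<Rightarrow> real"
  have "(\<Sum>i<p. (\<Sum>j<p. a i j * x j)\<^sup>2) \<le> (\<Sum>i<p. (\<Sum>j<p. (a i j)\<^sup>2) * (\<Sum>j<p. (x j)\<^sup>2))"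
    by (intro sum_mono Cauchy_Schwarz_ineq_sum)
  also have "\<dots> \<le> F\<^sup>2 * (\<Sum>j<p. (x j)\<^sup>2)"
    unfolding sum_distrib_right[symmetric] by (intro mult_right_mono F sum_nonneg) auto
  finally show "(\<Sum>i<p. (\<Sum>j<p. a i j * x j)\<^sup>2) \<le> F\<^sup>2 * (\<Sum>j<p. (x j)\<^sup>2)" .
qed

text \<open>The factor sqrt p is the one that cancels against the p^(-1/2) error of
  \<open>nu2_approx\<close>.\<close>

lemma abs_trace_le:
  fixes a :: "nat \<Rightarrow> nat \<Rightarrow> real"
  assumes F: "(\<Sum>i<p. \<Sum>j<p. (a i j)\<^sup>2) \<le> F\<^sup>2" and F0: "0 \<le> F"
  shows "\<bar>\<Sum>i<p. a i i\<bar> \<le> sqrt (real p) * F"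
proof -
  have "(\<Sum>i<p. a i i)\<^sup>2 = (\<Sum>i<p. 1 * a i i)\<^sup>2" by simp
  also have "\<dots> \<le> (\<Sum>i<p. 1\<^sup>2) * (\<Sum>i<p. (a i i)\<^sup>2)" by (rule Cauchy_Schwarz_ineq_sum)
  also have "\<dots> \<le> real p * F\<^sup>2"
  proof -
    have "(\<Sum>i<p. (a i i)\<^sup>2) \<le> (\<Sum>i<p. \<Sum>j<p. (a i j)\<^sup>2)"
      by (intro sum_mono) (auto intro!: member_le_sum)
    then show ?thesis using F by (auto intro!: mult_left_mono)
  qed
  finally have "\<bar>\<Sum>i<p. a i i\<bar> \<le> sqrt (real p * F\<^sup>2)" by (intro real_le_rsqrt) simp
  then show ?thesis using F0 by (simp add: real_sqrt_mult)
qed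

lemma op_bounded_sum:
  assumes op: "op_bounded p a L" and L: "0 \<le> L"
  shows "\<bar>\<Sum>i<p. \<Sum>j<p. a i j\<bar> \<le> real p * L"
  using op_bounded_bilinear[OF op L, of "\<lambda>_. 1" "\<lambda>_. 1"] by (simp add: mult_ac)

text \<open>These sums are the coefficients of the linear form that appears when y is shifted by t:
  the matrix and its transpose applied to the vector of ones.\<close>

lemma op_bounded_row_col_sums:
  assumes op: "op_bounded p a L" and L: "0 \<le> L"
  shows "(\<Sum>j<p. (\<Sum>i<p. a i j + a j i)\<^sup>2) \<le> 4 * real p * L\<^sup>2"
proof -
  have "(\<Sum>j<p. (\<Sum>i<p. a i j + a j i)\<^sup>2) \<le> (\<Sum>j<p. 2 * (\<Sum>i<p. a i j * 1)\<^sup>2 + 2 * (\<Sum>i<p. a j i * 1)\<^sup>2)"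
  proof (intro sum_mono)
    fix j
    have "(u + v)\<^sup>2 \<le> 2 * u\<^sup>2 + 2 * v\<^sup>2" for u v :: real
      using zero_le_power2[of "u - v"] by (simp add: power2_eq_square algebra_simps)
    then show "(\<Sum>i<p. a i j + a j i)\<^sup>2 \<le> 2 * (\<Sum>i<p. a i j * 1)\<^sup>2 + 2 * (\<Sum>i<p. a j i * 1)\<^sup>2"
      by (simp add: sum.distrib)
  qed
  also have "\<dots> = 2 * (\<Sum>j<p. (\<Sum>i<p. a i j * 1)\<^sup>2) + 2 * (\<Sum>j<p. (\<Sum>i<p. a j i * 1)\<^sup>2)"
    by (simp only: sum.distrib sum_distrib_left)
  also have "\<dots> \<le> 2 * (L\<^sup>2 * (\<Sum>j<p. 1\<^sup>2)) + 2 * (L\<^sup>2 * (\<Sum>j<p. 1\<^sup>2))"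
    by (intro add_mono mult_left_mono op_boundedD op op_bounded_transpose L) auto
  also have "\<dots> = 4 * real p * L\<^sup>2" by simp
  finally show ?thesis .
qed

section \<open>Deterministic comparison with the unnormalised form\<close>

lemma abs_inverse_square_diff:
  fixes \<mu> t :: real
  assumes mu: "0 < \<mu>" and t: "\<mu> / 2 \<le> \<mu> + t"
  shows "\<bar>1 / (\<mu> + t)\<^sup>2 - 1 / \<mu>\<^sup>2\<bar> \<le> 6 / \<mu> ^ 3 * \<bar>t\<bar>" "1 / (\<mu> + t)\<^sup>2 \<le> 4 / \<mu>\<^sup>2"
proof -
  define v where "v = \<mu> + t"
  have v: "\<mu> / 2 \<le> v" "0 < v" using t mu by (auto simp: v_def)
  have iv: "1 / v \<le> 2 / \<mu>" using v mu by (simp add: field_simps)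
  have "1 / v * (1 / v) \<le> 2 / \<mu> * (2 / \<mu>)" using iv v mu by (intro mult_mono) auto
  then have iv2: "1 / v\<^sup>2 \<le> 4 / \<mu>\<^sup>2" by (simp add: power2_eq_square)
  then show "1 / (\<mu> + t)\<^sup>2 \<le> 4 / \<mu>\<^sup>2" by (simp add: v_def)
  have t_v: "t = v - \<mu>" by (simp add: v_def)
  have "1 / v\<^sup>2 - 1 / \<mu>\<^sup>2 = - t * ((1 / v\<^sup>2) / \<mu> + (1 / v) / \<mu>\<^sup>2)"
    using v mu unfolding t_v by (simp add: field_simps power2_eq_square)
  also have "\<bar>\<dots>\<bar> = \<bar>t\<bar> * ((1 / v\<^sup>2) / \<mu> + (1 / v) / \<mu>\<^sup>2)"
    using v mu by (simp add: abs_mult abs_of_nonneg add_nonneg_nonneg)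
  also have "\<dots> \<le> \<bar>t\<bar> * ((4 / \<mu>\<^sup>2) / \<mu> + (2 / \<mu>) / \<mu>\<^sup>2)"
    using iv iv2 mu by (intro mult_left_mono add_mono divide_right_mono) auto
  also have "\<dots> = 6 / \<mu> ^ 3 * \<bar>t\<bar>"
    using mu by (simp add: field_simps power2_eq_square power3_eq_cube)
  finally show "\<bar>1 / (\<mu> + t)\<^sup>2 - 1 / \<mu>\<^sup>2\<bar> \<le> 6 / \<mu> ^ 3 * \<bar>t\<bar>" by (simp add: v_def)
qed

lemma weighted_am_gm:
  fixes b c u :: real
  assumes c: "0 < c"
  shows "2 * (b * \<bar>u\<bar>) \<le> b\<^sup>2 / c + c * u\<^sup>2"
proof -
  have "0 \<le> (b - c * \<bar>u\<bar>)\<^sup>2" by simp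
  then have "c * (2 * (b * \<bar>u\<bar>)) \<le> b\<^sup>2 + c\<^sup>2 * u\<^sup>2"
    by (simp add: power2_diff power_mult_distrib mult_ac)
  also have "\<dots> = c * (b\<^sup>2 / c + c * u\<^sup>2)" using c by (simp add: field_simps power2_eq_square)
  finally show ?thesis using c by (simp add: mult_le_cancel_left_pos)
qed

lemma quadratic_shift:
  fixes a :: "nat \<Rightarrow> nat \<Rightarrow> real" and y :: "nat \<Rightarrow> real"
  shows "(\<Sum>i<p. \<Sum>j<p. a i j * ((y i - t) * (y j - t)))
    = (\<Sum>i<p. \<Sum>j<p. a i j * (y i * y j)) - t * (\<Sum>j<p. (\<Sum>i<p. a i j + a j i) * y j)
      + t\<^sup>2 * (\<Sum>i<p. \<Sum>j<p. a i j)"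
proof -
  have "(\<Sum>i<p. \<Sum>j<p. a i j * ((y i - t) * (y j - t)))
    = (\<Sum>i<p. \<Sum>j<p. a i j * (y i * y j) - t * (a i j * y i) - t * (a i j * y j) + t\<^sup>2 * a i j)"
    by (intro sum.cong refl) (simp add: power2_eq_square algebra_simps)
  also have "\<dots> = (\<Sum>i<p. \<Sum>j<p. a i j * (y i * y j)) - t * (\<Sum>i<p. \<Sum>j<p. a i j * y i)
     - t * (\<Sum>i<p. \<Sum>j<p. a i j * y j) + t\<^sup>2 * (\<Sum>i<p. \<Sum>j<p. a i j)"
    by (simp only: sum.distrib sum_subtractf sum_distrib_left)
  also have "(\<Sum>i<p. \<Sum>j<p. a i j * y j) = (\<Sum>j<p. \<Sum>i<p. a i j * y j)" by (rule sum.swap)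
  finally show ?thesis
    by (simp add: sum.distrib sum_distrib_right distrib_right distrib_left)
qed

text \<open>Everything caused by the random normaliser is pressed into l^2 / (p L) and F (1 + p
  t^2), both with manageable moments. L and F are separate because l scales with the operator norm
  whereas the trace scales with the Frobenius norm.\<close>

lemma self_normalised_quadratic_bound:
  fixes a :: "nat \<Rightarrow> nat \<Rightarrow> real" and y :: "nat \<Rightarrow> real" and \<mu> s :: real
  assumes p: "0 < p" and mu: "0 < \<mu>" and s: "0 \<le> s" and L: "0 < L" "L \<le> F"
    and op: "op_bounded p a L" and F: "(\<Sum>i<p. \<Sum>j<p. (a i j)\<^sup>2) \<le> F\<^sup>2"
    and t: "\<mu> / 2 \<le> \<mu> + t" and nu: "\<bar>\<nu> - s / \<mu>\<^sup>2\<bar> \<le> k / sqrt (real p)"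
  defines "Q \<equiv> (\<Sum>i<p. \<Sum>j<p. a i j * (y i * y j)) - s * (\<Sum>i<p. a i i)"
    and "l \<equiv> \<Sum>j<p. (\<Sum>i<p. a i j + a j i) * y j"
  shows "\<bar>(\<Sum>i<p. \<Sum>j<p. a i j * ((y i - t) / (\<mu> + t) * ((y j - t) / (\<mu> + t)))) - \<nu> * (\<Sum>i<p. a i i)\<bar>
     \<le> (8 / \<mu>\<^sup>2 + 6 * s / \<mu> ^ 3 + k) * (\<bar>Q\<bar> + l\<^sup>2 / (real p * L) + F * (1 + real p * t\<^sup>2))"
proof -
  define z where "z = real p * t\<^sup>2"
  let ?tr = "\<Sum>i<p. a i i" and ?v = "1 / (\<mu> + t)\<^sup>2" and ?S = "\<Sum>i<p. \<Sum>j<p. a i j"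
  have F0: "0 < F" using L by simp
  have z0: "0 \<le> z" by (simp add: z_def)
  have "0 \<le> k / sqrt (real p)" by (rule order_trans[OF abs_ge_zero nu])
  then have k0: "0 \<le> k" using p by (simp add: zero_le_divide_iff)
  have tr: "\<bar>?tr\<bar> \<le> sqrt (real p) * F" using F F0 by (intro abs_trace_le) auto
  have "(\<Sum>i<p. \<Sum>j<p. a i j * ((y i - t) / (\<mu> + t) * ((y j - t) / (\<mu> + t))))
      = ?v * (\<Sum>i<p. \<Sum>j<p. a i j * ((y i - t) * (y j - t)))"
    by (simp add: sum_distrib_left power2_eq_square)
  also have "\<dots> = ?v * (Q + s * ?tr - t * l + t\<^sup>2 * ?S)"
    unfolding quadratic_shift Q_def l_def by simp
  \<comment> \<open>Three errors: the shifted form itself, the change of normaliser acting on the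
    mean s tr A, and the inexact centring \<nu>.\<close>
  finally have "(\<Sum>i<p. \<Sum>j<p. a i j * ((y i - t) / (\<mu> + t) * ((y j - t) / (\<mu> + t)))) - \<nu> * ?tr
      = ?v * (Q - t * l + t\<^sup>2 * ?S) + s * ?tr * (?v - 1 / \<mu>\<^sup>2) + (s / \<mu>\<^sup>2 - \<nu>) * ?tr"
    by (simp add: algebra_simps)
  also have "\<bar>\<dots>\<bar> \<le> \<bar>?v * (Q - t * l + t\<^sup>2 * ?S)\<bar> + \<bar>s * ?tr * (?v - 1 / \<mu>\<^sup>2)\<bar> + \<bar>(s / \<mu>\<^sup>2 - \<nu>) * ?tr\<bar>"
    by (intro order_trans[OF abs_triangle_ineq] add_mono order_refl)
  also have "\<dots> \<le> 8 / \<mu>\<^sup>2 * (\<bar>Q\<bar> + l\<^sup>2 / (real p * L) + F * (1 + z)) + 6 * s / \<mu> ^ 3 * (F * (1 + z)) + k * (F * (1 + z))"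
  proof (intro add_mono)
    \<comment> \<open>The weight p L makes the t-part equal to L p t^2, the size of the term with
      the sum of all entries.\<close>
    have "2 * (\<bar>l\<bar> * \<bar>t\<bar>) \<le> \<bar>l\<bar>\<^sup>2 / (real p * L) + real p * L * t\<^sup>2"
      using p L by (intro weighted_am_gm) auto
    then have 1: "2 * \<bar>t * l\<bar> \<le> l\<^sup>2 / (real p * L) + L * z"
      by (simp add: abs_mult z_def mult_ac)
    have "t\<^sup>2 * \<bar>?S\<bar> \<le> t\<^sup>2 * (real p * L)" using op L by (intro mult_left_mono op_bounded_sum) auto
    then have 2: "\<bar>t\<^sup>2 * ?S\<bar> \<le> L * z" by (simp add: z_def abs_mult mult_ac)
    have 3: "L * z \<le> F * z" "0 \<le> L * z" "0 \<le> l\<^sup>2 / (real p * L)"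
      using L z0 by (auto intro: mult_right_mono)
    have "\<bar>Q - t * l + t\<^sup>2 * ?S\<bar> \<le> \<bar>Q - t * l\<bar> + \<bar>t\<^sup>2 * ?S\<bar>"
      by (rule abs_triangle_ineq)
    also have "\<dots> \<le> \<bar>Q\<bar> + \<bar>t * l\<bar> + \<bar>t\<^sup>2 * ?S\<bar>"
      by (intro add_right_mono abs_triangle_ineq4)
    also have "\<dots> \<le> 2 * (\<bar>Q\<bar> + l\<^sup>2 / (real p * L) + (F + F * z))"
    proof -
      have "Q' + b + c \<le> 2 * (Q' + d + (F + g))"
        if "2 * b \<le> d + e" "c \<le> e" "e \<le> g" "0 \<le> e" "0 \<le> d" "0 \<le> Q'" for Q' b c d e g :: real
        using that F0 by simp
      from this[OF 1 2 3 abs_ge_zero] show ?thesis .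
    qed
    finally have "\<bar>Q - t * l + t\<^sup>2 * ?S\<bar> \<le> 2 * (\<bar>Q\<bar> + l\<^sup>2 / (real p * L) + F * (1 + z))"
      by (simp only: distrib_left[of F] mult_1_right)
    then have "?v * \<bar>Q - t * l + t\<^sup>2 * ?S\<bar> \<le> 4 / \<mu>\<^sup>2 * (2 * (\<bar>Q\<bar> + l\<^sup>2 / (real p * L) + F * (1 + z)))"
      using abs_inverse_square_diff(2)[OF mu t] by (intro mult_mono) auto
    then show "\<bar>?v * (Q - t * l + t\<^sup>2 * ?S)\<bar> \<le> 8 / \<mu>\<^sup>2 * (\<bar>Q\<bar> + l\<^sup>2 / (real p * L) + F * (1 + z))"
      by (simp add: abs_mult)
    \<comment> \<open>The factor sqrt p of the trace combines with the |t| from the normaliser to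
      sqrt z.\<close>
    have "sqrt (real p) * \<bar>t\<bar> = sqrt z" by (simp add: z_def real_sqrt_mult)
    also have "\<dots> \<le> sqrt ((1 + z)\<^sup>2)"
      using z0 by (intro real_sqrt_le_mono) (simp add: power2_eq_square algebra_simps)
    also have "\<dots> = 1 + z" using z0 by simp
    finally have pt: "sqrt (real p) * \<bar>t\<bar> \<le> 1 + z" .
    have "\<bar>s * ?tr * (?v - 1 / \<mu>\<^sup>2)\<bar> = s * (\<bar>?tr\<bar> * \<bar>?v - 1 / \<mu>\<^sup>2\<bar>)" using s by (simp add: abs_mult)
    also have "\<dots> \<le> s * ((sqrt (real p) * F) * (6 / \<mu> ^ 3 * \<bar>t\<bar>))"
      using tr abs_inverse_square_diff(1)[OF mu t] s F0 by (intro mult_left_mono mult_mono) auto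
    also have "\<dots> = 6 * s / \<mu> ^ 3 * (F * (sqrt (real p) * \<bar>t\<bar>))" by simp
    also have "\<dots> \<le> 6 * s / \<mu> ^ 3 * (F * (1 + z))"
      using pt s mu F0 by (intro mult_left_mono) auto
    finally show "\<bar>s * ?tr * (?v - 1 / \<mu>\<^sup>2)\<bar> \<le> 6 * s / \<mu> ^ 3 * (F * (1 + z))" .
    have "\<bar>(s / \<mu>\<^sup>2 - \<nu>) * ?tr\<bar> \<le> k / sqrt (real p) * (sqrt (real p) * F)"
      unfolding abs_mult using nu tr k0 by (intro mult_mono) (auto simp: abs_minus_commute)
    also have "\<dots> = k * F" using p by simp
    also have "\<dots> \<le> k * (F * (1 + z))" using k0 F0 z0 by (intro mult_left_mono) auto
    finally show "\<bar>(s / \<mu>\<^sup>2 - \<nu>) * ?tr\<bar> \<le> k * (F * (1 + z))" .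
  qed
  also have "\<dots> \<le> 8 / \<mu>\<^sup>2 * (\<bar>Q\<bar> + l\<^sup>2 / (real p * L) + F * (1 + z))
      + 6 * s / \<mu> ^ 3 * (\<bar>Q\<bar> + l\<^sup>2 / (real p * L) + F * (1 + z))
      + k * (\<bar>Q\<bar> + l\<^sup>2 / (real p * L) + F * (1 + z))"
    using s mu k0 L by (intro add_mono mult_left_mono order_refl) auto
  finally show ?thesis unfolding z_def by (simp add: distrib_right)
qed

section \<open>Exponential estimates for the lower tail\<close>

lemma powr_le_exp:
  fixes x b k :: real
  assumes "0 < x" "0 < b" "0 < k"
  shows "x powr b \<le> (b / k) powr b * exp (k * x)"
proof -
  have "b * ln (x * k / b) \<le> b * (x * k / b)"
    using assms ln_le_minus_one[of "x * k / b"] by (intro mult_left_mono) auto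
  then have "(x * k / b) powr b \<le> exp (k * x)"
    using assms by (simp add: powr_def mult.commute)
  then have "(b / k) powr b * (x * k / b) powr b \<le> (b / k) powr b * exp (k * x)"
    by (intro mult_left_mono) auto
  moreover have "(b / k) powr b * (x * k / b) powr b = x powr b"
    using assms by (simp add: powr_mult[symmetric])
  ultimately show ?thesis by simp
qed

text \<open>Multiplying by 1 + u \<le> exp u suffices, since (1 + u)(1 - u + u^2) = 1 + u^3.\<close>

lemma exp_minus_le_quadratic:
  fixes u :: real
  assumes "0 \<le> u"
  shows "exp (- u) \<le> 1 - u + u\<^sup>2"
proof -
  have "1 \<le> (1 + u) * (1 - u + u\<^sup>2)"
    using assms by (simp add: algebra_simps power2_eq_square)
  also have "\<dots> \<le> exp u * (1 - u + u\<^sup>2)"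
  proof (intro mult_right_mono exp_ge_add_one_self)
    have "0 \<le> (1 - u)\<^sup>2 + u" using assms by (intro add_nonneg_nonneg) auto
    then show "0 \<le> 1 - u + u\<^sup>2" using zero_le_power2[of "u - 1/2"]
      by (simp add: power2_eq_square algebra_simps)
  qed
  finally show ?thesis by (simp add: exp_minus field_simps)
qed


text \<open>The maximum over h of the Chernoff exponent h \<mu> / 2 - h^2 (\<mu>^2 + s).\<close>

definition tail_rate :: "real \<Rightarrow> real \<Rightarrow> real" where
  "tail_rate \<mu> s = \<mu>\<^sup>2 / (16 * (\<mu>\<^sup>2 + s))"

text \<open>The last summand bounds p^(5/2) times the probability of the bad event: p^2 for the
  ratio there, and p^(1/2) for the rate. The others collect the expansion errors of the
  normaliser.\<close>

definition nu_const :: "real \<Rightarrow> real \<Rightarrow> real \<Rightarrow> real" where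
  "nu_const \<mu> s C = 4 / \<mu>\<^sup>2 * (s + 4 * rosenthal_const 2 * s)
     + 8 / \<mu> ^ 3 * (C + 2 * rosenthal_const 2 * s) + (5 / 2 / tail_rate \<mu> s) powr (5 / 2)"

text \<open>The factor 4 comes from splitting a q-th power of a sum twice; the last summand bounds
  p^(3q) times the probability of the bad event, where the form is only known to be of order F
  p^3.\<close>

definition core_const :: "real \<Rightarrow> real \<Rightarrow> real \<Rightarrow> real \<Rightarrow> real" where
  "core_const q \<mu> s C =
     (4 * (8 / \<mu>\<^sup>2 + 6 * s / \<mu> ^ 3 + nu_const \<mu> s C)) powr q
       * (1 + rosenthal_const (2 * q) * 4 powr q * (1 + s powr q)
          + 2 powr q * (1 + rosenthal_const (2 * q) * (1 + s powr q)))
     + 2 powr q * (3 * q / tail_rate \<mu> s) powr (3 * q)"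

locale positive_sample = centred_family M p "\<lambda>j x. w j x - \<mu>" q s C m
  for M :: "'a measure" and p w \<mu> q s C m +
  assumes mu: "0 < \<mu>"
    and pos: "\<And>j. j < p \<Longrightarrow> AE x in M. 0 < w j x"
begin

abbreviation t :: "'a \<Rightarrow> real" where "t x \<equiv> wbar p w x - \<mu>"

abbreviation ratio_form :: "(nat \<Rightarrow> nat \<Rightarrow> real) \<Rightarrow> 'a \<Rightarrow> real" where
  "ratio_form a x \<equiv> (\<Sum>i<p. \<Sum>j<p. a i j * ((w i x / wbar p w x - 1) * (w j x / wbar p w x - 1)))
     - nu2 M p w * (\<Sum>i<p. a i i)"

lemma w_meas[measurable]: "j < p \<Longrightarrow> w j \<in> borel_measurable M"
  using borel_measurable_add[OF meas[of j], of "\<lambda>_. \<mu>"] by simp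

lemma wbar_meas[measurable]: "wbar p w \<in> borel_measurable M"
  unfolding wbar_def using w_meas by (intro borel_measurable_divide borel_measurable_sum) auto

lemma pos_all: "AE x in M. \<forall>j<p. 0 < w j x"
  using pos by (simp add: AE_all_countable)

lemma t_eq: "t x = (\<Sum>j<p. 1 * (w j x - \<mu>)) / real p"
  using p by (simp add: wbar_def sum_subtractf field_simps)

text \<open>Up to the factor 1 / p, p t^2 is the square of the linear form with unit coefficients,
  so its q-th moment is a moment of order 2q and is of order \<open>\<theta>\<close>.\<close>

lemma t_moment:
  shows "integrable M (\<lambda>x. (real p * (t x)\<^sup>2) powr q)"
    and "expectation (\<lambda>x. (real p * (t x)\<^sup>2) powr q) \<le> rosenthal_const (2 * q) * (1 + s powr q) * \<theta>"
proof -
  let ?P = "real p powr q"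
  have P: "0 < ?P" using p by simp
  have eq: "(real p * (t x)\<^sup>2) powr q = \<bar>\<Sum>j<p. 1 * (w j x - \<mu>)\<bar> powr (2 * q) / ?P" for x
  proof -
    have "real p * (t x)\<^sup>2 = (\<Sum>j<p. 1 * (w j x - \<mu>))\<^sup>2 / real p"
      unfolding t_eq using p by (simp add: power_divide power2_eq_square)
    then show ?thesis using abs_powr_eq_square_powr[of _ "2 * q"] by (simp add: powr_divide)
  qed
  note lf = linear_form[OF _ _ order_refl moment, of "\<lambda>_. 1"]
  show "integrable M (\<lambda>x. (real p * (t x)\<^sup>2) powr q)"
    unfolding eq using lf(1) q by (intro integrable_divide) auto
  have "expectation (\<lambda>x. (real p * (t x)\<^sup>2) powr q)
      = expectation (\<lambda>x. \<bar>\<Sum>j<p. 1 * (w j x - \<mu>)\<bar> powr (2 * q)) / ?P"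
    unfolding eq by simp
  also have "\<dots> \<le> rosenthal_const (2 * q) * (s powr q * ?P + m * real p) / ?P"
    using lf(2) q P by (intro divide_right_mono) auto
  also have "\<dots> = rosenthal_const (2 * q) * (s powr q + real p powr (1 - q) * m)"
    using p by (simp add: powr_diff field_simps)
  also have "\<dots> \<le> rosenthal_const (2 * q) * ((1 + s powr q) * \<theta>)"
  proof (intro mult_left_mono rosenthal_const_nonneg)
    have "0 \<le> s powr q * (real p powr (1 - q) * m)" using m_nonneg by simp
    then show "s powr q + real p powr (1 - q) * m \<le> (1 + s powr q) * \<theta>"
      by (simp add: \<theta>_def algebra_simps)
  qed
  finally show "expectation (\<lambda>x. (real p * (t x)\<^sup>2) powr q) \<le> rosenthal_const (2 * q) * (1 + s powr q) * \<theta>"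
    by (simp add: mult.assoc)
qed

lemma t_square:
  shows "integrable M (\<lambda>x. (t x)\<^sup>2)"
    and "expectation (\<lambda>x. (t x)\<^sup>2) \<le> 2 * rosenthal_const 2 * s / real p"
proof -
  have m2: "expectation (\<lambda>x. \<bar>w j x - \<mu>\<bar> powr 2) \<le> s" if "j < p" for j
    using var[OF that] by simp
  note lf = linear_form[OF _ _ order_refl m2, of "\<lambda>_. 1"]
  have eq: "(t x)\<^sup>2 = \<bar>\<Sum>j<p. 1 * (w j x - \<mu>)\<bar> powr 2 / (real p)\<^sup>2" for x
    unfolding t_eq by (simp add: power_divide)
  show "integrable M (\<lambda>x. (t x)\<^sup>2)"
    unfolding eq using lf(1) q by (intro integrable_divide) auto
  have "expectation (\<lambda>x. (t x)\<^sup>2) = expectation (\<lambda>x. \<bar>\<Sum>j<p. 1 * (w j x - \<mu>)\<bar> powr 2) / (real p)\<^sup>2"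
    unfolding eq by simp
  \<comment> \<open>At order 2 both terms of Rosenthal's bound equal s p, whence the factor
    2.\<close>
  also have "\<dots> \<le> (rosenthal_const 2 * (s powr (2 / 2) * (\<Sum>j<p. 1\<^sup>2) powr (2 / 2) + s * (\<Sum>j<p. \<bar>1\<bar> powr 2))) / (real p)\<^sup>2"
    using lf(2) q by (intro divide_right_mono) auto
  also have "\<dots> = 2 * rosenthal_const 2 * s / real p"
    using p s_nonneg by (simp add: power2_eq_square field_simps)
  finally show "expectation (\<lambda>x. (t x)\<^sup>2) \<le> 2 * rosenthal_const 2 * s / real p" .
qed

definition bad :: "'a set" where "bad = {x \<in> space M. wbar p w x < \<mu> / 2}"

lemma bad_sets[measurable]: "bad \<in> sets M"
  unfolding bad_def by measurable

lemma bad_integrable[simp]: "integrable M (indicator bad :: 'a \<Rightarrow> real)"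
  by (rule integrable_const_bound[of _ 1]) auto

lemma tail_rate_pos: "0 < tail_rate \<mu> s"
  unfolding tail_rate_def using mu s_nonneg by (simp add: add_pos_nonneg)

text \<open>For positive variables the lower tail is exponentially small under a second moment
  assumption only.\<close>

lemma prob_bad: "prob bad \<le> exp (- tail_rate \<mu> s * real p)"
proof -
  define v where "v = \<mu>\<^sup>2 + s"
  \<comment> \<open>The maximiser of h \<mu> / 2 - h^2 v.\<close>
  define h where "h = \<mu> / (4 * v)"
  have v: "0 < v" using mu s_nonneg by (simp add: v_def add_pos_nonneg)
  have h: "0 < h" using mu v by (simp add: h_def)
  let ?e = "\<lambda>j x. exp (- (h * w j x))"
  have ind: "indep_vars (\<lambda>_. borel) ?e {..<p}"
    using indep_vars_compose2[OF indep, of "\<lambda>_ z. exp (- (h * (z + \<mu>)))" "\<lambda>_. borel"] by simp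
  have ie: "integrable M (?e j)" if j: "j < p" for j
  proof (rule integrable_const_bound[of _ 1])
    show "AE x in M. norm (?e j x) \<le> 1"
      using pos[OF j] by eventually_elim (use h in simp)
  qed (use w_meas[OF j] in measurable)
  have ew: "expectation (?e j) \<le> exp (- (h * \<mu>) + h\<^sup>2 * v)" if j: "j < p" for j
  proof -
    have iw: "integrable M (\<lambda>x. w j x - \<mu>)" "integrable M (\<lambda>x. (w j x - \<mu>)\<^sup>2)"
      using int_abs[OF j] int_sq[OF j] by auto
    \<comment> \<open>This is 1 - h w + (h w)^2 expanded about \<mu>, so that mean and variance can
      be inserted directly.\<close>
    let ?g = "\<lambda>x. (1 - h * \<mu> + h\<^sup>2 * \<mu>\<^sup>2) + (2 * h\<^sup>2 * \<mu> - h) * (w j x - \<mu>) + h\<^sup>2 * (w j x - \<mu>)\<^sup>2"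
    have "expectation (?e j) \<le> expectation ?g"
    proof (intro integral_mono_AE ie j)
      show "integrable M ?g" using iw by auto
      show "AE x in M. ?e j x \<le> ?g x"
        using pos[OF j]
      proof eventually_elim
        case (elim x)
        then have "exp (- (h * w j x)) \<le> 1 - h * w j x + (h * w j x)\<^sup>2"
          using h by (intro exp_minus_le_quadratic) auto
        also have "\<dots> = ?g x" by (simp add: power2_eq_square algebra_simps)
        finally show ?case .
      qed
    qed
    also have "\<dots> = 1 + (- (h * \<mu>) + h\<^sup>2 * v)"
    proof -
      have "expectation ?g = (1 - h * \<mu> + h\<^sup>2 * \<mu>\<^sup>2) + (2 * h\<^sup>2 * \<mu> - h) * expectation (\<lambda>x. w j x - \<mu>)
          + h\<^sup>2 * expectation (\<lambda>x. (w j x - \<mu>)\<^sup>2)"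
        using iw by (simp add: prob_space del: Bochner_Integration.integral_diff)
      then show ?thesis unfolding mean[OF j] var[OF j] by (simp add: v_def algebra_simps)
    qed
    also have "\<dots> \<le> exp (- (h * \<mu>) + h\<^sup>2 * v)" by (rule exp_ge_add_one_self)
    finally show ?thesis .
  qed
  \<comment> \<open>Chernoff's method: on the bad event the exponent h (p \<mu> / 2 - sum of the w
    j) is nonnegative, and independence factorises the exponential.\<close>
  have "expectation (indicator bad) \<le> expectation (\<lambda>x. exp (h * (real p * \<mu> / 2)) * (\<Prod>j<p. ?e j x))"
  proof (intro integral_mono)
    show "integrable M (\<lambda>x. exp (h * (real p * \<mu> / 2)) * (\<Prod>j<p. ?e j x))"
      using indep_vars_integrable[OF _ ind] ie by auto
    fix x assume x: "x \<in> space M"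
    show "indicator bad x \<le> exp (h * (real p * \<mu> / 2)) * (\<Prod>j<p. ?e j x)"
    proof (cases "x \<in> bad")
      case True
      then have "(\<Sum>j<p. w j x) \<le> real p * \<mu> / 2"
        using p by (simp add: bad_def wbar_def field_simps)
      then have "0 \<le> h * (real p * \<mu> / 2) + (\<Sum>j<p. - (h * w j x))"
        using h by (simp add: sum_negf sum_distrib_left[symmetric])
      then have "1 \<le> exp (h * (real p * \<mu> / 2) + (\<Sum>j<p. - (h * w j x)))" by simp
      also have "\<dots> = exp (h * (real p * \<mu> / 2)) * (\<Prod>j<p. ?e j x)" by (simp add: exp_add exp_sum)
      finally show ?thesis using True by simp
    qed (auto intro!: mult_nonneg_nonneg prod_nonneg)
  qed auto
  also have "\<dots> = exp (h * (real p * \<mu> / 2)) * (\<Prod>j<p. expectation (?e j))"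
    using indep_vars_lebesgue_integral[OF _ ind] ie by simp
  also have "\<dots> \<le> exp (h * (real p * \<mu> / 2)) * (\<Prod>j<p. exp (- (h * \<mu>) + h\<^sup>2 * v))"
    using ew by (intro mult_left_mono prod_mono) auto
  also have "\<dots> = exp (real p * (h * \<mu> / 2 + (- (h * \<mu>) + h\<^sup>2 * v)))"
    by (simp add: exp_of_nat_mult[symmetric] exp_add[symmetric] algebra_simps)
  also have "h * \<mu> / 2 + (- (h * \<mu>) + h\<^sup>2 * v) = - tail_rate \<mu> s"
    using v by (simp add: h_def tail_rate_def flip: v_def) (simp add: field_simps power2_eq_square)
  finally show ?thesis by (simp add: mult.commute)
qed

lemma powr_prob_bad:
  assumes b: "0 < b"
  shows "real p powr b * prob bad \<le> (b / tail_rate \<mu> s) powr b"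
proof -
  have "real p powr b * prob bad \<le> ((b / tail_rate \<mu> s) powr b * exp (tail_rate \<mu> s * real p)) * exp (- tail_rate \<mu> s * real p)"
    using b p tail_rate_pos prob_bad by (intro mult_mono powr_le_exp) auto
  also have "\<dots> = (b / tail_rate \<mu> s) powr b" by (simp add: exp_minus)
  finally show ?thesis .
qed

text \<open>No positive summand exceeds the total, so the quotient by the mean lies between 0 and p.
  This is what makes the bad event harmless despite the small denominator.\<close>

lemma ratio_bound:
  assumes j: "j < p" and x: "\<And>i. i < p \<Longrightarrow> 0 < w i x"
  shows "\<bar>w j x / wbar p w x - 1\<bar> \<le> real p"
proof -
  have S: "w j x \<le> (\<Sum>i<p. w i x)" using j x by (intro member_le_sum) (auto intro: less_imp_le)
  have w: "0 < w j x" using x j by simp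
  have "w j x / wbar p w x = real p * (w j x / (\<Sum>i<p. w i x))" using S w p by (simp add: wbar_def)
  also have "\<dots> \<le> real p * 1" using S w by (intro mult_left_mono) auto
  finally have "w j x / wbar p w x \<le> real p" by simp
  moreover have "0 \<le> w j x / wbar p w x" using S w by (simp add: wbar_def)
  moreover have "1 \<le> real p" using p by simp
  ultimately show ?thesis by linarith
qed

lemma nu2_bounds: "0 \<le> nu2 M p w" "nu2 M p w \<le> (real p)\<^sup>2"
  and nu2_integrable: "integrable M (\<lambda>x. (w 0 x / wbar p w x - 1)\<^sup>2)"
proof -
  note [measurable] = w_meas[OF p]
  have bd: "AE x in M. norm ((w 0 x / wbar p w x - 1)\<^sup>2) \<le> (real p)\<^sup>2"
    using pos_all
  proof eventually_elim
    case (elim x)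
    then have "\<bar>w 0 x / wbar p w x - 1\<bar>\<^sup>2 \<le> (real p)\<^sup>2"
      using p by (intro power_mono ratio_bound) auto
    then show ?case by simp
  qed
  show i: "integrable M (\<lambda>x. (w 0 x / wbar p w x - 1)\<^sup>2)"
    by (rule integrable_const_bound[OF bd]) measurable
  show "0 \<le> nu2 M p w" by (simp add: nu2_def)
  show "nu2 M p w \<le> (real p)\<^sup>2"
    unfolding nu2_def using bd by (intro integral_le_const i) auto
qed

text \<open>The integrand is compared with y^2 / \<mu>^2, whose mean is s / \<mu>^2. The error is
  governed by |y| |t|, t^2 and y^2 |t|, and E t^2 is of order 1 / p.\<close>

lemma nu2_approx: "\<bar>nu2 M p w - s / \<mu>\<^sup>2\<bar> \<le> nu_const \<mu> s C / sqrt (real p)"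
proof -
  let ?y = "\<lambda>x. w 0 x - \<mu>"
  let ?sp = "sqrt (real p)"
  let ?R = "rosenthal_const 2"
  have p1: "1 \<le> real p" using p by simp
  have sp: "1 \<le> ?sp" "0 < ?sp" using p1 by auto
  note i2 = int_sq[OF p] and i4 = int_fourth[OF p]
  let ?f = "\<lambda>x. (w 0 x / wbar p w x - 1)\<^sup>2 - (?y x)\<^sup>2 / \<mu>\<^sup>2"
  let ?g = "\<lambda>x. 4 / \<mu>\<^sup>2 * ((?y x)\<^sup>2 / ?sp + 2 * (?sp * (t x)\<^sup>2))
     + 8 / \<mu> ^ 3 * ((?y x) ^ 4 / ?sp + ?sp * (t x)\<^sup>2) + (real p)\<^sup>2 * indicator bad x"
  have "nu2 M p w - s / \<mu>\<^sup>2 = expectation ?f"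
    using nu2_integrable i2 var[OF p] by (simp add: nu2_def)
  also have "\<bar>\<dots>\<bar> \<le> expectation (\<lambda>x. \<bar>?f x\<bar>)" by (rule integral_abs_bound)
  also have "\<dots> \<le> expectation ?g"
  proof (rule integral_mono_AE)
    show "integrable M (\<lambda>x. \<bar>?f x\<bar>)" using nu2_integrable i2 by auto
    show "integrable M ?g"
      using i2 i4 t_square(1) by (intro Bochner_Integration.integrable_add integrable_mult_right integrable_divide) auto
    show "AE x in M. \<bar>?f x\<bar> \<le> ?g x"
      using pos_all AE_space
    proof (eventually_elim)
      case (elim x)
      let ?Y = "w 0 x - \<mu>" and ?T = "\<bar>t x\<bar>"
      \<comment> \<open>The weight sqrt p balances the products: after integration y^2 / sqrt p and
        sqrt p t^2 are both of order p^(-1/2).\<close>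
      have c: "2 * (\<bar>?Y\<bar> * ?T) \<le> ?Y\<^sup>2 / ?sp + ?sp * (t x)\<^sup>2" using weighted_am_gm[of ?sp "\<bar>?Y\<bar>" "t x"] sp by simp
      have d: "2 * (?Y\<^sup>2 * ?T) \<le> ?Y ^ 4 / ?sp + ?sp * (t x)\<^sup>2"
        using weighted_am_gm[of ?sp "?Y\<^sup>2" "t x"] sp by (simp flip: power_mult)
      have e: "(t x)\<^sup>2 \<le> ?sp * (t x)\<^sup>2" using sp by (simp add: mult_right_mono[of 1 ?sp, simplified])
      have part: "4 / \<mu>\<^sup>2 * (2 * (\<bar>?Y\<bar> * ?T) + (t x)\<^sup>2) + 8 / \<mu> ^ 3 * (?Y\<^sup>2 * ?T)
          \<le> 4 / \<mu>\<^sup>2 * (?Y\<^sup>2 / ?sp + 2 * (?sp * (t x)\<^sup>2)) + 8 / \<mu> ^ 3 * (?Y ^ 4 / ?sp + ?sp * (t x)\<^sup>2)"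
      proof (rule add_mono; rule mult_left_mono)
        show "2 * (\<bar>?Y\<bar> * ?T) + (t x)\<^sup>2 \<le> ?Y\<^sup>2 / ?sp + 2 * (?sp * (t x)\<^sup>2)" using c e by linarith
        have "0 \<le> ?Y\<^sup>2 * ?T" by simp
        then show "?Y\<^sup>2 * ?T \<le> ?Y ^ 4 / ?sp + ?sp * (t x)\<^sup>2" using d by linarith
      qed (use mu in auto)
      show ?case
      proof (cases "wbar p w x < \<mu> / 2")
        case False
        then have tx: "\<mu> / 2 \<le> \<mu> + t x" by simp
        have "?f x = ((?Y - t x)\<^sup>2 - ?Y\<^sup>2) * (1 / (\<mu> + t x)\<^sup>2) + ?Y\<^sup>2 * (1 / (\<mu> + t x)\<^sup>2 - 1 / \<mu>\<^sup>2)"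
        proof -
          have "wbar p w x \<noteq> 0" using False mu by auto
          then have "w 0 x / wbar p w x - 1 = (?Y - t x) / (\<mu> + t x)" by (simp add: field_simps)
          then have eq: "(w 0 x / wbar p w x - 1)\<^sup>2 = (?Y - t x)\<^sup>2 * (1 / (\<mu> + t x)\<^sup>2)"
            by (simp only: power_divide) simp
          show ?thesis unfolding eq by (simp add: algebra_simps)
        qed
        also have "\<bar>\<dots>\<bar> \<le> \<bar>(?Y - t x)\<^sup>2 - ?Y\<^sup>2\<bar> * (1 / (\<mu> + t x)\<^sup>2) + ?Y\<^sup>2 * \<bar>1 / (\<mu> + t x)\<^sup>2 - 1 / \<mu>\<^sup>2\<bar>"
          by (rule order_trans[OF abs_triangle_ineq]) (simp add: abs_mult)
        also have "\<dots> \<le> (2 * (\<bar>?Y\<bar> * ?T) + (t x)\<^sup>2) * (4 / \<mu>\<^sup>2) + ?Y\<^sup>2 * (6 / \<mu> ^ 3 * ?T)"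
        proof (intro add_mono mult_mono mult_left_mono abs_inverse_square_diff mu tx)
          have "(?Y - t x)\<^sup>2 - ?Y\<^sup>2 = - 2 * (?Y * t x) + (t x)\<^sup>2"
            by (simp add: power2_eq_square algebra_simps)
          then show "\<bar>(?Y - t x)\<^sup>2 - ?Y\<^sup>2\<bar> \<le> 2 * (\<bar>?Y\<bar> * ?T) + (t x)\<^sup>2"
            using abs_mult[of ?Y "t x"] zero_le_power2[of "t x"] by linarith
        qed auto
        also have "\<dots> \<le> 4 / \<mu>\<^sup>2 * (2 * (\<bar>?Y\<bar> * ?T) + (t x)\<^sup>2) + 8 / \<mu> ^ 3 * (?Y\<^sup>2 * ?T)"
        proof -
          have "6 / \<mu> ^ 3 * (?Y\<^sup>2 * ?T) \<le> 8 / \<mu> ^ 3 * (?Y\<^sup>2 * ?T)"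
            using mu by (intro mult_right_mono divide_right_mono) auto
          then show ?thesis by (simp add: mult_ac)
        qed
        also note part
        also have "4 / \<mu>\<^sup>2 * (?Y\<^sup>2 / ?sp + 2 * (?sp * (t x)\<^sup>2)) + 8 / \<mu> ^ 3 * (?Y ^ 4 / ?sp + ?sp * (t x)\<^sup>2) \<le> ?g x"
          by simp
        finally show ?thesis .
      next
        case True
        \<comment> \<open>On the bad event |t| is bounded below, so y^2 / \<mu>^2 is already covered
          by the error term y^2 |t|; only the ratio itself needs the indicator.\<close>
        have "\<mu> / 2 \<le> ?T" using True by linarith
        then have "?Y\<^sup>2 / \<mu>\<^sup>2 * (\<mu> / 2) \<le> ?Y\<^sup>2 / \<mu>\<^sup>2 * ?T" by (intro mult_left_mono) auto
        then have "?Y\<^sup>2 / \<mu>\<^sup>2 \<le> 2 / \<mu> ^ 3 * (?Y\<^sup>2 * ?T)"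
          using mu by (simp add: field_simps power2_eq_square power3_eq_cube)
        also have "\<dots> \<le> 8 / \<mu> ^ 3 * (?Y\<^sup>2 * ?T)"
          using mu by (intro mult_right_mono divide_right_mono) auto
        also have "\<dots> \<le> 4 / \<mu>\<^sup>2 * (2 * (\<bar>?Y\<bar> * ?T) + (t x)\<^sup>2) + 8 / \<mu> ^ 3 * (?Y\<^sup>2 * ?T)"
          by (simp add: add_nonneg_nonneg)
        also note part
        finally have 1: "?Y\<^sup>2 / \<mu>\<^sup>2 \<le> 4 / \<mu>\<^sup>2 * (?Y\<^sup>2 / ?sp + 2 * (?sp * (t x)\<^sup>2)) + 8 / \<mu> ^ 3 * (?Y ^ 4 / ?sp + ?sp * (t x)\<^sup>2)" .
        have "\<bar>w 0 x / wbar p w x - 1\<bar>\<^sup>2 \<le> (real p)\<^sup>2"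
          using elim p by (intro power_mono ratio_bound) auto
        then have 2: "(w 0 x / wbar p w x - 1)\<^sup>2 \<le> (real p)\<^sup>2 * indicator bad x"
          using True elim by (simp add: bad_def)
        have "\<bar>?f x\<bar> \<le> (w 0 x / wbar p w x - 1)\<^sup>2 + ?Y\<^sup>2 / \<mu>\<^sup>2"
          by (rule order_trans[OF abs_triangle_ineq4]) simp
        with 1 2 show ?thesis by linarith
      qed
    qed
  qed
  also have "\<dots> = 4 / \<mu>\<^sup>2 * (s / ?sp + 2 * (?sp * expectation (\<lambda>x. (t x)\<^sup>2)))
     + 8 / \<mu> ^ 3 * (expectation (\<lambda>x. (?y x) ^ 4) / ?sp + ?sp * expectation (\<lambda>x. (t x)\<^sup>2)) + (real p)\<^sup>2 * prob bad"
    using i2 i4 t_square(1) var[OF p] by simp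
  also have "\<dots> \<le> 4 / \<mu>\<^sup>2 * (s / ?sp + 2 * (2 * ?R * s / ?sp))
     + 8 / \<mu> ^ 3 * (C / ?sp + 2 * ?R * s / ?sp) + (5 / 2 / tail_rate \<mu> s) powr (5 / 2) / ?sp"
  proof -
    have "?sp * expectation (\<lambda>x. (t x)\<^sup>2) \<le> ?sp * (2 * ?R * s / real p)"
      using t_square(2) by (intro mult_left_mono) auto
    also have "\<dots> = 2 * ?R * s / ?sp" using sp by (simp add: field_simps)
    finally have 1: "?sp * expectation (\<lambda>x. (t x)\<^sup>2) \<le> 2 * ?R * s / ?sp" .
    \<comment> \<open>The exponent 5/2 = 2 + 1/2 leaves the factor p^(-1/2) over.\<close>
    have "(real p)\<^sup>2 * prob bad = (real p powr (5 / 2) * prob bad) / ?sp"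
    proof -
      have "real p powr (5 / 2) = real p powr 2 * real p powr (1 / 2)"
        by (subst powr_add[symmetric]) simp
      then have "real p powr (5 / 2) = (real p)\<^sup>2 * ?sp" using p by (simp add: powr_half_sqrt)
      then show ?thesis using sp by simp
    qed
    also have "\<dots> \<le> (5 / 2 / tail_rate \<mu> s) powr (5 / 2) / ?sp"
      using powr_prob_bad[of "5/2"] sp by (intro divide_right_mono) auto
    finally have 2: "(real p)\<^sup>2 * prob bad \<le> (5 / 2 / tail_rate \<mu> s) powr (5 / 2) / ?sp" .
    have 3: "expectation (\<lambda>x. (?y x) ^ 4) / ?sp \<le> C / ?sp"
      using fourth[OF p] sp by (intro divide_right_mono) auto
    show ?thesis using 1 2 3 mu by (intro add_mono mult_left_mono order_refl) auto
  qed
  also have "\<dots> = nu_const \<mu> s C / ?sp" unfolding nu_const_def by (simp add: add_divide_distrib distrib_left)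
  finally show ?thesis .
qed

text \<open>Reduces the ratio form to the form in centred variables. Both scales are kept for the
  two applications: L = F in the Frobenius bound, F = sqrt p L in the operator bound.\<close>

lemma core_bound:
  fixes a :: "nat \<Rightarrow> nat \<Rightarrow> real"
  assumes L: "0 < L" "L \<le> F" and op: "op_bounded p a L"
    and F: "(\<Sum>i<p. \<Sum>j<p. (a i j)\<^sup>2) \<le> F\<^sup>2"
  shows "(\<integral>\<^sup>+x. \<bar>ratio_form a x\<bar> powr q \<partial>M)
    \<le> ennreal (core_const q \<mu> s C) *
      ((\<integral>\<^sup>+x. \<bar>centred_form a x\<bar> powr q \<partial>M)
        + ennreal (\<theta> * F powr q + (1 + m) * L powr q))"
proof -
  define D where "D x = ratio_form a x" for x
  define Q where "Q x = centred_form a x" for x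
  define l where "l x = (\<Sum>j<p. (\<Sum>i<p. a i j + a j i) * (w j x - \<mu>))" for x
  let ?R = "rosenthal_const (2 * q)"
  let ?c = "8 / \<mu>\<^sup>2 + 6 * s / \<mu> ^ 3 + nu_const \<mu> s C"
  have F0: "0 < F" using L by simp
  have p1: "1 \<le> real p" using p by simp
  have R0: "0 \<le> ?R" by (rule rosenthal_const_nonneg)
  let ?h = "\<lambda>x. (l x)\<^sup>2 / (real p * L)"
  let ?Z = "\<lambda>x. real p * (t x)\<^sup>2"
  have [measurable]: "l \<in> borel_measurable M" "Q \<in> borel_measurable M"
    unfolding l_def Q_def using w_meas
    by (auto intro!: borel_measurable_sum borel_measurable_diff borel_measurable_times)
  have h_eq: "?h x powr q = \<bar>l x\<bar> powr (2 * q) / (real p * L) powr q" for x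
    using L by (simp add: powr_divide abs_powr_eq_square_powr[of _ "2 * q"])
  have l_int: "integrable M (\<lambda>x. \<bar>l x\<bar> powr (2 * q))"
    unfolding l_def using q moment by (intro linear_form(1)) auto
  have h_int: "integrable M (\<lambda>x. ?h x powr q)"
    unfolding h_eq using l_int by (rule integrable_divide)
  have h_exp: "expectation (\<lambda>x. ?h x powr q) \<le> ?R * 4 powr q * (1 + s powr q) * ((1 + m) * L powr q)"
  proof -
    have "expectation (\<lambda>x. \<bar>l x\<bar> powr (2 * q)) \<le> ?R * (s powr (2 * q / 2) + m) * (4 * real p * L\<^sup>2) powr (2 * q / 2)"
      unfolding l_def using q moment m_nonneg L
      by (intro linear_form_l2 op_bounded_row_col_sums op) auto
    also have "(4 * real p * L\<^sup>2) powr (2 * q / 2) = (4 * L * (real p * L)) powr q"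
      by (simp add: power2_eq_square mult_ac)
    also have "\<dots> = 4 powr q * L powr q * (real p * L) powr q"
      by (simp only: powr_mult)
    finally have "expectation (\<lambda>x. ?h x powr q) \<le> ?R * (s powr q + m) * (4 powr q * L powr q)"
      unfolding h_eq using L p by (simp add: divide_le_eq mult_ac)
    also have "\<dots> \<le> ?R * ((1 + s powr q) * (1 + m)) * (4 powr q * L powr q)"
      using R0 m_nonneg by (intro mult_right_mono mult_left_mono) (auto simp: algebra_simps)
    finally show ?thesis by (simp add: mult_ac)
  qed
  have F_exp: "expectation (\<lambda>x. (F * (1 + ?Z x)) powr q) \<le> 2 powr q * (1 + ?R * (1 + s powr q)) * (\<theta> * F powr q)"
    and F_int: "integrable M (\<lambda>x. (F * (1 + ?Z x)) powr q)"
  proof -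
    have le: "(F * (1 + ?Z x)) powr q \<le> F powr q * (2 powr q * (1 + ?Z x powr q))" for x
      using powr_add_le[of 1 "?Z x" q] q F0 by (simp add: powr_mult mult_left_mono)
    have ib: "integrable M (\<lambda>x. F powr q * (2 powr q * (1 + ?Z x powr q)))"
      using t_moment(1) by auto
    show i: "integrable M (\<lambda>x. (F * (1 + ?Z x)) powr q)"
      by (rule Bochner_Integration.integrable_bound[OF ib])
         (use le in \<open>auto intro!: AE_I2 intro: order_trans[OF _ abs_ge_self]\<close>)
    have "expectation (\<lambda>x. (F * (1 + ?Z x)) powr q) \<le> expectation (\<lambda>x. F powr q * (2 powr q * (1 + ?Z x powr q)))"
      by (intro integral_mono i ib le)
    also have "\<dots> = F powr q * (2 powr q * (1 + expectation (\<lambda>x. ?Z x powr q)))"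
      using t_moment(1) by (simp add: prob_space)
    also have "\<dots> \<le> F powr q * (2 powr q * (\<theta> + ?R * (1 + s powr q) * \<theta>))"
      using t_moment(2) \<theta>_ge_1 by (intro mult_left_mono add_mono) auto
    finally show "expectation (\<lambda>x. (F * (1 + ?Z x)) powr q) \<le> 2 powr q * (1 + ?R * (1 + s powr q)) * (\<theta> * F powr q)"
      by (simp add: algebra_simps)
  qed
  let ?K = "(4 * ?c) powr q"
  \<comment> \<open>All terms known to be integrable; only the moment of Q remains an integral in
    [0, \<infinity>].\<close>
  let ?rest = "\<lambda>x. ?K * (?h x powr q + (F * (1 + ?Z x)) powr q) + (2 * F * real p ^ 3) powr q * indicator bad x"
  have "AE x in M. \<bar>D x\<bar> powr q \<le> ?K * \<bar>Q x\<bar> powr q + ?rest x"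
    using pos_all AE_space
  proof eventually_elim
    case (elim x)
    show ?case
    proof (cases "wbar p w x < \<mu> / 2")
      case False
      then have tx: "\<mu> / 2 \<le> \<mu> + t x" and w0: "wbar p w x \<noteq> 0" using mu by auto
      have "w j x / wbar p w x - 1 = (w j x - \<mu> - t x) / (\<mu> + t x)" for j
        using w0 by (simp add: field_simps)
      then have "\<bar>D x\<bar> \<le> ?c * (\<bar>Q x\<bar> + ?h x + F * (1 + ?Z x))"
        unfolding D_def Q_def l_def
        by (simp only:) (rule self_normalised_quadratic_bound[OF p mu s_nonneg L op F tx nu2_approx])
      then have "\<bar>D x\<bar> powr q \<le> (?c * (\<bar>Q x\<bar> + ?h x + F * (1 + ?Z x))) powr q"
        using q by (intro powr_mono2) auto
      also have "\<dots> = ?c powr q * (\<bar>Q x\<bar> + (?h x + F * (1 + ?Z x))) powr q"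
        by (simp only: powr_mult add.assoc)
      also have "\<dots> \<le> ?c powr q * (2 powr q * (\<bar>Q x\<bar> powr q + 2 powr q * (?h x powr q + (F * (1 + ?Z x)) powr q)))"
      proof (intro mult_left_mono)
        have "0 \<le> ?h x" "0 \<le> F * (1 + ?Z x)" using L F0 by auto
        then show "(\<bar>Q x\<bar> + (?h x + F * (1 + ?Z x))) powr q
            \<le> 2 powr q * (\<bar>Q x\<bar> powr q + 2 powr q * (?h x powr q + (F * (1 + ?Z x)) powr q))"
          using q by (intro order_trans[OF powr_add_le] mult_left_mono add_left_mono powr_add_le) auto
      qed auto
      \<comment> \<open>The coefficient of Q is enlarged so that the single constant
        \<open>?K\<close> serves all terms.\<close>
      also have "\<dots> \<le> ?c powr q * (2 powr q * (2 powr q * \<bar>Q x\<bar> powr q + 2 powr q * (?h x powr q + (F * (1 + ?Z x)) powr q)))"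
        using q ge_one_powr_ge_zero[of 2 q]
        by (intro mult_left_mono add_right_mono) (auto simp: mult_right_mono[of 1 "2 powr q", simplified])
      also have "\<dots> = ?K * \<bar>Q x\<bar> powr q + ?K * (?h x powr q + (F * (1 + ?Z x)) powr q)"
      proof -
        have "?K = 2 powr q * 2 powr q * ?c powr q"
          by (simp only: powr_mult[symmetric]) simp
        then show ?thesis by (simp add: algebra_simps)
      qed
      finally have "\<bar>D x\<bar> powr q \<le> ?K * \<bar>Q x\<bar> powr q + ?K * (?h x powr q + (F * (1 + ?Z x)) powr q)" .
      moreover have "0 \<le> (2 * F * real p ^ 3) powr q * indicator bad x" by simp
      ultimately show ?thesis by linarith
    next
      case True
      then have ind: "indicator bad x = (1 :: real)" using elim by (simp add: bad_def)
      let ?u = "\<lambda>j. w j x / wbar p w x - 1"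
      \<comment> \<open>On the bad event each ratio is at most p, so the squared norm is at most
        p^3; the trace term, bounded by p^2 sqrt p F, is of no larger order.\<close>
      have "(\<Sum>j<p. (?u j)\<^sup>2) \<le> (\<Sum>j<p. (real p)\<^sup>2)"
      proof (intro sum_mono)
        fix j assume "j \<in> {..<p}"
        then have "\<bar>?u j\<bar>\<^sup>2 \<le> (real p)\<^sup>2" using elim by (intro power_mono ratio_bound) auto
        then show "(?u j)\<^sup>2 \<le> (real p)\<^sup>2" by simp
      qed
      then have u: "(\<Sum>j<p. (?u j)\<^sup>2) \<le> real p ^ 3" by (simp add: power3_eq_cube power2_eq_square)
      have "\<bar>\<Sum>i<p. \<Sum>j<p. a i j * (?u i * ?u j)\<bar> \<le> L * sqrt (\<Sum>j<p. (?u j)\<^sup>2) * sqrt (\<Sum>j<p. (?u j)\<^sup>2)"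
        using op_bounded_bilinear[OF op, of ?u ?u] L by (simp add: mult.assoc)
      also have "\<dots> = L * (\<Sum>j<p. (?u j)\<^sup>2)" by (simp add: sum_nonneg)
      also have "\<dots> \<le> F * real p ^ 3" using u L F0 by (intro mult_mono) (auto intro: sum_nonneg)
      finally have 1: "\<bar>\<Sum>i<p. \<Sum>j<p. a i j * (?u i * ?u j)\<bar> \<le> F * real p ^ 3" .
      have "\<bar>nu2 M p w * (\<Sum>i<p. a i i)\<bar> \<le> (real p)\<^sup>2 * (sqrt (real p) * F)"
        unfolding abs_mult using nu2_bounds F F0 by (intro mult_mono abs_trace_le) auto
      also have "\<dots> \<le> (real p)\<^sup>2 * (real p * F)"
        using p1 F0 by (intro mult_left_mono mult_right_mono) (auto intro!: real_le_lsqrt simp: power2_eq_square)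
      finally have 2: "\<bar>nu2 M p w * (\<Sum>i<p. a i i)\<bar> \<le> F * real p ^ 3"
        by (simp add: power3_eq_cube power2_eq_square mult_ac)
      have "\<bar>D x\<bar> \<le> 2 * F * real p ^ 3"
        unfolding D_def using order_trans[OF abs_triangle_ineq4 add_mono[OF 1 2]] by simp
      then have "\<bar>D x\<bar> powr q \<le> (2 * F * real p ^ 3) powr q" using q by (intro powr_mono2) auto
      then show ?thesis using ind by (simp add: add_increasing)
    qed
  qed
  then have "(\<integral>\<^sup>+x. \<bar>D x\<bar> powr q \<partial>M) \<le> (\<integral>\<^sup>+x. ennreal ?K * ennreal (\<bar>Q x\<bar> powr q) + ennreal (?rest x) \<partial>M)"
  proof (intro nn_integral_mono_AE, eventually_elim)
    case (elim x)
    have "0 \<le> ?rest x" by simp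
    then show ?case using elim by (simp add: ennreal_mult[symmetric] ennreal_plus[symmetric] del: ennreal_plus)
  qed
  also have "\<dots> = ennreal ?K * (\<integral>\<^sup>+x. \<bar>Q x\<bar> powr q \<partial>M) + (\<integral>\<^sup>+x. ?rest x \<partial>M)"
    by (subst nn_integral_add) (auto simp: nn_integral_cmult)
  also have "(\<integral>\<^sup>+x. ?rest x \<partial>M) = ennreal (expectation ?rest)"
    using h_int F_int by (intro nn_integral_eq_integral) auto
  finally have 1: "(\<integral>\<^sup>+x. \<bar>D x\<bar> powr q \<partial>M)
      \<le> ennreal ?K * (\<integral>\<^sup>+x. \<bar>Q x\<bar> powr q \<partial>M) + ennreal (expectation ?rest)" .
  have "expectation ?rest = ?K * (expectation (\<lambda>x. ?h x powr q) + expectation (\<lambda>x. (F * (1 + ?Z x)) powr q))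
     + (2 * F * real p ^ 3) powr q * prob bad"
    using h_int F_int by simp
  also have "\<dots> \<le> core_const q \<mu> s C * (\<theta> * F powr q + (1 + m) * L powr q)"
  proof -
    have \<theta>F: "F powr q \<le> \<theta> * F powr q" "0 \<le> (1 + m) * L powr q"
      using \<theta>_ge_1 m_nonneg by (auto simp: mult_right_mono[of 1 \<theta> "F powr q", simplified])
    have "(2 * F * real p ^ 3) powr q * prob bad = 2 powr q * F powr q * (real p powr (3 * q) * prob bad)"
      using p by (simp add: powr_mult powr_powr flip: powr_numeral)
    also have "\<dots> \<le> 2 powr q * F powr q * (3 * q / tail_rate \<mu> s) powr (3 * q)"
      using q by (intro mult_left_mono powr_prob_bad) auto
    also have "\<dots> \<le> 2 powr q * (3 * q / tail_rate \<mu> s) powr (3 * q) * (\<theta> * F powr q + (1 + m) * L powr q)"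
    proof -
      have "2 powr q * (3 * q / tail_rate \<mu> s) powr (3 * q) * F powr q
          \<le> 2 powr q * (3 * q / tail_rate \<mu> s) powr (3 * q) * (\<theta> * F powr q + (1 + m) * L powr q)"
        using \<theta>F by (intro mult_left_mono) auto
      then show ?thesis by (simp add: mult_ac)
    qed
    finally have b: "(2 * F * real p ^ 3) powr q * prob bad
        \<le> 2 powr q * (3 * q / tail_rate \<mu> s) powr (3 * q) * (\<theta> * F powr q + (1 + m) * L powr q)" .
    let ?A = "?R * 4 powr q * (1 + s powr q)" and ?B = "2 powr q * (1 + ?R * (1 + s powr q))"
    have AB: "0 \<le> ?A" "0 \<le> ?B" using R0 by (auto intro!: mult_nonneg_nonneg add_nonneg_nonneg)
    have "?K * (expectation (\<lambda>x. ?h x powr q) + expectation (\<lambda>x. (F * (1 + ?Z x)) powr q))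
        \<le> ?K * (?A * ((1 + m) * L powr q) + ?B * (\<theta> * F powr q))"
      using h_exp F_exp by (intro mult_left_mono add_mono) auto
    also have "\<dots> \<le> ?K * ((1 + ?A + ?B) * (\<theta> * F powr q + (1 + m) * L powr q))"
    proof (intro mult_left_mono)
      have \<theta>F0: "0 \<le> \<theta> * F powr q" using \<theta>_ge_1 by simp
      have "0 \<le> ?A * (\<theta> * F powr q)" "0 \<le> ?B * ((1 + m) * L powr q)"
        using AB \<theta>F \<theta>F0 by (auto intro!: mult_nonneg_nonneg simp del: mult_nonneg_nonneg)
      then show "?A * ((1 + m) * L powr q) + ?B * (\<theta> * F powr q)
          \<le> (1 + ?A + ?B) * (\<theta> * F powr q + (1 + m) * L powr q)"
        using \<theta>F(2) \<theta>F0 unfolding distrib_left distrib_right by linarith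
    qed simp
    finally have "?K * (expectation (\<lambda>x. ?h x powr q) + expectation (\<lambda>x. (F * (1 + ?Z x)) powr q))
        \<le> ?K * ((1 + ?A + ?B) * (\<theta> * F powr q + (1 + m) * L powr q))" .
    from add_mono[OF this b] show ?thesis
      unfolding core_const_def by (simp only: distrib_right mult.assoc)
  qed
  finally have 2: "expectation ?rest \<le> core_const q \<mu> s C * (\<theta> * F powr q + (1 + m) * L powr q)" .
  have 3: "ennreal ?K * (\<integral>\<^sup>+x. \<bar>Q x\<bar> powr q \<partial>M) \<le> ennreal (core_const q \<mu> s C) * (\<integral>\<^sup>+x. \<bar>Q x\<bar> powr q \<partial>M)"
  proof (intro mult_right_mono ennreal_leI)
    let ?A = "?R * 4 powr q * (1 + s powr q)" and ?B = "2 powr q * (1 + ?R * (1 + s powr q))"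
    have "0 \<le> ?A" "0 \<le> ?B" using R0 by (auto intro!: mult_nonneg_nonneg add_nonneg_nonneg)
    then have "?K * 1 \<le> ?K * (1 + ?A + ?B)" by (intro mult_left_mono) auto
    moreover have "0 \<le> 2 powr q * (3 * q / tail_rate \<mu> s) powr (3 * q)" by simp
    ultimately show "?K \<le> core_const q \<mu> s C" unfolding core_const_def by linarith
  qed simp
  have "0 \<le> core_const q \<mu> s C"
    unfolding core_const_def using R0 by (intro add_nonneg_nonneg mult_nonneg_nonneg) auto
  then have "ennreal (core_const q \<mu> s C * (\<theta> * F powr q + (1 + m) * L powr q))
      = ennreal (core_const q \<mu> s C) * ennreal (\<theta> * F powr q + (1 + m) * L powr q)"
    using \<theta>_ge_1 m_nonneg by (intro ennreal_mult) auto
  then show ?thesis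
    using order_trans[OF 1 add_mono[OF 3 ennreal_leI[OF 2]]] by (simp add: D_def Q_def distrib_left)
qed

end

section \<open>Spectral theory of complex matrices\<close>

lemma mat_adjoint_index:
  assumes "A \<in> carrier_mat n k" "i < k" "j < n"
  shows "mat_adjoint A $$ (i, j) = conjugate (A $$ (j, i))"
  using assms by (auto simp: mat_adjoint_def mat_of_rows_def)

lemma mat_adjoint_carrier[simp]:
  "A \<in> carrier_mat n k \<Longrightarrow> mat_adjoint A \<in> carrier_mat k n"
  by (auto simp: mat_adjoint_def)

lemma index_mult_mat_sum:
  assumes "A \<in> carrier_mat n k" "B \<in> carrier_mat k m" "i < n" "j < m"
  shows "(A * B) $$ (i, j) = (\<Sum>l<k. A $$ (i, l) * B $$ (l, j))"
  using assms by (auto simp: scalar_prod_def atLeast0LessThan intro!: sum.cong)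

lemma index_mult_adjoint:
  fixes A :: "complex mat"
  assumes A: "A \<in> carrier_mat n k" and B: "B \<in> carrier_mat m k" and "i < n" "j < m"
  shows "(A * mat_adjoint B) $$ (i, j) = (\<Sum>l<k. A $$ (i, l) * cnj (B $$ (j, l)))"
  using assms by (subst index_mult_mat_sum[of _ n k _ m]) (auto simp: mat_adjoint_index[OF B])

lemma index_adjoint_mult:
  fixes A :: "complex mat"
  assumes A: "A \<in> carrier_mat k n" and B: "B \<in> carrier_mat k m" and "i < n" "j < m"
  shows "(mat_adjoint A * B) $$ (i, j) = (\<Sum>l<k. cnj (A $$ (l, i)) * B $$ (l, j))"
  using assms by (subst index_mult_mat_sum[of _ n k _ m]) (auto simp: mat_adjoint_index[OF A])

lemma mtrace_comm:
  assumes A: "A \<in> carrier_mat n k" and B: "B \<in> carrier_mat k n"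
  shows "mtrace (A * B) = mtrace (B * A)"
proof -
  have "mtrace (A * B) = (\<Sum>i<n. \<Sum>l<k. A $$ (i, l) * B $$ (l, i))"
    using A B by (simp add: mtrace_def index_mult_mat_sum[OF A B] del: index_mult_mat(1))
  also have "\<dots> = (\<Sum>l<k. \<Sum>i<n. B $$ (l, i) * A $$ (i, l))"
    by (subst sum.swap) (simp add: mult.commute)
  also have "\<dots> = mtrace (B * A)"
    using A B by (simp add: mtrace_def index_mult_mat_sum[OF B A] del: index_mult_mat(1))
  finally show ?thesis .
qed

text \<open>By Schur triangularisation the trace is the sum of the roots of the characteristic
  polynomial; if t were the only eigenvalue it would be m t.\<close>

lemma exists_eigenvalue_neq:
  assumes C: "C \<in> carrier_mat m m" and tr: "mtrace C \<noteq> of_nat m * t"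
  shows "\<exists>k. eigenvalue C k \<and> k \<noteq> t"
proof (rule ccontr)
  assume "\<not> ?thesis"
  then have all: "eigenvalue C k \<Longrightarrow> k = t" for k by blast
  obtain as where as: "char_poly C = (\<Prod>a\<leftarrow>as. [:- a, 1:])" "length as = m"
    using char_poly_factorized[OF C] by blast
  have "a = t" if "a \<in> set as" for a
    using that by (intro all) (auto simp: eigenvalue_root_char_poly[OF C] as(1) poly_prod_list_zero_iff)
  then have rep: "as = replicate m t" using as(2) by (auto intro: replicate_eqI)
  obtain B P Q where BPQ: "schur_decomposition C as = (B, P, Q)"
    by (cases "schur_decomposition C as") auto
  from schur_decomposition[OF C as(1) BPQ]
  have wit: "similar_mat_wit C B P Q" and diag: "diag_mat B = as" by auto
  note w = similar_mat_witD2[OF C wit]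
  have "mtrace C = mtrace (P * (B * Q))" using w(3) w(5-7) by (simp add: assoc_mult_mat)
  also have "\<dots> = mtrace (B * Q * P)" using w(5-7) by (intro mtrace_comm[of _ m m]) auto
  also have "B * Q * P = B" using w by (simp add: assoc_mult_mat[of _ m m _ m _ m])
  also have "mtrace B = (\<Sum>i<m. as ! i)"
    unfolding mtrace_def using w(5) by (auto simp: diag[symmetric] diag_mat_def intro!: sum.cong)
  also have "\<dots> = of_nat m * t" unfolding rep by simp
  finally show False using tr by simp
qed

text \<open>The deflated matrix \<open>B + \<Sum>\<^sub>l (t - d\<^sub>l) v\<^sub>l v\<^sub>l\<^sup>*\<close> has the eigenvalue \<open>t\<close> on the span of the
  eigenvectors found so far. For all but one \<open>t\<close> its trace forces a further eigenvalue, and an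
  eigenvector for it is orthogonal to that span.\<close>

lemma orthonormal_eigenvectors:
  fixes B :: "nat \<Rightarrow> nat \<Rightarrow> complex"
  assumes herm: "\<And>i j. i < m \<Longrightarrow> j < m \<Longrightarrow> B j i = cnj (B i j)"
  shows "k \<le> m \<Longrightarrow> \<exists>v d. (\<forall>l<k. \<forall>i<m. (\<Sum>j<m. B i j * v l j) = complex_of_real (d l) * v l i) \<and>
    (\<forall>l<k. \<forall>l'<k. (\<Sum>i<m. cnj (v l i) * v l' i) = (if l = l' then 1 else 0))"
proof (induction k)
  case 0
  then show ?case by simp
next
  case (Suc k)
  from Suc.IH[OF Suc_leD[OF Suc.prems]] obtain v d where H: "\<forall>l<k. \<forall>i<m. (\<Sum>j<m. B i j * v l j) = complex_of_real (d l) * v l i"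
      "\<forall>l<k. \<forall>l'<k. (\<Sum>i<m. cnj (v l i) * v l' i) = (if l = l' then 1 else 0)"
    by (elim exE conjE)
  have ev: "(\<Sum>j<m. B i j * v l j) = complex_of_real (d l) * v l i" if "l < k" "i < m" for l i
    using H(1) that by blast
  have on: "(\<Sum>i<m. cnj (v l i) * v l' i) = (if l = l' then 1 else 0)" if "l < k" "l' < k" for l l'
    using H(2) that by blast
  have herm': "cnj (B j i) = B i j" if "i < m" "j < m" for i j
    using arg_cong[OF herm[OF that], of cnj] by (simp only: complex_cnj_cnj)
  have selfadj: "(\<Sum>i<m. cnj (u i) * (\<Sum>j<m. B i j * z j)) = (\<Sum>i<m. cnj (\<Sum>j<m. B i j * u j) * z i)"
    for u z :: "nat \<Rightarrow> complex"
  proof -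
    have "(\<Sum>i<m. cnj (u i) * (\<Sum>j<m. B i j * z j)) = (\<Sum>j<m. \<Sum>i<m. cnj (u i) * (B i j * z j))"
      unfolding sum_distrib_left by (rule sum.swap)
    also have "\<dots> = (\<Sum>j<m. \<Sum>i<m. (cnj (B j i) * cnj (u i)) * z j)"
      by (intro sum.cong refl) (simp add: herm')
    also have "\<dots> = (\<Sum>j<m. cnj (\<Sum>i<m. B j i * u i) * z j)"
      by (simp only: sum_distrib_right cnj_sum complex_cnj_mult)
    finally show ?thesis .
  qed
  define C where "C t = mat m m (\<lambda>(i, j). B i j + (\<Sum>l<k. complex_of_real (t - d l) * v l i * cnj (v l j)))" for t
  have C: "C t \<in> carrier_mat m m" for t by (simp add: C_def)
  have tr: "mtrace (C t) = (\<Sum>i<m. B i i) + (\<Sum>l<k. complex_of_real (t - d l))" for t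
  proof -
    have "mtrace (C t) = (\<Sum>i<m. B i i) + (\<Sum>i<m. \<Sum>l<k. complex_of_real (t - d l) * (cnj (v l i) * v l i))"
      by (simp add: mtrace_def C_def sum.distrib mult_ac)
    also have "(\<Sum>i<m. \<Sum>l<k. complex_of_real (t - d l) * (cnj (v l i) * v l i))
        = (\<Sum>l<k. complex_of_real (t - d l) * (\<Sum>i<m. cnj (v l i) * v l i))"
      unfolding sum_distrib_left by (rule sum.swap)
    also have "\<dots> = (\<Sum>l<k. complex_of_real (t - d l))" by (simp add: on)
    finally show ?thesis .
  qed
  \<comment> \<open>As a function of t the trace has slope k, whereas m t has slope m > k, so they
    cannot agree both at 0 and at 1.\<close>
  have "\<exists>t::real. mtrace (C t) \<noteq> of_nat m * complex_of_real t"
  proof (rule ccontr)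
    assume "\<not> ?thesis"
    then have *: "mtrace (C t) = of_nat m * complex_of_real t" for t by blast
    have "mtrace (C 1) - mtrace (C 0) = of_nat k" by (simp add: tr sum_subtractf sum_negf)
    moreover have "mtrace (C 1) - mtrace (C 0) = of_nat m" by (simp add: *)
    ultimately have "k = m" by simp
    then show False using Suc.prems by simp
  qed
  then obtain t where t: "mtrace (C t) \<noteq> of_nat m * complex_of_real t" by blast
  obtain e where e: "eigenvalue (C t) e" "e \<noteq> complex_of_real t"
    using exists_eigenvalue_neq[OF C t] by blast
  then obtain xv where xv: "xv \<in> carrier_vec m" "xv \<noteq> 0\<^sub>v m" "C t *\<^sub>v xv = e \<cdot>\<^sub>v xv"
    using C[of t] by (auto simp: eigenvalue_def eigenvector_def)
  define x where "x i = vec_index xv i" for i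
  have Cx: "(\<Sum>j<m. B i j * x j) + (\<Sum>l<k. complex_of_real (t - d l) * v l i * (\<Sum>j<m. cnj (v l j) * x j)) = e * x i"
    if i: "i < m" for i
  proof -
    have "e * x i = vec_index (C t *\<^sub>v xv) i" using xv(1) i by (simp add: xv(3) x_def)
    also have "\<dots> = (\<Sum>j<m. (B i j + (\<Sum>l<k. complex_of_real (t - d l) * v l i * cnj (v l j))) * x j)"
      using xv(1) i C[of t] by (simp add: scalar_prod_def C_def x_def atLeast0LessThan)
    also have "\<dots> = (\<Sum>j<m. B i j * x j) + (\<Sum>j<m. \<Sum>l<k. complex_of_real (t - d l) * v l i * cnj (v l j) * x j)"
      by (simp add: distrib_right sum.distrib sum_distrib_right)
    also have "(\<Sum>j<m. \<Sum>l<k. complex_of_real (t - d l) * v l i * cnj (v l j) * x j)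
        = (\<Sum>l<k. complex_of_real (t - d l) * v l i * (\<Sum>j<m. cnj (v l j) * x j))"
      unfolding sum_distrib_left by (subst sum.swap) (simp add: mult_ac)
    finally show ?thesis by simp
  qed
  have orth: "(\<Sum>i<m. cnj (v l i) * x i) = 0" if l: "l < k" for l
  proof -
    let ?c = "\<lambda>l. \<Sum>j<m. cnj (v l j) * x j"
    \<comment> \<open>Pairing the eigenvalue equation with v l: self-adjointness gives d l, the
      deflation adds t - d l, and the coefficient satisfies (e - t) c = 0.\<close>
    have "e * ?c l = (\<Sum>i<m. cnj (v l i) * (e * x i))" by (simp add: sum_distrib_left mult_ac)
    also have "\<dots> = (\<Sum>i<m. cnj (v l i) * ((\<Sum>j<m. B i j * x j) + (\<Sum>l'<k. complex_of_real (t - d l') * v l' i * ?c l')))"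
      by (rule sum.cong[OF refl]) (simp only: Cx lessThan_iff)
    also have "\<dots> = (\<Sum>i<m. cnj (v l i) * (\<Sum>j<m. B i j * x j))
        + (\<Sum>i<m. \<Sum>l'<k. complex_of_real (t - d l') * ?c l' * (cnj (v l i) * v l' i))"
      by (simp add: distrib_left sum.distrib sum_distrib_left mult_ac)
    also have "(\<Sum>i<m. cnj (v l i) * (\<Sum>j<m. B i j * x j)) = complex_of_real (d l) * ?c l"
      unfolding selfadj using ev[OF l] by (simp add: sum_distrib_left mult_ac)
    also have "(\<Sum>i<m. \<Sum>l'<k. complex_of_real (t - d l') * ?c l' * (cnj (v l i) * v l' i))
        = (\<Sum>l'<k. complex_of_real (t - d l') * ?c l' * (\<Sum>i<m. cnj (v l i) * v l' i))"
      unfolding sum_distrib_left[of _ "\<lambda>i. cnj (v l i) * v _ i"] by (rule sum.swap)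
    also have "\<dots> = (\<Sum>l'<k. if l' = l then complex_of_real (t - d l') * ?c l' else 0)"
      using l by (intro sum.cong refl) (auto simp: on)
    also have "\<dots> = complex_of_real (t - d l) * ?c l" using l by simp
    finally have "(e - complex_of_real t) * ?c l = 0" by (simp add: algebra_simps)
    then show ?thesis using e(2) by simp
  qed
  \<comment> \<open>By orthogonality the deflation vanishes on x, which is thus an eigenvector of B
    itself.\<close>
  have Bx: "(\<Sum>j<m. B i j * x j) = e * x i" if "i < m" for i
    using Cx[OF that] by (simp add: orth)
  define N where "N = (\<Sum>i<m. (cmod (x i))\<^sup>2)"
  have xx: "(\<Sum>i<m. cnj (x i) * x i) = complex_of_real N"
    by (simp add: N_def complex_norm_square[unfolded of_real_power] mult.commute)
  have N: "0 < N"
  proof -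
    have "\<exists>i<m. x i \<noteq> 0"
    proof (rule ccontr)
      assume "\<not> ?thesis"
      then have "xv = 0\<^sub>v m" using xv(1) by (intro eq_vecI) (auto simp: x_def)
      then show False using xv(2) by simp
    qed
    then obtain i where "i < m" "x i \<noteq> 0" by blast
    then show ?thesis unfolding N_def by (intro sum_pos2[of _ i]) auto
  qed
  have e_real: "e = complex_of_real (Re e)"
  proof -
    have "e * complex_of_real N = (\<Sum>i<m. cnj (x i) * (e * x i))"
      unfolding xx[symmetric] by (simp add: sum_distrib_left mult_ac)
    also have "\<dots> = (\<Sum>i<m. cnj (x i) * (\<Sum>j<m. B i j * x j))"
      by (rule sum.cong[OF refl]) (simp only: Bx lessThan_iff)
    also have "\<dots> = (\<Sum>i<m. cnj (e * x i) * x i)" unfolding selfadj by (simp add: Bx)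
    also have "\<dots> = cnj e * complex_of_real N"
      unfolding xx[symmetric] by (simp add: sum_distrib_left mult_ac)
    finally have "e = cnj e" using N by simp
    from arg_cong[OF this, of Im] have "Im e = 0" by simp
    then show ?thesis by (simp add: complex_eq_iff)
  qed
  define v' where "v' l i = (if l = k then x i / complex_of_real (sqrt N) else v l i)" for l i
  define d' where "d' l = (if l = k then Re e else d l)" for l
  have orth': "(\<Sum>i<m. cnj (x i) * v l i) = 0" if "l < k" for l
  proof -
    have "(\<Sum>i<m. cnj (x i) * v l i) = cnj (\<Sum>i<m. cnj (v l i) * x i)" by (simp add: mult.commute)
    then show ?thesis using orth[OF that] by simp
  qed
  have sq: "complex_of_real (sqrt N) * complex_of_real (sqrt N) = complex_of_real N"
    using N by (simp flip: of_real_mult)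
  show ?case
  proof (intro exI[of _ v'] exI[of _ d'] conjI allI impI)
    fix l i assume l: "l < Suc k" and i: "i < m"
    show "(\<Sum>j<m. B i j * v' l j) = complex_of_real (d' l) * v' l i"
    proof (cases "l = k")
      case True
      have "(\<Sum>j<m. B i j * v' l j) = (\<Sum>j<m. B i j * x j) / complex_of_real (sqrt N)"
        using True by (simp add: v'_def sum_divide_distrib)
      then show ?thesis using True Bx[OF i] e_real by (simp add: v'_def d'_def)
    next
      case False
      then show ?thesis using l i ev by (simp add: v'_def d'_def)
    qed
  next
    fix l l' assume l: "l < Suc k" "l' < Suc k"
    consider "l < k" "l' < k" | "l = k" "l' < k" | "l < k" "l' = k" | "l = k" "l' = k"
      using l by linarith
    then show "(\<Sum>i<m. cnj (v' l i) * v' l' i) = (if l = l' then 1 else 0)"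
    proof cases
      case 1
      then show ?thesis using on by (simp add: v'_def)
    next
      case 2
      then show ?thesis using orth'[of l'] by (simp add: v'_def flip: sum_divide_distrib)
    next
      case 3
      then show ?thesis using orth[of l] by (simp add: v'_def flip: sum_divide_distrib)
    next
      case 4
      have "(\<Sum>i<m. cnj (v' l i) * v' l' i) = (\<Sum>i<m. cnj (x i) * x i) / complex_of_real N"
        using 4 sq by (simp add: v'_def sum_divide_distrib)
      then show ?thesis using 4 N xx by simp
    qed
  qed
qed

text \<open>One identity with three uses: V = A and f = 1 gives the squared norm of the adjoint
  applied to x, V = U and f = d the spectral form, V = U and f = 1 Parseval's identity.\<close>

lemma hermitian_form_decomposition:
  fixes V :: "nat \<Rightarrow> nat \<Rightarrow> complex" and f x :: "nat \<Rightarrow> complex"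
  shows "(\<Sum>i<m. cnj (x i) * (\<Sum>j<m. (\<Sum>l<m. V i l * f l * cnj (V j l)) * x j))
    = (\<Sum>l<m. f l * complex_of_real ((cmod (\<Sum>i<m. cnj (V i l) * x i))\<^sup>2))"
proof -
  let ?z = "\<lambda>l. \<Sum>i<m. cnj (V i l) * x i"
  have "(\<Sum>i<m. cnj (x i) * (\<Sum>j<m. (\<Sum>l<m. V i l * f l * cnj (V j l)) * x j))
      = (\<Sum>i<m. \<Sum>j<m. \<Sum>l<m. f l * ((V i l * cnj (x i)) * (cnj (V j l) * x j)))"
    unfolding sum_distrib_left sum_distrib_right by (intro sum.cong refl) (simp only: mult_ac)
  also have "\<dots> = (\<Sum>i<m. \<Sum>l<m. \<Sum>j<m. f l * ((V i l * cnj (x i)) * (cnj (V j l) * x j)))"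
    by (rule sum.cong[OF refl], rule sum.swap)
  also have "\<dots> = (\<Sum>l<m. \<Sum>i<m. \<Sum>j<m. f l * ((V i l * cnj (x i)) * (cnj (V j l) * x j)))"
    by (rule sum.swap)
  also have "\<dots> = (\<Sum>l<m. f l * ((\<Sum>i<m. V i l * cnj (x i)) * ?z l))"
    by (simp only: sum_product) (simp only: sum_distrib_left)
  also have "\<dots> = (\<Sum>l<m. f l * (?z l * cnj (?z l)))"
    by (intro sum.cong refl) (simp add: mult.commute)
  also have "\<dots> = (\<Sum>l<m. f l * complex_of_real ((cmod (?z l))\<^sup>2))"
    by (simp only: complex_norm_square)
  finally show ?thesis .
qed

lemma mult_adjoint_spectral:
  fixes A :: "complex mat"
  assumes A: "A \<in> carrier_mat m m"
  obtains U d where "U \<in> carrier_mat m m" "U * mat_adjoint U = 1\<^sub>m m" "mat_adjoint U * U = 1\<^sub>m m"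
    "\<And>i. i < m \<Longrightarrow> 0 \<le> d i"
    "A * mat_adjoint A = U * mat_diag m (\<lambda>i. complex_of_real (d i)) * mat_adjoint U"
proof -
  define B where "B = A * mat_adjoint A"
  have B: "B \<in> carrier_mat m m" using A by (auto simp: B_def)
  have Bij: "B $$ (i, j) = (\<Sum>l<m. A $$ (i, l) * cnj (A $$ (j, l)))" if "i < m" "j < m" for i j
    unfolding B_def using that A by (intro index_mult_adjoint)
  have herm: "B $$ (j, i) = cnj (B $$ (i, j))" if "i < m" "j < m" for i j
    using that by (simp add: Bij mult.commute)
  obtain v d where H: "\<forall>l<m. \<forall>i<m. (\<Sum>j<m. B $$ (i, j) * v l j) = complex_of_real (d l) * v l i"
      "\<forall>l<m. \<forall>l'<m. (\<Sum>i<m. cnj (v l i) * v l' i) = (if l = l' then 1 else 0)"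
    using orthonormal_eigenvectors[of m "\<lambda>i j. B $$ (i, j)" m, OF herm order_refl] by blast
  have ev: "(\<Sum>j<m. B $$ (i, j) * v l j) = complex_of_real (d l) * v l i" if "l < m" "i < m" for l i
    using H(1) that by blast
  have on: "(\<Sum>i<m. cnj (v l i) * v l' i) = (if l = l' then 1 else 0)" if "l < m" "l' < m" for l l'
    using H(2) that by blast
  define U where "U = mat m m (\<lambda>(i, l). v l i)"
  let ?D = "mat_diag m (\<lambda>i. complex_of_real (d i))"
  have U: "U \<in> carrier_mat m m" by (simp add: U_def)
  have UU: "mat_adjoint U * U = 1\<^sub>m m"
  proof (rule eq_matI)
    fix i j assume "i < dim_row (1\<^sub>m m :: complex mat)" "j < dim_col (1\<^sub>m m :: complex mat)"
    then have ij: "i < m" "j < m" by auto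
    have "(mat_adjoint U * U) $$ (i, j) = (\<Sum>l<m. cnj (U $$ (l, i)) * U $$ (l, j))"
      using ij by (intro index_adjoint_mult[OF U U])
    then show "(mat_adjoint U * U) $$ (i, j) = 1\<^sub>m m $$ (i, j)" using ij on by (simp add: U_def)
  qed (use carrier_matD[OF U] carrier_matD[OF mat_adjoint_carrier[OF U]] in auto)
  have UU': "U * mat_adjoint U = 1\<^sub>m m"
    using U UU by (intro mat_mult_left_right_inverse[of "mat_adjoint U" m U]) auto
  have "B * U = U * ?D"
  proof (rule eq_matI)
    fix i l assume "i < dim_row (U * ?D)" "l < dim_col (U * ?D)"
    then have il: "i < m" "l < m" using U by (auto simp: mat_diag_def)
    have "(B * U) $$ (i, l) = (\<Sum>j<m. B $$ (i, j) * v l j)"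
      using il by (subst index_mult_mat_sum[OF B U]) (auto simp: U_def)
    also have "\<dots> = (U * ?D) $$ (i, l)"
      using il U by (subst mat_diag_mult_right[OF U]) (simp add: ev U_def mult.commute[of "v l i"])
    finally show "(B * U) $$ (i, l) = (U * ?D) $$ (i, l)" .
  qed (use B U in \<open>auto simp: mat_diag_def\<close>)
  then have "U * ?D * mat_adjoint U = B * U * mat_adjoint U" by simp
  also have "\<dots> = B * (U * mat_adjoint U)" using B U by (intro assoc_mult_mat[of _ m m _ m _ m]) auto
  also have "\<dots> = B" using B UU' by simp
  finally have decomp: "A * mat_adjoint A = U * ?D * mat_adjoint U" by (simp add: B_def)
  \<comment> \<open>The eigenvalue is the value of the form at a unit eigenvector, hence the squared
    norm of the adjoint of A applied to it.\<close>
  have "0 \<le> d l" if l: "l < m" for l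
  proof -
    let ?z = "\<lambda>k. \<Sum>j<m. cnj (A $$ (j, k)) * v l j"
    have "complex_of_real (d l) = (\<Sum>i<m. cnj (v l i) * (complex_of_real (d l) * v l i))"
      using on[OF l l] by (simp add: mult.left_commute flip: sum_distrib_left)
    also have "\<dots> = (\<Sum>i<m. cnj (v l i) * (\<Sum>j<m. B $$ (i, j) * v l j))" using l by (simp add: ev)
    also have "\<dots> = (\<Sum>i<m. cnj (v l i) * (\<Sum>j<m. (\<Sum>k<m. A $$ (i, k) * 1 * cnj (A $$ (j, k))) * v l j))"
      by (simp add: Bij)
    also have "\<dots> = complex_of_real (\<Sum>k<m. (cmod (?z k))\<^sup>2)"
      unfolding hermitian_form_decomposition by simp
    finally have "d l = (\<Sum>k<m. (cmod (?z k))\<^sup>2)" by (simp only: of_real_eq_iff)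
    then show ?thesis by (simp add: sum_nonneg)
  qed
  then show ?thesis by (intro that[of U d] U UU UU' decomp)
qed

lemma mtrace_unitary_diag:
  assumes U: "U \<in> carrier_mat m m" and UU: "mat_adjoint U * U = 1\<^sub>m m"
  shows "mtrace (U * mat_diag m f * mat_adjoint U) = (\<Sum>i<m. f i)"
proof -
  let ?D = "mat_diag m f"
  have D: "?D \<in> carrier_mat m m" by simp
  have "mtrace (U * ?D * mat_adjoint U) = mtrace (mat_adjoint U * (U * ?D))"
    using U D by (intro mtrace_comm[of _ m m]) auto
  also have "mat_adjoint U * (U * ?D) = (mat_adjoint U * U) * ?D"
    using U D by (intro assoc_mult_mat[of _ m m _ m _ m, symmetric]) auto
  also have "\<dots> = ?D" unfolding UU by (rule left_mult_one_mat[OF D])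
  finally show ?thesis by (simp add: mtrace_def mat_diag_def)
qed

lemma mtrace_mult_adjoint:
  fixes A :: "complex mat"
  assumes A: "A \<in> carrier_mat m m"
  shows "mtrace (A * mat_adjoint A) = complex_of_real (\<Sum>i<m. \<Sum>j<m. (cmod (A $$ (i, j)))\<^sup>2)"
  using A by (simp add: mtrace_def index_mult_adjoint[OF A A] complex_norm_square[unfolded of_real_power] del: index_mult_mat(1))

text \<open>Makes an infinite moment dominate for nonzero A. The power is a choice, so existence
  comes from the spectral theorem; for whichever decomposition is taken, the trace is the sum of the
  d i powr r, and some d i is positive because the d i sum to the squared Frobenius norm.\<close>

lemma mtrace_psd_power_pos:
  fixes A :: "complex mat"
  assumes A: "A \<in> carrier_mat m m" and nz: "0 < (\<Sum>i<m. \<Sum>j<m. (cmod (A $$ (i, j)))\<^sup>2)"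
  shows "0 < Re (mtrace (psd_power (A * mat_adjoint A) r))"
proof -
  let ?B = "A * mat_adjoint A"
  have dim: "dim_row ?B = m" using A by simp
  have "\<exists>C. is_psd_power ?B r C"
  proof -
    obtain U d where U: "U \<in> carrier_mat m m" "U * mat_adjoint U = 1\<^sub>m m" "mat_adjoint U * U = 1\<^sub>m m"
      and d: "\<And>i. i < m \<Longrightarrow> 0 \<le> d i"
      and B: "?B = U * mat_diag m (\<lambda>i. complex_of_real (d i)) * mat_adjoint U"
      by (rule mult_adjoint_spectral[OF A]) blast
    have "is_psd_power ?B r (U * mat_diag m (\<lambda>i. complex_of_real (d i powr r)) * mat_adjoint U)"
      unfolding is_psd_power_def Let_def dim
      by (rule bexI[OF _ U(1)], rule exI[of _ d]) (intro conjI U(2,3) B refl allI impI d)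
    then show ?thesis ..
  qed
  then have "is_psd_power ?B r (psd_power ?B r)" unfolding psd_power_def by (rule someI_ex)
  then obtain U d where U: "U \<in> carrier_mat m m" "mat_adjoint U * U = 1\<^sub>m m"
    and d: "\<And>i. i < m \<Longrightarrow> 0 \<le> d i"
    and B: "?B = U * mat_diag m (\<lambda>i. complex_of_real (d i)) * mat_adjoint U"
    and P: "psd_power ?B r = U * mat_diag m (\<lambda>i. complex_of_real (d i powr r)) * mat_adjoint U"
    unfolding is_psd_power_def Let_def dim by blast
  have "complex_of_real (\<Sum>i<m. d i) = complex_of_real (\<Sum>i<m. \<Sum>j<m. (cmod (A $$ (i, j)))\<^sup>2)"
    unfolding mtrace_mult_adjoint[OF A, symmetric] B mtrace_unitary_diag[OF U] by simp
  then have "0 < (\<Sum>i<m. d i)" using nz by (simp only: of_real_eq_iff)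
  then obtain i where i: "i < m" "0 < d i"
    by (metis lessThan_iff not_le sum_nonpos)
  have "0 < (\<Sum>i<m. d i powr r)" using i by (intro sum_pos2[of _ i]) auto
  then show ?thesis unfolding P mtrace_unitary_diag[OF U] by simp
qed

text \<open>Each diagonal entry of a spectral decomposition is a real eigenvalue and hence below the
  maximum; expanding x in the eigenbasis does the rest. For m = 0 there are no eigenvalues and
  \<open>Max\<close> is taken over the empty set, which explains the premise of the second
  claim.\<close>

lemma spectral_norm_bound:
  fixes A :: "complex mat" and x :: "nat \<Rightarrow> complex"
  assumes A: "A \<in> carrier_mat m m"
  shows "(\<Sum>k<m. (cmod (\<Sum>i<m. cnj (A $$ (i, k)) * x i))\<^sup>2) \<le> (spectral_norm A)\<^sup>2 * (\<Sum>i<m. (cmod (x i))\<^sup>2)"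
    and "0 < m \<Longrightarrow> 0 \<le> spectral_norm A"
proof -
  let ?B = "A * mat_adjoint A"
  obtain U d where U: "U \<in> carrier_mat m m" "U * mat_adjoint U = 1\<^sub>m m" "mat_adjoint U * U = 1\<^sub>m m"
    and d0: "\<And>i. i < m \<Longrightarrow> 0 \<le> d i"
    and B: "?B = U * mat_diag m (\<lambda>i. complex_of_real (d i)) * mat_adjoint U"
    by (rule mult_adjoint_spectral[OF A]) blast
  have Bc: "?B \<in> carrier_mat m m" using A by simp
  let ?D = "mat_diag m (\<lambda>i. complex_of_real (d i))"
  let ?\<Lambda> = "largest_eigenvalue ?B"
  have fin: "finite {x :: real. eigenvalue ?B (complex_of_real x)}"
  proof -
    have "finite (spectrum ?B)" using card_finite_spectrum[OF Bc] by simp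
    then have "finite (complex_of_real -` spectrum ?B)"
      by (intro finite_vimageI) (auto simp: inj_on_def)
    then show ?thesis by (simp add: spectrum_def vimage_def)
  qed
  have d_le: "d l \<le> ?\<Lambda>" if l: "l < m" for l
  proof -
    have BU: "?B * U = U * ?D"
    proof -
      have "?B * U = U * ?D * (mat_adjoint U * U)"
        unfolding B using U by (intro assoc_mult_mat[of _ m m _ m _ m]) auto
      moreover have "U * ?D \<in> carrier_mat m m" by (rule mult_carrier_mat[OF U(1) mat_diag_dim])
      ultimately show ?thesis unfolding U(3) by (simp only: right_mult_one_mat)
    qed
    have "eigenvector ?B (col U l) (complex_of_real (d l))"
      unfolding eigenvector_def
    proof (intro conjI)
      show "col U l \<in> carrier_vec (dim_row ?B)" 
        by (rule carrier_vecI) (use carrier_matD[OF U(1)] carrier_matD[OF A] in simp)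
      show "col U l \<noteq> 0\<^sub>v (dim_row ?B)"
      proof
        assume z: "col U l = 0\<^sub>v (dim_row ?B)"
        have "U $$ (i, l) = 0" if i: "i < m" for i
        proof -
          have "U $$ (i, l) = vec_index (col U l) i"
            using i l carrier_matD[OF U(1)] by simp
          also have "\<dots> = 0" unfolding z using i carrier_matD[OF A] by simp
          finally show ?thesis .
        qed
        then have "(mat_adjoint U * U) $$ (l, l) = 0"
          unfolding index_adjoint_mult[OF U(1) U(1) l l] by (intro sum.neutral) simp
        then show False unfolding U(3) using l by simp
      qed
      have "?B *\<^sub>v col U l = col (?B * U) l" using Bc U(1) l by (intro col_mult2[symmetric]) auto
      also have "\<dots> = complex_of_real (d l) \<cdot>\<^sub>v col U l"
        unfolding BU mat_diag_mult_right[OF U(1)]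
        using carrier_matD[OF U(1)] l by (intro eq_vecI) (simp_all add: mult.commute)
      finally show "?B *\<^sub>v col U l = complex_of_real (d l) \<cdot>\<^sub>v col U l" .
    qed
    then show ?thesis
      unfolding largest_eigenvalue_def by (intro Max_ge fin CollectI) (unfold eigenvalue_def, rule exI)
  qed
  have \<Lambda>: "0 \<le> ?\<Lambda>" if "0 < m" using d0[OF that] d_le[OF that] by linarith
  then show "0 < m \<Longrightarrow> 0 \<le> spectral_norm A" by (simp add: spectral_norm_def)
  define y where "y l = (\<Sum>i<m. cnj (U $$ (i, l)) * x i)" for l
  have UDU: "(U * mat_diag m f * mat_adjoint U) $$ (i, j) = (\<Sum>l<m. U $$ (i, l) * f l * cnj (U $$ (j, l)))"
    if "i < m" "j < m" for i j f
    using that U(1) by (subst index_mult_adjoint[of _ m m]) (auto simp: mat_diag_mult_right[OF U(1)] simp del: index_mult_mat(1))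
  \<comment> \<open>Parseval's identity for the unitary U.\<close>
  have nx: "(\<Sum>i<m. (cmod (x i))\<^sup>2) = (\<Sum>l<m. (cmod (y l))\<^sup>2)"
  proof -
    have "complex_of_real (\<Sum>l<m. (cmod (y l))\<^sup>2)
        = (\<Sum>i<m. cnj (x i) * (\<Sum>j<m. (\<Sum>l<m. U $$ (i, l) * 1 * cnj (U $$ (j, l))) * x j))"
      unfolding hermitian_form_decomposition y_def by simp
    also have "\<dots> = (\<Sum>i<m. cnj (x i) * (\<Sum>j<m. (if i = j then 1 else 0) * x j))"
    proof (intro sum.cong refl arg_cong2[of _ _ _ _ "(*)"])
      fix i j assume ij: "i \<in> {..<m}" "j \<in> {..<m}"
      have "(\<Sum>l<m. U $$ (i, l) * 1 * cnj (U $$ (j, l))) = (U * mat_adjoint U) $$ (i, j)"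
        using ij U(1) by (subst index_mult_adjoint[of _ m m]) auto
      then show "(\<Sum>l<m. U $$ (i, l) * 1 * cnj (U $$ (j, l))) = (if i = j then 1 else 0)"
        using ij U(2) by simp
    qed
    also have "\<dots> = (\<Sum>i<m. cnj (x i) * x i)"
      by (intro sum.cong refl) (simp add: if_distrib[of "\<lambda>u. u * _"] cong: if_cong)
    also have "\<dots> = complex_of_real (\<Sum>i<m. (cmod (x i))\<^sup>2)"
      by (simp add: complex_norm_square[unfolded of_real_power] mult.commute)
    finally show ?thesis by (simp only: of_real_eq_iff)
  qed
  have entries: "(\<Sum>l<m. A $$ (i, l) * 1 * cnj (A $$ (j, l)))
      = (\<Sum>l<m. U $$ (i, l) * complex_of_real (d l) * cnj (U $$ (j, l)))"
    if ij: "i < m" "j < m" for i j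
  proof -
    have "(\<Sum>l<m. A $$ (i, l) * 1 * cnj (A $$ (j, l))) = ?B $$ (i, j)"
      using ij A by (subst index_mult_adjoint[of _ m m]) auto
    also have "\<dots> = (\<Sum>l<m. U $$ (i, l) * complex_of_real (d l) * cnj (U $$ (j, l)))"
      unfolding B using ij by (intro UDU) auto
    finally show ?thesis .
  qed
  have "complex_of_real (\<Sum>k<m. (cmod (\<Sum>i<m. cnj (A $$ (i, k)) * x i))\<^sup>2)
      = (\<Sum>i<m. cnj (x i) * (\<Sum>j<m. (\<Sum>l<m. A $$ (i, l) * 1 * cnj (A $$ (j, l))) * x j))"
    unfolding hermitian_form_decomposition by simp
  also have "\<dots> = (\<Sum>i<m. cnj (x i) * (\<Sum>j<m. (\<Sum>l<m. U $$ (i, l) * complex_of_real (d l) * cnj (U $$ (j, l))) * x j))"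
    by (rule sum.cong[OF refl], rule arg_cong2[where f = "(*)", OF refl], rule sum.cong[OF refl],
        rule arg_cong2[where f = "(*)", OF _ refl], rule entries) simp_all
  also have "\<dots> = complex_of_real (\<Sum>l<m. d l * (cmod (y l))\<^sup>2)"
    unfolding hermitian_form_decomposition y_def by simp
  finally have "(\<Sum>k<m. (cmod (\<Sum>i<m. cnj (A $$ (i, k)) * x i))\<^sup>2) = (\<Sum>l<m. d l * (cmod (y l))\<^sup>2)"
    by (simp only: of_real_eq_iff)
  also have "\<dots> \<le> (\<Sum>l<m. ?\<Lambda> * (cmod (y l))\<^sup>2)" using d_le by (intro sum_mono mult_right_mono) auto
  also have "\<dots> = ?\<Lambda> * (\<Sum>i<m. (cmod (x i))\<^sup>2)" by (simp add: nx sum_distrib_left)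
  also have "\<dots> = (spectral_norm A)\<^sup>2 * (\<Sum>i<m. (cmod (x i))\<^sup>2)"
    using \<Lambda> by (cases "m = 0") (auto simp: spectral_norm_def)
  finally show "(\<Sum>k<m. (cmod (\<Sum>i<m. cnj (A $$ (i, k)) * x i))\<^sup>2) \<le> (spectral_norm A)\<^sup>2 * (\<Sum>i<m. (cmod (x i))\<^sup>2)" .
qed

text \<open>At a real vector x the squared norm of the adjoint applied to x is the sum of those of
  the transposed real and imaginary parts, so each is bounded; transposing again gives the
  claim.\<close>

lemma op_bounded_Re_Im:
  fixes A :: "complex mat"
  assumes A: "A \<in> carrier_mat m m" and m: "0 < m" and L: "spectral_norm A \<le> L"
  shows "op_bounded m (\<lambda>i j. Re (A $$ (i, j))) L" "op_bounded m (\<lambda>i j. Im (A $$ (i, j))) L"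
proof -
  have N: "0 \<le> spectral_norm A" using spectral_norm_bound(2)[OF A m] .
  then have L0: "0 \<le> L" using L by simp
  have le: "(\<Sum>j<m. (cmod (\<Sum>i<m. cnj (A $$ (i, j)) * complex_of_real (x i)))\<^sup>2) \<le> L\<^sup>2 * (\<Sum>i<m. (x i)\<^sup>2)"
    for x :: "nat \<Rightarrow> real"
  proof -
    have "(\<Sum>j<m. (cmod (\<Sum>i<m. cnj (A $$ (i, j)) * complex_of_real (x i)))\<^sup>2)
        \<le> (spectral_norm A)\<^sup>2 * (\<Sum>i<m. (x i)\<^sup>2)"
      using spectral_norm_bound(1)[OF A, of "\<lambda>i. complex_of_real (x i)"] by simp
    also have "\<dots> \<le> L\<^sup>2 * (\<Sum>i<m. (x i)\<^sup>2)"
      using N L by (intro mult_right_mono power_mono sum_nonneg) auto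
    finally show ?thesis .
  qed
  have re: "Re (\<Sum>i<m. cnj (A $$ (i, j)) * complex_of_real (x i)) = (\<Sum>i<m. Re (A $$ (i, j)) * x i)"
    and im: "Im (\<Sum>i<m. cnj (A $$ (i, j)) * complex_of_real (x i)) = - (\<Sum>i<m. Im (A $$ (i, j)) * x i)"
    for j and x :: "nat \<Rightarrow> real"
    by (simp_all add: sum_negf)
  have "op_bounded m (\<lambda>j i. Re (A $$ (i, j))) L"
    unfolding op_bounded_def
  proof
    fix x :: "nat \<Rightarrow> real"
    show "(\<Sum>j<m. (\<Sum>i<m. Re (A $$ (i, j)) * x i)\<^sup>2) \<le> L\<^sup>2 * (\<Sum>i<m. (x i)\<^sup>2)"
      unfolding re[symmetric]
      by (intro order_trans[OF sum_mono le]) (simp add: cmod_power2)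
  qed
  from op_bounded_transpose[OF this L0] show "op_bounded m (\<lambda>i j. Re (A $$ (i, j))) L" by simp
  have "op_bounded m (\<lambda>j i. Im (A $$ (i, j))) L"
    unfolding op_bounded_def
  proof
    fix x :: "nat \<Rightarrow> real"
    have "(\<Sum>i<m. Im (A $$ (i, j)) * x i)\<^sup>2 = (Im (\<Sum>i<m. cnj (A $$ (i, j)) * complex_of_real (x i)))\<^sup>2" for j
      unfolding im by simp
    then show "(\<Sum>j<m. (\<Sum>i<m. Im (A $$ (i, j)) * x i)\<^sup>2) \<le> L\<^sup>2 * (\<Sum>i<m. (x i)\<^sup>2)"
      by (simp only:) (intro order_trans[OF sum_mono le], simp add: cmod_power2)
  qed
  from op_bounded_transpose[OF this L0] show "op_bounded m (\<lambda>i j. Im (A $$ (i, j))) L" by simp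
qed

section \<open>Quadratic forms in the normalised vector\<close>

context positive_sample
begin

lemma ratio_form_meas[measurable]: "ratio_form a \<in> borel_measurable M"
  using w_meas by (intro borel_measurable_diff borel_measurable_sum borel_measurable_times
      borel_measurable_divide borel_measurable_const wbar_meas) auto

lemma const_nonneg: "0 \<le> norm_const q s C" "0 \<le> core_const q \<mu> s C"
  unfolding norm_const_def core_const_def using rosenthal_const_nonneg
  by (auto intro!: mult_nonneg_nonneg add_nonneg_nonneg)

text \<open>Instance L = F = sqrt G of \<open>core_bound\<close>, with \<open>\<theta>\<close>
  absorbed into 1 + m. Strict positivity of G is inherited from L, so the zero matrix is treated
  separately.\<close>

lemma ratio_form_frobenius:
  assumes G: "0 < G" "(\<Sum>i<p. \<Sum>j<p. (a i j)\<^sup>2) \<le> G"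
  shows "(\<integral>\<^sup>+x. \<bar>ratio_form a x\<bar> powr q \<partial>M)
    \<le> ennreal (core_const q \<mu> s C * ((quad_const q s C * (2 + rosenthal_const q * (s powr (q / 2) + 1)) + 2) * (1 + m)
        * G powr (q / 2)))"
proof -
  let ?F = "sqrt G"
  let ?k = "quad_const q s C * (2 + rosenthal_const q * (s powr (q / 2) + 1))"
  have F: "0 < ?F" "(\<Sum>i<p. \<Sum>j<p. (a i j)\<^sup>2) \<le> ?F\<^sup>2" using G by auto
  have Fq: "?F powr q = G powr (q / 2)" using abs_powr_eq_square_powr[of ?F q] G by simp
  have k: "0 \<le> ?k"
    using const_nonneg quad_const_nonneg[of q s C] rosenthal_const_nonneg[of q] by (intro mult_nonneg_nonneg add_nonneg_nonneg) auto
  have \<theta>: "\<theta> \<le> 1 + m"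
  proof -
    have "real p powr (1 - q) \<le> real p powr 0" using p q by (intro powr_mono) auto
    then have "real p powr (1 - q) * m \<le> 1 * m" using p m_nonneg by (intro mult_right_mono) auto
    then show ?thesis by (simp add: \<theta>_def)
  qed
  have "(\<integral>\<^sup>+x. \<bar>ratio_form a x\<bar> powr q \<partial>M) \<le> ennreal (core_const q \<mu> s C) *
      ((\<integral>\<^sup>+x. \<bar>centred_form a x\<bar> powr q \<partial>M)
        + ennreal (\<theta> * ?F powr q + (1 + m) * ?F powr q))"
    by (intro core_bound F op_bounded_frobenius order_refl)
  also have "\<dots> \<le> ennreal (core_const q \<mu> s C) *
      (ennreal (?k * (1 + m) * G powr (q / 2)) + ennreal (2 * (1 + m) * G powr (q / 2)))"
  proof (intro mult_left_mono add_mono)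
    have "(\<integral>\<^sup>+x. \<bar>centred_form a x\<bar> powr q \<partial>M)
      \<le> ennreal (?k * (1 + m) * (\<Sum>i<p. \<Sum>j<p. (a i j)\<^sup>2) powr (q / 2))"
      by (rule quadratic_form_frobenius)
    also have "\<dots> \<le> ennreal (?k * (1 + m) * G powr (q / 2))"
      using G k m_nonneg q by (intro ennreal_leI mult_left_mono powr_mono2 sum_nonneg) auto
    finally show "(\<integral>\<^sup>+x. \<bar>centred_form a x\<bar> powr q \<partial>M)
      \<le> \<dots>" .
    have "(\<theta> + (1 + m)) * G powr (q / 2) \<le> (2 * (1 + m)) * G powr (q / 2)"
      using \<theta> by (intro mult_right_mono) auto
    then show "ennreal (\<theta> * ?F powr q + (1 + m) * ?F powr q) \<le> ennreal (2 * (1 + m) * G powr (q / 2))"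
      unfolding Fq by (intro ennreal_leI) (simp add: distrib_right)
  qed auto
  also have "\<dots> = ennreal (core_const q \<mu> s C * ((?k + 2) * (1 + m) * G powr (q / 2)))"
    using k m_nonneg const_nonneg
    by (simp add: ennreal_plus[symmetric] ennreal_mult[symmetric] distrib_right del: ennreal_plus)
  finally show ?thesis .
qed

text \<open>Here F = sqrt p L, since all p rows have norm at most L.\<close>

lemma ratio_form_operator:
  assumes L: "0 < L" and op: "op_bounded p a L"
  shows "(\<integral>\<^sup>+x. \<bar>ratio_form a x\<bar> powr q \<partial>M)
    \<le> ennreal (core_const q \<mu> s C * ((quad_const q s C * (2 + norm_const q s C) + 1)
        * \<theta> * L powr q * (real p powr (q / 2) + (1 + m) * real p)))"
proof -
  let ?F = "sqrt (real p) * L"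
  let ?k = "quad_const q s C * (2 + norm_const q s C)"
  let ?X = "L powr q * (real p powr (q / 2) + (1 + m) * real p)"
  have p1: "1 \<le> real p" using p by simp
  have row: "(\<Sum>j<p. (a i j)\<^sup>2) \<le> L\<^sup>2" if "i < p" for i
    using op L that by (intro op_bounded_row) auto
  have F: "L \<le> ?F" using p1 L by simp
  have F2: "(\<Sum>i<p. \<Sum>j<p. (a i j)\<^sup>2) \<le> ?F\<^sup>2"
  proof -
    have "(\<Sum>i<p. \<Sum>j<p. (a i j)\<^sup>2) \<le> (\<Sum>i<p. L\<^sup>2)" using row by (intro sum_mono) auto
    then show ?thesis by (simp add: power_mult_distrib)
  qed
  have Fq: "?F powr q = real p powr (q / 2) * L powr q"
    using abs_powr_eq_square_powr[of "sqrt (real p)" q] by (simp add: powr_mult)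
  have k: "0 \<le> ?k" using const_nonneg quad_const_nonneg[of q s C] by simp
  have X0: "0 \<le> \<theta> * ?X" using \<theta>_ge_1 m_nonneg by simp
  have "(\<integral>\<^sup>+x. \<bar>ratio_form a x\<bar> powr q \<partial>M) \<le> ennreal (core_const q \<mu> s C) *
      ((\<integral>\<^sup>+x. \<bar>centred_form a x\<bar> powr q \<partial>M)
        + ennreal (\<theta> * ?F powr q + (1 + m) * L powr q))"
    by (intro core_bound L F F2 op)
  also have "\<dots> \<le> ennreal (core_const q \<mu> s C) * (ennreal (?k * (\<theta> * ?X)) + ennreal (\<theta> * ?X))"
  proof (intro mult_left_mono add_mono)
    show "(\<integral>\<^sup>+x. \<bar>centred_form a x\<bar> powr q \<partial>M)
      \<le> ennreal (?k * (\<theta> * ?X))"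
      using quadratic_form_operator[OF less_imp_le[OF L] op_boundedD[OF op] row] by (simp add: mult.assoc)
    show "ennreal (\<theta> * ?F powr q + (1 + m) * L powr q) \<le> ennreal (\<theta> * ?X)"
    proof (rule ennreal_leI)
      have "(1 + m) * L powr q * 1 \<le> (1 + m) * L powr q * (real p * \<theta>)"
        using m_nonneg p1 \<theta>_ge_1 mult_mono[of 1 "real p" 1 \<theta>] by (intro mult_left_mono) auto
      then show "\<theta> * ?F powr q + (1 + m) * L powr q \<le> \<theta> * ?X"
        unfolding Fq by (simp add: algebra_simps)
    qed
  qed auto
  also have "\<dots> = ennreal (core_const q \<mu> s C * (?k * (\<theta> * ?X) + \<theta> * ?X))"
    using k X0 const_nonneg
    by (simp add: ennreal_plus[symmetric] ennreal_mult[symmetric] mult_nonneg_nonneg del: ennreal_plus)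
  finally show ?thesis by (simp add: algebra_simps)
qed

text \<open>The vector is real, so the form splits into those of the real and imaginary parts of A
  and the real theory applies to each.\<close>

lemma quad_dev_eq:
  assumes A: "A \<in> carrier_mat p p" and n: "1 \<le> n"
  shows "quad_dev M n p w A x = complex_of_real (1 / real n) *
    Complex (ratio_form (\<lambda>i j. Re (A $$ (i, j))) x) (ratio_form (\<lambda>i j. Im (A $$ (i, j))) x)"
proof -
  let ?u = "\<lambda>j. w j x / wbar p w x - 1"
  let ?r = "\<lambda>j. complex_of_real (1 / sqrt (real n) * ?u j)"
  have r: "?r i * ?r j = complex_of_real (1 / real n) * complex_of_real (?u i * ?u j)" for i j
  proof -
    have "(1 / sqrt (real n) * ?u i) * (1 / sqrt (real n) * ?u j) = 1 / real n * (?u i * ?u j)"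
      using n by (simp add: field_simps)
    then show ?thesis by (simp only: of_real_mult[symmetric])
  qed
  have "scalar_prod (rvec n p w x) (A *\<^sub>v rvec n p w x) = (\<Sum>i<p. ?r i * (\<Sum>j<p. A $$ (i, j) * ?r j))"
    using A by (simp add: scalar_prod_def rvec_def atLeast0LessThan)
  also have "\<dots> = complex_of_real (1 / real n) * (\<Sum>i<p. \<Sum>j<p. A $$ (i, j) * complex_of_real (?u i * ?u j))"
    unfolding sum_distrib_left
  proof (intro sum.cong refl)
    fix i j
    have "?r i * (A $$ (i, j) * ?r j) = A $$ (i, j) * (?r i * ?r j)" by (simp only: mult_ac)
    then show "?r i * (A $$ (i, j) * ?r j)
        = complex_of_real (1 / real n) * (A $$ (i, j) * complex_of_real (?u i * ?u j))"
      unfolding r by (simp only: mult_ac)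
  qed
  finally have "quad_dev M n p w A x = complex_of_real (1 / real n) *
      ((\<Sum>i<p. \<Sum>j<p. A $$ (i, j) * complex_of_real (?u i * ?u j)) - complex_of_real (nu2 M p w) * (\<Sum>i<p. A $$ (i, i)))"
    using A by (simp add: quad_dev_def mtrace_def right_diff_distrib)
  also have "(\<Sum>i<p. \<Sum>j<p. A $$ (i, j) * complex_of_real (?u i * ?u j)) - complex_of_real (nu2 M p w) * (\<Sum>i<p. A $$ (i, i))
      = Complex (ratio_form (\<lambda>i j. Re (A $$ (i, j))) x) (ratio_form (\<lambda>i j. Im (A $$ (i, j))) x)"
    by (rule complex_eqI) (simp_all del: of_real_mult)
  finally show ?thesis .
qed

lemma quad_dev_moment_le:
  assumes A: "A \<in> carrier_mat p p" and n: "1 \<le> n"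
    and re: "(\<integral>\<^sup>+x. \<bar>ratio_form (\<lambda>i j. Re (A $$ (i, j))) x\<bar> powr q \<partial>M) \<le> ennreal B"
    and im: "(\<integral>\<^sup>+x. \<bar>ratio_form (\<lambda>i j. Im (A $$ (i, j))) x\<bar> powr q \<partial>M) \<le> ennreal B"
    and B: "0 \<le> B"
  shows "(\<integral>\<^sup>+x. ennreal (cmod (quad_dev M n p w A x) powr q) \<partial>M) \<le> ennreal (real n powr (- q) * 2 powr q * (2 * B))"
proof -
  let ?f = "ratio_form (\<lambda>i j. Re (A $$ (i, j)))" and ?g = "ratio_form (\<lambda>i j. Im (A $$ (i, j)))"
  have "(\<integral>\<^sup>+x. ennreal (cmod (quad_dev M n p w A x) powr q) \<partial>M)
      \<le> (\<integral>\<^sup>+x. ennreal (real n powr (- q) * 2 powr q) * (ennreal (\<bar>?f x\<bar> powr q) + ennreal (\<bar>?g x\<bar> powr q)) \<partial>M)"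
  proof (intro nn_integral_mono)
    fix x
    have "cmod (quad_dev M n p w A x) = 1 / real n * cmod (Complex (?f x) (?g x))"
      unfolding quad_dev_eq[OF A n] norm_mult norm_of_real by simp
    also have "\<dots> \<le> 1 / real n * (\<bar>?f x\<bar> + \<bar>?g x\<bar>)"
      using cmod_le[of "Complex (?f x) (?g x)"] by (intro mult_left_mono) auto
    finally have "cmod (quad_dev M n p w A x) powr q \<le> (1 / real n * (\<bar>?f x\<bar> + \<bar>?g x\<bar>)) powr q"
      using q by (intro powr_mono2) auto
    also have "\<dots> = real n powr (- q) * (\<bar>?f x\<bar> + \<bar>?g x\<bar>) powr q"
      by (simp add: powr_mult powr_divide powr_minus_divide)
    also have "\<dots> \<le> real n powr (- q) * (2 powr q * (\<bar>?f x\<bar> powr q + \<bar>?g x\<bar> powr q))"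
      using q by (intro mult_left_mono powr_add_le) auto
    finally show "ennreal (cmod (quad_dev M n p w A x) powr q)
        \<le> ennreal (real n powr (- q) * 2 powr q) * (ennreal (\<bar>?f x\<bar> powr q) + ennreal (\<bar>?g x\<bar> powr q))"
      by (simp add: ennreal_plus[symmetric] ennreal_mult[symmetric] mult.assoc ennreal_leI del: ennreal_plus)
  qed
  also have "\<dots> = ennreal (real n powr (- q) * 2 powr q)
      * ((\<integral>\<^sup>+x. \<bar>?f x\<bar> powr q \<partial>M) + (\<integral>\<^sup>+x. \<bar>?g x\<bar> powr q \<partial>M))"
    using ratio_form_meas by (simp add: nn_integral_cmult nn_integral_add)
  also have "\<dots> \<le> ennreal (real n powr (- q) * 2 powr q) * (ennreal B + ennreal B)"
    by (intro mult_left_mono add_mono re im) auto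
  also have "\<dots> = ennreal (real n powr (- q) * 2 powr q * (2 * B))"
    using B by (simp add: ennreal_plus[symmetric] ennreal_mult[symmetric] del: ennreal_plus)
  finally show ?thesis .
qed

lemma prob_Bc_eq: "prob_Bc M p w \<mu> \<epsilon> = prob {x \<in> space M. \<epsilon> < \<bar>t x\<bar>}"
  unfolding prob_Bc_def B_event_def by (intro arg_cong[of _ _ prob]) auto

lemma tail_bound:
  assumes u: "2 \<le> u" "u \<le> 2 * q" and \<epsilon>: "0 < \<epsilon>"
  shows "prob_Bc M p w \<mu> \<epsilon> \<le> rosenthal_const u * (s powr (u / 2) + (1 + m)) * real p powr (- u / 2) * \<epsilon> powr (- u)"
proof -
  let ?S = "\<lambda>x. \<Sum>j<p. 1 * (w j x - \<mu>)"
  have mu_u: "expectation (\<lambda>x. \<bar>w j x - \<mu>\<bar> powr u) \<le> 1 + m" if j: "j < p" for j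
  proof -
    have "expectation (\<lambda>x. \<bar>w j x - \<mu>\<bar> powr u) \<le> expectation (\<lambda>x. 1 + \<bar>w j x - \<mu>\<bar> powr (2 * q))"
      using int_powr[OF j] int[OF j] u q
      by (intro integral_mono powr_le_one_add_powr) auto
    also have "\<dots> \<le> 1 + m" using int[OF j] moment[OF j] by (simp add: prob_space)
    finally show ?thesis .
  qed
  have i: "integrable M (\<lambda>x. \<bar>?S x\<bar> powr u)" using u mu_u by (intro linear_form(1)) auto
  have "prob_Bc M p w \<mu> \<epsilon> \<le> prob {x \<in> space M. (real p * \<epsilon>) powr u \<le> \<bar>?S x\<bar> powr u}"
    unfolding prob_Bc_eq
  proof (rule finite_measure_mono)
    show "{x \<in> space M. \<epsilon> < \<bar>t x\<bar>} \<subseteq> {x \<in> space M. (real p * \<epsilon>) powr u \<le> \<bar>?S x\<bar> powr u}"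
    proof (safe)
      fix x assume "\<epsilon> < \<bar>t x\<bar>"
      then have "real p * \<epsilon> \<le> \<bar>?S x\<bar>" unfolding t_eq using p by (simp add: field_simps)
      then show "(real p * \<epsilon>) powr u \<le> \<bar>?S x\<bar> powr u" using u \<epsilon> by (intro powr_mono2) auto
    qed
    show "{x \<in> space M. (real p * \<epsilon>) powr u \<le> \<bar>?S x\<bar> powr u} \<in> sets M"
      using borel_measurable_integrable[OF i] by measurable
  qed
  also have "\<dots> \<le> expectation (\<lambda>x. \<bar>?S x\<bar> powr u) / (real p * \<epsilon>) powr u"
    using i p \<epsilon> by (intro integral_Markov_inequality_measure[where A = "{}"]) auto
  also have "\<dots> \<le> rosenthal_const u * (s powr (u / 2) + (1 + m)) * real p powr (u / 2) / (real p * \<epsilon>) powr u"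
    using u mu_u m_nonneg by (intro divide_right_mono linear_form_l2) auto
  also have "\<dots> = rosenthal_const u * (s powr (u / 2) + (1 + m)) * real p powr (- u / 2) * \<epsilon> powr (- u)"
  proof -
    have e: "- u / 2 = u / 2 - u" by simp
    have "real p powr (u / 2) / (real p * \<epsilon>) powr u = real p powr (- u / 2) * \<epsilon> powr (- u)"
      unfolding e powr_diff powr_mult by (simp add: powr_minus_divide)
    then show ?thesis by (simp only: times_divide_eq_right[symmetric] mult.assoc)
  qed
  finally show ?thesis .
qed

text \<open>Below order 2 Rosenthal's inequality is replaced by Chebyshev's: a probability is at
  most its own power u / 2, and the second moment bound is raised to that power.\<close>

lemma tail_bound_small:
  assumes u: "0 < u" "u \<le> 2" and \<epsilon>: "0 < \<epsilon>"
  shows "prob_Bc M p w \<mu> \<epsilon> \<le> (2 * rosenthal_const 2) powr (u / 2) * s powr (u / 2) * real p powr (- u / 2) * \<epsilon> powr (- u)"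
proof -
  let ?P = "prob_Bc M p w \<mu> \<epsilon>"
  have P: "0 \<le> ?P" "?P \<le> 1" by (simp_all add: prob_Bc_eq)
  have "?P \<le> prob {x \<in> space M. \<epsilon>\<^sup>2 \<le> (t x)\<^sup>2}"
    unfolding prob_Bc_eq
  proof (rule finite_measure_mono)
    show "{x \<in> space M. \<epsilon> < \<bar>t x\<bar>} \<subseteq> {x \<in> space M. \<epsilon>\<^sup>2 \<le> (t x)\<^sup>2}"
    proof safe
      fix x assume "\<epsilon> < \<bar>t x\<bar>"
      then have "\<epsilon>\<^sup>2 \<le> \<bar>t x\<bar>\<^sup>2" using \<epsilon> by (intro power_mono) auto
      then show "\<epsilon>\<^sup>2 \<le> (t x)\<^sup>2" by simp
    qed
  qed measurable
  also have "\<dots> \<le> expectation (\<lambda>x. (t x)\<^sup>2) / \<epsilon>\<^sup>2"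
    using t_square(1) \<epsilon> by (intro integral_Markov_inequality_measure[where A = "{}"]) auto
  also have "\<dots> \<le> 2 * rosenthal_const 2 * s / real p / \<epsilon>\<^sup>2"
    using t_square(2) by (intro divide_right_mono) auto
  finally have le: "?P \<le> 2 * rosenthal_const 2 * s / real p / \<epsilon>\<^sup>2" .
  have "?P \<le> ?P powr (u / 2)"
    using powr_mono'[of "u / 2" 1 ?P] P u by simp
  also have "\<dots> \<le> (2 * rosenthal_const 2 * s / real p / \<epsilon>\<^sup>2) powr (u / 2)"
    using P u le by (intro powr_mono2) auto
  also have "\<dots> = (2 * rosenthal_const 2) powr (u / 2) * s powr (u / 2) * real p powr (- u / 2) * \<epsilon> powr (- u)"
    using \<epsilon> abs_powr_eq_square_powr[of \<epsilon> u] by (simp add: powr_mult powr_divide powr_minus_divide)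
  finally show ?thesis .
qed

end

section \<open>Identically distributed samples and uniform constants\<close>

lemma iid_positive_sample:
  assumes iid: "iid_positive M p w" and p: "1 \<le> p" and mu: "0 < \<mu>" and q: "2 \<le> q"
    and mean_int: "integrable M (w 0)" and mean: "(\<integral>x. w 0 x \<partial>M) = \<mu>"
    and var: "(\<integral>x. (w 0 x - \<mu>)\<^sup>2 \<partial>M) = s"
    and fourth: "(\<integral>x. \<bar>w 0 x - \<mu>\<bar> ^ 4 \<partial>M) \<le> C"
    and int: "integrable M (\<lambda>x. \<bar>w 0 x - \<mu>\<bar> powr (2 * q))"
    and moment: "(\<integral>x. \<bar>w 0 x - \<mu>\<bar> powr (2 * q) \<partial>M) \<le> m"
  shows "positive_sample M p w \<mu> q s C m"
proof -
  interpret prob_space M using iid by (simp add: iid_positive_def)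
  have indep: "indep_vars (\<lambda>_. borel) w {..<p}"
    and same: "\<And>j. j < p \<Longrightarrow> distr M borel (w j) = distr M borel (w 0)"
    and pos: "\<And>j. j < p \<Longrightarrow> AE x in M. 0 < w j x"
    using iid unfolding iid_positive_def by blast+
  have meas: "w j \<in> borel_measurable M" if "j < p" for j
    using indep that by (auto simp: indep_vars_def)
  have w0: "w 0 \<in> borel_measurable M" using meas p by simp
  have transfer: "expectation (\<lambda>x. f (w j x)) = expectation (\<lambda>x. f (w 0 x))"
    "integrable M (\<lambda>x. f (w j x)) \<longleftrightarrow> integrable M (\<lambda>x. f (w 0 x))"
    if j: "j < p" and f: "f \<in> borel_measurable borel" for j and f :: "real \<Rightarrow> real"
    using integral_distr[OF meas[OF j] f] integral_distr[OF w0 f]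
      integrable_distr_eq[OF meas[OF j] f] integrable_distr_eq[OF w0 f] same[OF j] by auto
  show ?thesis
  proof
    show "2 \<le> q" "0 < p" "0 < \<mu>" using q p mu by auto
    show "indep_vars (\<lambda>_. borel) (\<lambda>j x. w j x - \<mu>) {..<p}"
      using indep by (rule indep_vars_compose2) auto
    fix j assume j: "j < p"
    show "integrable M (\<lambda>x. \<bar>w j x - \<mu>\<bar> powr (2 * q))"
      using transfer(2)[OF j, of "\<lambda>z. \<bar>z - \<mu>\<bar> powr (2 * q)"] int by simp
    show "expectation (\<lambda>x. w j x - \<mu>) = 0"
      using transfer(1)[OF j, of "\<lambda>z. z - \<mu>"] mean mean_int by (simp add: prob_space)
    show "expectation (\<lambda>x. (w j x - \<mu>)\<^sup>2) = s"
      using transfer(1)[OF j, of "\<lambda>z. (z - \<mu>)\<^sup>2"] var by simp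
    show "expectation (\<lambda>x. (w j x - \<mu>) ^ 4) \<le> C"
      using transfer(1)[OF j, of "\<lambda>z. (z - \<mu>) ^ 4"] fourth by simp
    show "expectation (\<lambda>x. \<bar>w j x - \<mu>\<bar> powr (2 * q)) \<le> m"
      using transfer(1)[OF j, of "\<lambda>z. \<bar>z - \<mu>\<bar> powr (2 * q)"] moment by simp
    show "AE x in M. 0 < w j x" by (rule pos[OF j])
  qed
qed

lemma (in prob_space) integrable_centred_powr:
  fixes X :: "'a \<Rightarrow> real"
  assumes [measurable]: "X \<in> borel_measurable M" and fin: "abs_moment M X u < \<infinity>" and u: "0 \<le> u"
  shows "integrable M (\<lambda>x. \<bar>X x - \<mu>\<bar> powr u)"
proof -
  have i: "integrable M (\<lambda>x. \<bar>X x\<bar> powr u)"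
    using fin by (intro integrableI_bounded) (auto simp: abs_moment_def)
  show ?thesis
    by (rule Bochner_Integration.integrable_bound[of _ "\<lambda>x. 2 powr u * (\<bar>X x\<bar> powr u + \<bar>\<mu>\<bar> powr u)"])
       (use i abs_add_powr_le[OF u, of "X _" "- \<mu>"] in auto)
qed

text \<open>Limits control only large n, whereas the constants must serve every n from 1 on; the
  finitely many exceptions are absorbed by a minimum of positive numbers.\<close>

lemma eventually_bounded_below_imp_bounded_below:
  fixes X :: "nat \<Rightarrow> real"
  assumes ev: "\<forall>\<^sub>F n in sequentially. b \<le> X n" and b: "0 < b" and pos: "\<And>n. 1 \<le> n \<Longrightarrow> 0 < X n"
  obtains b' where "0 < b'" "\<And>n. 1 \<le> n \<Longrightarrow> b' \<le> X n"
proof -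
  obtain N where N: "\<And>n. N \<le> n \<Longrightarrow> b \<le> X n" using ev by (auto simp: eventually_sequentially)
  define b' where "b' = Min (insert b (X ` {1..N}))"
  have "0 < b'" unfolding b'_def using b pos by (subst Min_gr_iff) auto
  moreover have "b' \<le> X n" if "1 \<le> n" for n
  proof (cases "n \<le> N")
    case True
    then show ?thesis unfolding b'_def using that by (intro Min_le) auto
  next
    case False
    have "b' \<le> b" unfolding b'_def by (intro Min_le) auto
    then show ?thesis using N[of n] False by linarith
  qed
  ultimately show ?thesis using that by blast
qed

definition frobenius_const :: "real \<Rightarrow> real \<Rightarrow> real \<Rightarrow> real \<Rightarrow> real \<Rightarrow> real" where
  "frobenius_const q \<mu> s C m = 2 powr q * (2 * (core_const q \<mu> s C *
     ((quad_const q s C * (2 + rosenthal_const q * (s powr (q / 2) + 1)) + 2) * (1 + m))))"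

text \<open>In contrast to \<open>frobenius_const\<close> this is free of m, which depends on n
  under truncation.\<close>

definition operator_const :: "real \<Rightarrow> real \<Rightarrow> real \<Rightarrow> real \<Rightarrow> real \<Rightarrow> real" where
  "operator_const q \<mu> s C L = 2 powr q * (2 * (core_const q \<mu> s C *
     ((quad_const q s C * (2 + norm_const q s C) + 1) * L powr q)))"

context positive_sample
begin

lemma frobenius_const_nonneg: "0 \<le> frobenius_const q \<mu> s C m"
  unfolding frobenius_const_def using const_nonneg quad_const_nonneg[of q s C] rosenthal_const_nonneg[of q] m_nonneg
  by (intro mult_nonneg_nonneg add_nonneg_nonneg) auto

lemma quad_dev_zero:
  assumes A: "A \<in> carrier_mat p p" and n: "1 \<le> n" and z: "(\<Sum>i<p. \<Sum>j<p. (cmod (A $$ (i, j)))\<^sup>2) = 0"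
  shows "quad_dev M n p w A x = 0"
proof -
  have "A $$ (i, j) = 0" if "i < p" "j < p" for i j
    using z that by (simp add: sum_nonneg_eq_0_iff sum_nonneg)
  then have "ratio_form (\<lambda>i j. Re (A $$ (i, j))) x = 0" "ratio_form (\<lambda>i j. Im (A $$ (i, j))) x = 0"
    by simp_all
  then show ?thesis unfolding quad_dev_eq[OF A n] by (simp add: complex_eq_iff)
qed

lemma quad_dev_frobenius:
  assumes A: "A \<in> carrier_mat p p" and n: "1 \<le> n"
  shows "(\<integral>\<^sup>+x. ennreal (cmod (quad_dev M n p w A x) powr q) \<partial>M)
    \<le> ennreal (real n powr (- q) * (frobenius_const q \<mu> s C m * Re (mtrace (A * mat_adjoint A)) powr (q / 2)))"
proof -
  define G where "G = (\<Sum>i<p. \<Sum>j<p. (cmod (A $$ (i, j)))\<^sup>2)"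
  have tr: "Re (mtrace (A * mat_adjoint A)) = G" unfolding G_def mtrace_mult_adjoint[OF A] by simp
  have G0: "0 \<le> G" unfolding G_def by (intro sum_nonneg) auto
  show ?thesis
  proof (cases "G = 0")
    case True
    then have "quad_dev M n p w A x = 0" for x using quad_dev_zero[OF A n] by (simp add: G_def)
    then show ?thesis by simp
  next
    case False
    then have G: "0 < G" using G0 by simp
    let ?k = "core_const q \<mu> s C *
      ((quad_const q s C * (2 + rosenthal_const q * (s powr (q / 2) + 1)) + 2) * (1 + m) * G powr (q / 2))"
    have k: "0 \<le> ?k"
      using const_nonneg quad_const_nonneg[of q s C] rosenthal_const_nonneg[of q] m_nonneg by (intro mult_nonneg_nonneg add_nonneg_nonneg) auto
    have "(\<Sum>i<p. \<Sum>j<p. (Re (A $$ (i, j)))\<^sup>2) \<le> G" "(\<Sum>i<p. \<Sum>j<p. (Im (A $$ (i, j)))\<^sup>2) \<le> G"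
      unfolding G_def by (intro sum_mono; simp add: cmod_power2)+
    then have "(\<integral>\<^sup>+x. ennreal (cmod (quad_dev M n p w A x) powr q) \<partial>M)
        \<le> ennreal (real n powr (- q) * 2 powr q * (2 * ?k))"
      by (intro quad_dev_moment_le A n k ratio_form_frobenius G)
    then show ?thesis unfolding tr frobenius_const_def by (simp add: mult_ac)
  qed
qed

lemma quad_dev_operator:
  assumes A: "A \<in> carrier_mat p p" and n: "1 \<le> n" and L: "spectral_norm A \<le> L" "0 < L"
  shows "(\<integral>\<^sup>+x. ennreal (cmod (quad_dev M n p w A x) powr q) \<partial>M)
    \<le> ennreal (operator_const q \<mu> s C L * (1 + real p powr (1 - q) * m)
        * (real n powr (- q) * (real p powr (q / 2) + (1 + m) * real p)))"
proof -
  let ?k = "core_const q \<mu> s C * ((quad_const q s C * (2 + norm_const q s C) + 1)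
        * \<theta> * L powr q * (real p powr (q / 2) + (1 + m) * real p))"
  have k: "0 \<le> ?k"
    using const_nonneg quad_const_nonneg[of q s C] m_nonneg \<theta>_ge_1 by (intro mult_nonneg_nonneg add_nonneg_nonneg) auto
  have "(\<integral>\<^sup>+x. ennreal (cmod (quad_dev M n p w A x) powr q) \<partial>M)
        \<le> ennreal (real n powr (- q) * 2 powr q * (2 * ?k))"
    by (intro quad_dev_moment_le A n k ratio_form_operator L op_bounded_Re_Im p)
  then show ?thesis unfolding operator_const_def \<theta>_def[symmetric] by (simp add: mult_ac)
qed

end

text \<open>The truncated moment makes m equal to C \<delta>^(2q-4) N^(q-2), so N^(-q) P m has
  exactly the target order N^(-1) \<delta>^(2q-4). The other terms are at most of order N^(-q/2),
  and the lower bound on \<delta> N^(1/4) places this below the target.\<close>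

lemma truncated_rate_bounds:
  fixes N P q c0 c1 c2 d \<delta> C :: real
  assumes q: "2 \<le> q" and N: "1 \<le> N" and c1: "0 < c1" "c1 * N \<le> P" and c2: "P \<le> c2 * N"
    and c0: "0 < c0" "c0 \<le> \<delta> * N powr (1/4)" and \<delta>: "0 < \<delta>" "\<delta> \<le> d" and C: "0 \<le> C"
  defines "m \<equiv> (\<delta> * sqrt N) powr (2 * q - 4) * C" and "b \<equiv> c0 powr (- (2 * q - 4))"
  shows "1 + P powr (1 - q) * m \<le> 1 + c1 powr (1 - q) * C * d powr (2 * q - 4)"
    and "N powr (- q) * (P powr (q / 2) + (1 + m) * P)
      \<le> (c2 powr (q / 2) * b + c2 * (b + C)) * (N powr (- 1) * \<delta> powr (2 * q - 4))"
proof -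
  let ?D = "\<delta> powr (2 * q - 4)"
  have N0: "0 < N" using N by simp
  have "0 < c1 * N" using c1 N0 by simp
  then have P0: "0 < P" using c1(2) by linarith
  then have "0 < c2 * N" using c2 by linarith
  then have c20: "0 < c2" using N0 by (simp add: zero_less_mult_iff)
  have m: "m = C * ?D * N powr (q - 2)"
  proof -
    have "sqrt N powr (2 * q - 4) = N powr (1/2 * (2 * q - 4))"
      using N0 by (simp add: powr_powr flip: powr_half_sqrt)
    then show ?thesis by (simp add: m_def powr_mult mult_ac right_diff_distrib)
  qed
  \<comment> \<open>The exponent 1 - q is negative, so the lower bound on P is the relevant
    one.\<close>
  have "P powr (1 - q) * m \<le> (c1 * N) powr (1 - q) * m"
    using c1 q N0 C by (intro mult_right_mono powr_mono2') (auto simp: m)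
  also have "\<dots> = c1 powr (1 - q) * C * (?D * N powr (- 1))"
  proof -
    have "N powr (1 - q) * N powr (q - 2) = N powr (- 1)" using N0 by (simp add: powr_add[symmetric])
    from this[symmetric] show ?thesis unfolding m powr_mult by (simp only: mult_ac)
  qed
  also have "\<dots> \<le> c1 powr (1 - q) * C * (d powr (2 * q - 4) * 1)"
  proof (intro mult_left_mono mult_mono)
    show "?D \<le> d powr (2 * q - 4)" using \<delta> q by (intro powr_mono2) auto
    show "N powr (- 1) \<le> 1" using N by (simp add: powr_minus_divide)
  qed (use C in auto)
  finally show "1 + P powr (1 - q) * m \<le> 1 + c1 powr (1 - q) * C * d powr (2 * q - 4)" by simp
  \<comment> \<open>Raising c0 \<le> \<delta> N^(1/4) to the power 2q - 4 gives \<delta>^(2q-4)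
    N^(q/2-1), which turns N^(-q/2) into N^(-1) \<delta>^(2q-4).\<close>
  have half: "N powr (- q / 2) \<le> b * (N powr (- 1) * ?D)"
  proof -
    have "c0 powr (2 * q - 4) \<le> (\<delta> * N powr (1/4)) powr (2 * q - 4)"
      using c0 q by (intro powr_mono2) auto
    also have "\<dots> = ?D * N powr (q / 2 - 1)"
      using N0 by (simp add: powr_mult powr_powr diff_divide_distrib)
    finally have "b * c0 powr (2 * q - 4) * N powr (- q / 2) \<le> b * (?D * N powr (q / 2 - 1)) * N powr (- q / 2)"
      by (intro mult_right_mono mult_left_mono) (auto simp: b_def)
    moreover have "b * c0 powr (2 * q - 4) = 1" using c0 by (simp add: b_def powr_add[symmetric])
    moreover have "b * (?D * N powr (q / 2 - 1)) * N powr (- q / 2) = b * (N powr (- 1) * ?D)"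
    proof -
      have "N powr (q / 2 - 1) * N powr (- q / 2) = N powr (- 1)"
        using N0 by (simp add: powr_add[symmetric])
      from this[symmetric] show ?thesis by (simp only: mult_ac)
    qed
    ultimately show ?thesis by simp
  qed
  have 1: "N powr (- q) * P powr (q / 2) \<le> c2 powr (q / 2) * (b * (N powr (- 1) * ?D))"
  proof -
    have "N powr (- q) * P powr (q / 2) \<le> N powr (- q) * (c2 * N) powr (q / 2)"
      using c2 P0 q by (intro mult_left_mono powr_mono2) auto
    also have "\<dots> = c2 powr (q / 2) * N powr (- q / 2)"
    proof -
      have "N powr (- q) * N powr (q / 2) = N powr (- q / 2)" using N0 by (simp add: powr_add[symmetric])
      then show ?thesis by (simp add: powr_mult mult_ac)
    qed
    also have "\<dots> \<le> c2 powr (q / 2) * (b * (N powr (- 1) * ?D))" using half by (intro mult_left_mono) auto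
    finally show ?thesis .
  qed
  have NP: "N powr (- q) * P \<le> c2 * N powr (1 - q)"
  proof -
    have "N powr (- q) * P \<le> N powr (- q) * (c2 * N)" using c2 by (intro mult_left_mono) auto
    also have "\<dots> = c2 * N powr (1 - q)" using N0 by (simp add: powr_diff powr_minus_divide)
    finally show ?thesis .
  qed
  have 2: "N powr (- q) * P \<le> c2 * (b * (N powr (- 1) * ?D))"
  proof -
    have "N powr (1 - q) \<le> N powr (- q / 2)" using N q by (intro powr_mono) auto
    then have "c2 * N powr (1 - q) \<le> c2 * (b * (N powr (- 1) * ?D))"
      using half c20 by (intro mult_left_mono) auto
    then show ?thesis using NP by linarith
  qed
  have 3: "N powr (- q) * P * m \<le> c2 * C * (N powr (- 1) * ?D)"
  proof -
    have "N powr (- q) * P * m \<le> c2 * N powr (1 - q) * m"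
      using NP C by (intro mult_right_mono) (auto simp: m)
    also have "\<dots> = c2 * C * (N powr (- 1) * ?D)"
    proof -
      have "N powr (1 - q) * N powr (q - 2) = N powr (- 1)" using N0 by (simp add: powr_add[symmetric])
      from this[symmetric] show ?thesis unfolding m by (simp only: mult_ac)
    qed
    finally show ?thesis .
  qed
  have "N powr (- q) * (P powr (q / 2) + (1 + m) * P)
      = N powr (- q) * P powr (q / 2) + N powr (- q) * P + N powr (- q) * P * m"
    by (simp add: algebra_simps)
  also have "\<dots> \<le> c2 powr (q / 2) * (b * (N powr (- 1) * ?D)) + c2 * (b * (N powr (- 1) * ?D))
      + c2 * C * (N powr (- 1) * ?D)"
    by (intro add_mono 1 2 3)
  also have "\<dots> = (c2 powr (q / 2) * b + c2 * (b + C)) * (N powr (- 1) * ?D)"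
    using distrib_right[of "c2 powr (q / 2) * b" "c2 * (b + C)" "N powr (- 1) * ?D"]
    by (simp only: distrib_left distrib_right mult.assoc add.assoc)
  finally show "N powr (- q) * (P powr (q / 2) + (1 + m) * P)
      \<le> (c2 powr (q / 2) * b + c2 * (b + C)) * (N powr (- 1) * ?D)" .
qed

text \<open>All but four of the factors |Y| are replaced by the truncation level R.\<close>

lemma (in prob_space) truncated_moment:
  fixes Y :: "'a \<Rightarrow> real"
  assumes [measurable]: "Y \<in> borel_measurable M" and bnd: "AE x in M. \<bar>Y x\<bar> < R" and u: "4 \<le> u"
    and i4: "integrable M (\<lambda>x. \<bar>Y x\<bar> ^ 4)" and C: "expectation (\<lambda>x. \<bar>Y x\<bar> ^ 4) \<le> C"
  shows "integrable M (\<lambda>x. \<bar>Y x\<bar> powr u)" "expectation (\<lambda>x. \<bar>Y x\<bar> powr u) \<le> R powr (u - 4) * C"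
proof -
  have le: "AE x in M. \<bar>Y x\<bar> powr u \<le> R powr (u - 4) * \<bar>Y x\<bar> ^ 4"
    using bnd
  proof eventually_elim
    case (elim x)
    have "\<bar>Y x\<bar> powr u = \<bar>Y x\<bar> powr (u - 4) * \<bar>Y x\<bar> ^ 4"
      using u by (cases "Y x = 0") (auto simp: powr_diff)
    also have "\<dots> \<le> R powr (u - 4) * \<bar>Y x\<bar> ^ 4"
      using elim u by (intro mult_right_mono powr_mono2) auto
    finally show ?case .
  qed
  show i: "integrable M (\<lambda>x. \<bar>Y x\<bar> powr u)"
  proof (rule Bochner_Integration.integrable_bound)
    show "integrable M (\<lambda>x. R powr (u - 4) * \<bar>Y x\<bar> ^ 4)" using i4 by simp
    show "AE x in M. norm (\<bar>Y x\<bar> powr u) \<le> norm (R powr (u - 4) * \<bar>Y x\<bar> ^ 4)"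
      using le by eventually_elim simp
  qed measurable
  have "expectation (\<lambda>x. \<bar>Y x\<bar> powr u) \<le> expectation (\<lambda>x. R powr (u - 4) * \<bar>Y x\<bar> ^ 4)"
    using i i4 le by (intro integral_mono_AE) auto
  also have "\<dots> = R powr (u - 4) * expectation (\<lambda>x. \<bar>Y x\<bar> ^ 4)" by simp
  also have "\<dots> \<le> R powr (u - 4) * C" using C by (intro mult_left_mono) auto
  finally show "expectation (\<lambda>x. \<bar>Y x\<bar> powr u) \<le> R powr (u - 4) * C" .
qed

section \<open>The three estimates\<close>

lemma iid_positive_measurable:
  "iid_positive M p w \<Longrightarrow> 1 \<le> p \<Longrightarrow> w 0 \<in> borel_measurable M"
  by (auto simp: iid_positive_def prob_space.indep_vars_def)

locale sample_array =
  fixes M :: "nat \<Rightarrow> 'a measure" and w :: "nat \<Rightarrow> nat \<Rightarrow> 'a \<Rightarrow> real" and p :: "nat \<Rightarrow> nat" and \<mu> \<sigma> :: real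
  assumes p_pos: "1 \<le> n \<Longrightarrow> 1 \<le> p n" and mu_pos: "0 < \<mu>"
    and iid: "1 \<le> n \<Longrightarrow> iid_positive (M n) (p n) (w n)"
    and mean_int: "1 \<le> n \<Longrightarrow> integrable (M n) (w n 0)"
    and mean: "1 \<le> n \<Longrightarrow> (\<integral>x. w n 0 x \<partial>M n) = \<mu>"
    and variance: "1 \<le> n \<Longrightarrow> (\<integral>x. (w n 0 x - \<mu>)\<^sup>2 \<partial>M n) = \<sigma>\<^sup>2"
    and fourth: "1 \<le> n \<Longrightarrow> integrable (M n) (\<lambda>x. \<bar>w n 0 x - \<mu>\<bar> ^ 4)"

text \<open>With a common law D all moments become integrals over D, so constants built from them
  are visibly independent of n.\<close>

locale fixed_law_array = sample_array M w p \<mu> \<sigma>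
  for M :: "nat \<Rightarrow> 'a measure" and w p \<mu> \<sigma> +
  fixes D :: "real measure"
  assumes law: "1 \<le> n \<Longrightarrow> distr (M n) borel (w n 0) = D"
begin

lemma w0_measurable: "1 \<le> n \<Longrightarrow> w n 0 \<in> borel_measurable (M n)"
  by (rule iid_positive_measurable[OF iid p_pos])

lemma transfer:
  fixes f :: "real \<Rightarrow> real"
  assumes "1 \<le> n" "f \<in> borel_measurable borel"
  shows "(\<integral>x. f (w n 0 x) \<partial>M n) = (\<integral>z. f z \<partial>D)"
  using integral_distr[OF w0_measurable[OF assms(1)] assms(2)] law[OF assms(1)] by simp

lemma abs_moment_eq: "1 \<le> n \<Longrightarrow> abs_moment (M n) (w n 0) u = (\<integral>\<^sup>+z. ennreal (\<bar>z\<bar> powr u) \<partial>D)"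
  unfolding abs_moment_def using w0_measurable by (simp add: nn_integral_distr flip: law)

lemma sample:
  assumes n: "1 \<le> n" and u: "2 \<le> u" and i: "integrable (M n) (\<lambda>x. \<bar>w n 0 x - \<mu>\<bar> powr (2 * u))"
  shows "positive_sample (M n) (p n) (w n) \<mu> u (\<sigma>\<^sup>2)
    (\<integral>z. \<bar>z - \<mu>\<bar> ^ 4 \<partial>D) (\<integral>z. \<bar>z - \<mu>\<bar> powr (2 * u) \<partial>D)"
  using transfer[OF n, of "\<lambda>z. \<bar>z - \<mu>\<bar> ^ 4"] transfer[OF n, of "\<lambda>z. \<bar>z - \<mu>\<bar> powr (2 * u)"]
  by (intro iid_positive_sample iid p_pos n mu_pos u mean_int mean variance i) auto

text \<open>If the moment of order 2q is infinite, so is the right-hand side for nonzero A.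
  Otherwise it is a number determined by the law, and the Frobenius bound with that number inside
  the constant gives the first term.\<close>

lemma fixed_law_quad_dev:
  assumes q: "2 \<le> q"
  shows "\<exists>K>0. \<forall>n\<ge>1. \<forall>A \<in> carrier_mat (p n) (p n).
    (\<integral>\<^sup>+x. ennreal (cmod (quad_dev (M n) n (p n) (w n) A x) powr q) \<partial>M n)
    \<le> ennreal K * (ennreal (real n powr (- q)) *
         (ennreal (((\<integral>x. \<bar>w n 0 x\<bar> ^ 4 \<partial>M n) * Re (mtrace (A * mat_adjoint A))) powr (q/2))
          + abs_moment (M n) (w n 0) (2*q) * ennreal (Re (mtrace (psd_power (A * mat_adjoint A) (q/2))))))"
proof -
  show ?thesis
  proof (cases "(\<integral>\<^sup>+z. ennreal (\<bar>z\<bar> powr (2 * q)) \<partial>D) = \<infinity>")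
    case True
    show ?thesis
    proof (intro exI[of _ 1] conjI allI impI ballI)
      fix n :: nat and A :: "complex mat" assume n: "1 \<le> n" and A: "A \<in> carrier_mat (p n) (p n)"
      \<comment> \<open>Only the fourth moment is known to be finite here, so the locale is entered
        with q = 2; this suffices for \<open>quad_dev_zero\<close>.\<close>
      interpret positive_sample "M n" "p n" "w n" \<mu> 2 "\<sigma>\<^sup>2" "\<integral>z. \<bar>z - \<mu>\<bar> ^ 4 \<partial>D" "\<integral>z. \<bar>z - \<mu>\<bar> powr (2 * 2) \<partial>D"
        by (rule sample[OF n order_refl]) (use fourth[OF n] in simp)
      let ?S = "\<Sum>i<p n. \<Sum>j<p n. (cmod (A $$ (i, j)))\<^sup>2"
      have S0: "0 \<le> ?S" by (intro sum_nonneg) auto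
      show "(\<integral>\<^sup>+x. ennreal (cmod (quad_dev (M n) n (p n) (w n) A x) powr q) \<partial>M n)
        \<le> ennreal 1 * (ennreal (real n powr (- q)) *
         (ennreal (((\<integral>x. \<bar>w n 0 x\<bar> ^ 4 \<partial>M n) * Re (mtrace (A * mat_adjoint A))) powr (q/2))
          + abs_moment (M n) (w n 0) (2*q) * ennreal (Re (mtrace (psd_power (A * mat_adjoint A) (q/2))))))"
      proof (cases "?S = 0")
        case True
        then show ?thesis using quad_dev_zero[OF A n] by simp
      next
        case False
        then have "0 < Re (mtrace (psd_power (A * mat_adjoint A) (q/2)))"
          using S0 by (intro mtrace_psd_power_pos[OF A]) auto
        then have "abs_moment (M n) (w n 0) (2*q) * ennreal (Re (mtrace (psd_power (A * mat_adjoint A) (q/2)))) = \<infinity>"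
          unfolding abs_moment_eq[OF n] True by (simp add: ennreal_top_mult)
        then show ?thesis using n by (simp add: ennreal_mult_top)
      qed
    qed simp
  next
    case False
    define C where "C = (\<integral>z. \<bar>z - \<mu>\<bar> ^ 4 \<partial>D)"
    define m where "m = (\<integral>z. \<bar>z - \<mu>\<bar> powr (2 * q) \<partial>D)"
    define e where "e = (\<integral>z. \<bar>z\<bar> ^ 4 \<partial>D)"
    have fin: "integrable (M n) (\<lambda>x. \<bar>w n 0 x - \<mu>\<bar> powr (2 * q))" if n: "1 \<le> n" for n
    proof -
      interpret prob_space "M n" using iid[OF n] by (simp add: iid_positive_def)
      show ?thesis using False q
        by (intro integrable_centred_powr w0_measurable n) (auto simp: abs_moment_eq[OF n] less_top)
    qed
    have S: "positive_sample (M n) (p n) (w n) \<mu> q (\<sigma>\<^sup>2) C m" if n: "1 \<le> n" for n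
      unfolding C_def m_def by (rule sample[OF n q fin[OF n]])
    let ?k = "frobenius_const q \<mu> (\<sigma>\<^sup>2) C m"
    have k: "0 \<le> ?k" by (rule positive_sample.frobenius_const_nonneg[OF S[OF order_refl]])
    \<comment> \<open>A vanishing fourth moment would force w = 0 almost surely, against the
      positive mean. Positivity allows the power of the trace to be exchanged for that of e times
      the trace.\<close>
    have e: "0 < e"
    proof -
      obtain n :: nat where n: "1 \<le> n" by blast
      interpret prob_space "M n" using iid[OF n] by (simp add: iid_positive_def)
      note [measurable] = w0_measurable[OF n]
      have e_eq: "e = expectation (\<lambda>x. \<bar>w n 0 x\<bar> ^ 4)"
        using transfer[OF n, of "\<lambda>z. \<bar>z\<bar> ^ 4"] by (simp add: e_def)
      have i: "integrable (M n) (\<lambda>x. \<bar>w n 0 x\<bar> ^ 4)"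
      proof -
        have "integrable (M n) (\<lambda>x. \<bar>(w n 0 x - \<mu>) + \<mu>\<bar> powr 4)"
          by (rule Bochner_Integration.integrable_bound[of _ "\<lambda>x. 2 powr 4 * (\<bar>w n 0 x - \<mu>\<bar> powr 4 + \<bar>\<mu>\<bar> powr 4)"])
             (use abs_add_powr_le[of 4 "w n 0 _ - \<mu>" \<mu>] fourth[OF n] in auto)
        then show ?thesis by simp
      qed
      have "e \<noteq> 0"
      proof
        assume "e = 0"
        then have "AE x in M n. \<bar>w n 0 x\<bar> ^ 4 = 0"
          unfolding e_eq using integral_nonneg_eq_0_iff_AE[OF i] by simp
        then have "AE x in M n. w n 0 x = 0" by eventually_elim simp
        then have "(\<integral>x. w n 0 x \<partial>M n) = (\<integral>x. 0 \<partial>M n)" by (intro integral_cong_AE) auto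
        then show False using mean[OF n] mu_pos by simp
      qed
      moreover have "0 \<le> e" unfolding e_eq by simp
      ultimately show ?thesis by simp
    qed
    define K where "K = ?k / e powr (q / 2) + 1"
    have K: "0 < K" unfolding K_def using k e by (intro add_nonneg_pos) auto
    show ?thesis
    proof (intro exI[of _ K] conjI allI impI ballI K)
      fix n :: nat and A :: "complex mat" assume n: "1 \<le> n" and A: "A \<in> carrier_mat (p n) (p n)"
      interpret positive_sample "M n" "p n" "w n" \<mu> q "\<sigma>\<^sup>2" C m by (rule S[OF n])
      let ?G = "Re (mtrace (A * mat_adjoint A))"
      have e_eq: "(\<integral>x. \<bar>w n 0 x\<bar> ^ 4 \<partial>M n) = e"
        using transfer[OF n, of "\<lambda>z. \<bar>z\<bar> ^ 4"] by (simp add: e_def)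
      have "?k * ?G powr (q / 2) \<le> K * (e * ?G) powr (q / 2)"
      proof -
        have "?k * ?G powr (q / 2) = ?k / e powr (q / 2) * (e * ?G) powr (q / 2)"
          using e by (simp add: powr_mult)
        also have "\<dots> \<le> K * (e * ?G) powr (q / 2)" by (intro mult_right_mono) (auto simp: K_def)
        finally show ?thesis .
      qed
      then have "real n powr (- q) * (?k * ?G powr (q / 2)) \<le> real n powr (- q) * (K * (e * ?G) powr (q / 2))"
        by (intro mult_left_mono) auto
      then have "(\<integral>\<^sup>+x. ennreal (cmod (quad_dev (M n) n (p n) (w n) A x) powr q) \<partial>M n)
          \<le> ennreal (real n powr (- q) * (K * (e * ?G) powr (q / 2)))"
        using order_trans[OF quad_dev_frobenius[OF A n]] ennreal_leI by blast
      also have "\<dots> = ennreal K * (ennreal (real n powr (- q)) * ennreal ((e * ?G) powr (q / 2)))"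
        using K by (simp add: ennreal_mult[symmetric] mult_ac)
      also have "\<dots> \<le> ennreal K * (ennreal (real n powr (- q)) * (ennreal ((e * ?G) powr (q / 2))
          + abs_moment (M n) (w n 0) (2*q) * ennreal (Re (mtrace (psd_power (A * mat_adjoint A) (q/2))))))"
        by (intro mult_left_mono) auto
      finally show "(\<integral>\<^sup>+x. ennreal (cmod (quad_dev (M n) n (p n) (w n) A x) powr q) \<partial>M n)
        \<le> ennreal K * (ennreal (real n powr (- q)) *
         (ennreal (((\<integral>x. \<bar>w n 0 x\<bar> ^ 4 \<partial>M n) * ?G) powr (q/2))
          + abs_moment (M n) (w n 0) (2*q) * ennreal (Re (mtrace (psd_power (A * mat_adjoint A) (q/2))))))"
        unfolding e_eq .
    qed
  qed
qed

text \<open>Chebyshev's inequality serves u < 2, and an infinite moment of order u makes the claim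
  trivial. In the remaining case Markov's and Rosenthal's inequalities give p^(-u/2) with a constant
  determined by the law.\<close>

lemma fixed_law_tail:
  assumes sigma_pos: "0 < \<sigma>" and u: "0 < u"
  shows "\<exists>K>0. \<forall>\<epsilon>>0. \<forall>n\<ge>1. ennreal (prob_Bc (M n) (p n) (w n) \<mu> \<epsilon>)
    \<le> ennreal (K * \<epsilon> powr (- u)) * (ennreal (\<sigma> powr u * real (p n) powr (- u / 2))
         + ennreal (real (p n) powr (- u + 1)) * abs_moment (M n) (w n 0) u)"
proof -
  have \<sigma>u: "(\<sigma>\<^sup>2) powr (u / 2) = \<sigma> powr u"
    using abs_powr_eq_square_powr[of \<sigma> u] sigma_pos by simp
  have reduce: ?thesis
    if K: "0 < K" and le: "\<And>\<epsilon> n. 0 < \<epsilon> \<Longrightarrow> 1 \<le> n \<Longrightarrow>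
      prob_Bc (M n) (p n) (w n) \<mu> \<epsilon> \<le> K * \<epsilon> powr (- u) * (\<sigma> powr u * real (p n) powr (- u / 2))" for K
  proof (intro exI[of _ K] conjI allI impI K)
    fix \<epsilon> :: real and n :: nat assume \<epsilon>: "0 < \<epsilon>" and n: "1 \<le> n"
    have "ennreal (prob_Bc (M n) (p n) (w n) \<mu> \<epsilon>) \<le> ennreal (K * \<epsilon> powr (- u) * (\<sigma> powr u * real (p n) powr (- u / 2)))"
      using le[OF \<epsilon> n] by (rule ennreal_leI)
    also have "\<dots> = ennreal (K * \<epsilon> powr (- u)) * ennreal (\<sigma> powr u * real (p n) powr (- u / 2))"
      using K by (intro ennreal_mult) auto
    also have "\<dots> \<le> ennreal (K * \<epsilon> powr (- u)) * (ennreal (\<sigma> powr u * real (p n) powr (- u / 2))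
         + ennreal (real (p n) powr (- u + 1)) * abs_moment (M n) (w n 0) u)"
      by (intro mult_left_mono) auto
    finally show "ennreal (prob_Bc (M n) (p n) (w n) \<mu> \<epsilon>) \<le> \<dots>" .
  qed
  consider "u < 2" | "2 \<le> u" "(\<integral>\<^sup>+z. ennreal (\<bar>z\<bar> powr u) \<partial>D) = \<infinity>"
    | "2 \<le> u" "(\<integral>\<^sup>+z. ennreal (\<bar>z\<bar> powr u) \<partial>D) < \<infinity>"
    by (metis infinity_ennreal_def less_top not_le)
  then show ?thesis
  proof cases
    case 1
    let ?K = "(2 * rosenthal_const 2) powr (u / 2) + 1"
    show ?thesis
    proof (rule reduce[of ?K])
      fix \<epsilon> :: real and n :: nat assume \<epsilon>: "0 < \<epsilon>" and n: "1 \<le> n"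
      interpret positive_sample "M n" "p n" "w n" \<mu> 2 "\<sigma>\<^sup>2" "\<integral>z. \<bar>z - \<mu>\<bar> ^ 4 \<partial>D" "\<integral>z. \<bar>z - \<mu>\<bar> powr (2 * 2) \<partial>D"
        by (rule sample[OF n order_refl]) (use fourth[OF n] in simp)
      have "prob_Bc (M n) (p n) (w n) \<mu> \<epsilon>
          \<le> (2 * rosenthal_const 2) powr (u / 2) * (\<epsilon> powr (- u) * (\<sigma> powr u * real (p n) powr (- u / 2)))"
        using tail_bound_small[OF u _ \<epsilon>] 1 unfolding \<sigma>u by (simp add: mult_ac)
      also have "\<dots> \<le> ?K * (\<epsilon> powr (- u) * (\<sigma> powr u * real (p n) powr (- u / 2)))"
        by (intro mult_right_mono) auto
      finally show "prob_Bc (M n) (p n) (w n) \<mu> \<epsilon> \<le> ?K * \<epsilon> powr (- u) * (\<sigma> powr u * real (p n) powr (- u / 2))"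
        by (simp only: mult.assoc)
    qed (simp add: add_nonneg_pos)
  next
    case 2
    show ?thesis
    proof (intro exI[of _ 1] conjI allI impI)
      fix \<epsilon> :: real and n :: nat assume \<epsilon>: "0 < \<epsilon>" and n: "1 \<le> n"
      have "0 < real (p n)" using p_pos[OF n] by simp
      then show "ennreal (prob_Bc (M n) (p n) (w n) \<mu> \<epsilon>)
        \<le> ennreal (1 * \<epsilon> powr (- u)) * (ennreal (\<sigma> powr u * real (p n) powr (- u / 2))
         + ennreal (real (p n) powr (- u + 1)) * abs_moment (M n) (w n 0) u)"
        unfolding abs_moment_eq[OF n] 2 using \<epsilon> by (simp add: ennreal_mult_top)
    qed simp
  next
    case 3
    \<comment> \<open>The locale asks for a finite moment of order 2v with v at least 2, and
      \<open>tail_bound\<close> for u \<le> 2v. Up to u = 4 the fourth moment provides this, beyond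
      it the moment of order u itself.\<close>
    define v where "v = max 2 (u / 2)"
    define m where "m = (\<integral>z. \<bar>z - \<mu>\<bar> powr (2 * v) \<partial>D)"
    have v: "2 \<le> v" "u \<le> 2 * v" by (auto simp: v_def)
    have i: "integrable (M n) (\<lambda>x. \<bar>w n 0 x - \<mu>\<bar> powr (2 * v))" if n: "1 \<le> n" for n
    proof (cases "u \<le> 4")
      case True
      then have "2 * v = 4" by (simp add: v_def)
      then show ?thesis using fourth[OF n] by simp
    next
      case False
      then have eq: "2 * v = u" by (simp add: v_def)
      interpret prob_space "M n" using iid[OF n] by (simp add: iid_positive_def)
      show ?thesis unfolding eq using 3 u
        by (intro integrable_centred_powr w0_measurable n) (auto simp: abs_moment_eq[OF n])
    qed
    have S: "positive_sample (M n) (p n) (w n) \<mu> v (\<sigma>\<^sup>2) (\<integral>z. \<bar>z - \<mu>\<bar> ^ 4 \<partial>D) m" if "1 \<le> n" for n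
      unfolding m_def by (rule sample[OF that v(1) i[OF that]])
    have m0: "0 \<le> m" by (simp add: m_def)
    let ?c = "rosenthal_const u * (\<sigma> powr u + (1 + m))"
    have c0: "0 \<le> ?c" using m0 rosenthal_const_nonneg[of u] by simp
    \<comment> \<open>Since \<sigma> is fixed and positive, the whole constant can be expressed as a
      multiple of \<sigma>^u.\<close>
    let ?K = "?c / \<sigma> powr u + 1"
    show ?thesis
    proof (rule reduce[of ?K])
      show "0 < ?K" using c0 by (intro add_nonneg_pos) auto
      fix \<epsilon> :: real and n :: nat assume \<epsilon>: "0 < \<epsilon>" and n: "1 \<le> n"
      interpret positive_sample "M n" "p n" "w n" \<mu> v "\<sigma>\<^sup>2" "\<integral>z. \<bar>z - \<mu>\<bar> ^ 4 \<partial>D" m by (rule S[OF n])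
      have "prob_Bc (M n) (p n) (w n) \<mu> \<epsilon> \<le> ?c * real (p n) powr (- u / 2) * \<epsilon> powr (- u)"
        using tail_bound[OF 3(1) v(2) \<epsilon>] unfolding \<sigma>u .
      also have "\<dots> = ?c / \<sigma> powr u * (\<epsilon> powr (- u) * (\<sigma> powr u * real (p n) powr (- u / 2)))"
        using sigma_pos by simp
      also have "\<dots> \<le> ?K * (\<epsilon> powr (- u) * (\<sigma> powr u * real (p n) powr (- u / 2)))"
        by (intro mult_right_mono) auto
      finally show "prob_Bc (M n) (p n) (w n) \<mu> \<epsilon> \<le> ?K * \<epsilon> powr (- u) * (\<sigma> powr u * real (p n) powr (- u / 2))"
        by (simp only: mult.assoc)
    qed
  qed
qed

end

text \<open>The limits are first turned into bounds for all n from 1 on: c1 and c2 for p / n, d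
  above \<delta>, c0 below \<delta> n^(1/4). The operator bound with the truncated moment then has
  uniform constants.\<close>

lemma (in sample_array) truncated_quad_dev:
  fixes \<delta> :: "nat \<Rightarrow> real"
  assumes c_pos: "0 < c"
    and ratio: "(\<lambda>n. real (p n) / real n) \<longlonglongrightarrow> c"
    and delta_pos: "\<And>n. 0 < \<delta> n"
    and delta_lim: "\<delta> \<longlonglongrightarrow> 0"
    and delta_rate: "filterlim (\<lambda>n. \<delta> n * real n powr (1/4)) at_top sequentially"
    and C: "\<And>n. 1 \<le> n \<Longrightarrow> (\<integral>x. \<bar>w n 0 x - \<mu>\<bar> ^ 4 \<partial>M n) \<le> C"
    and q: "2 \<le> q"
  shows "\<exists>K>0. \<forall>n\<ge>1. \<forall>A \<in> carrier_mat (p n) (p n).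
    spectral_norm A \<le> K\<^sub>A \<longrightarrow>
    (\<forall>j<p n. AE x in M n. \<bar>w n j x - \<mu>\<bar> < \<delta> n * sqrt (real n)) \<longrightarrow>
    (\<integral>\<^sup>+x. ennreal (cmod (quad_dev (M n) n (p n) (w n) A x) powr q) \<partial>M n)
    \<le> ennreal (K * real n powr (- 1) * \<delta> n powr (2*q - 4))"
proof -
  have "\<forall>\<^sub>F n in sequentially. c / 2 < real (p n) / real n"
    using ratio c_pos by (intro order_tendstoD(1)) auto
  then have "\<forall>\<^sub>F n in sequentially. c / 2 \<le> real (p n) / real n"
    by eventually_elim simp
  then obtain c1 where c1: "0 < c1" "\<And>n. 1 \<le> n \<Longrightarrow> c1 \<le> real (p n) / real n"
    by (rule eventually_bounded_below_imp_bounded_below) (use c_pos p_pos in \<open>auto simp: Suc_le_eq\<close>)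
  obtain c2 where c2: "\<And>n. norm (real (p n) / real n) \<le> c2"
    using convergent_imp_Bseq[OF convergentI[OF ratio]] by (auto simp: Bseq_def)
  obtain d where d: "\<And>n. norm (\<delta> n) \<le> d"
    using convergent_imp_Bseq[OF convergentI[OF delta_lim]] by (auto simp: Bseq_def)
  have "\<forall>\<^sub>F n in sequentially. 1 \<le> \<delta> n * real n powr (1/4)"
    using delta_rate by (auto simp: filterlim_at_top)
  then obtain c0 where c0: "0 < c0" "\<And>n. 1 \<le> n \<Longrightarrow> c0 \<le> \<delta> n * real n powr (1/4)"
    by (rule eventually_bounded_below_imp_bounded_below) (use delta_pos in \<open>auto intro!: mult_pos_pos\<close>)
  define L where "L = max K\<^sub>A 1"
  have L: "0 < L" "K\<^sub>A \<le> L" by (auto simp: L_def)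
  have C0: "0 \<le> C" by (rule order_trans[OF _ C[of 1]]) auto
  let ?o = "operator_const q \<mu> (\<sigma>\<^sup>2) C L"
  define b where "b = c0 powr (- (2 * q - 4))"
  define X where "X = 1 + c1 powr (1 - q) * C * d powr (2 * q - 4)"
  define Y where "Y = c2 powr (q / 2) * b + c2 * (b + C)"
  have X0: "0 \<le> X" unfolding X_def using C0 by simp
  have "0 \<le> c2" by (rule order_trans[OF _ c2[of 1]]) simp
  then have Y0: "0 \<le> Y" unfolding Y_def b_def using C0 by simp
  \<comment> \<open>The absolute value spares a sign argument for the operator constant; adding 1
    makes K positive.\<close>
  define K where "K = \<bar>?o\<bar> * X * Y + 1"
  have K: "0 < K" unfolding K_def using X0 Y0 by (intro add_nonneg_pos) auto
  show ?thesis
  proof (intro exI[of _ K] conjI allI impI ballI K)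
    fix n :: nat and A :: "complex mat"
    assume n: "1 \<le> n" and A: "A \<in> carrier_mat (p n) (p n)" and sn: "spectral_norm A \<le> K\<^sub>A"
      and bnd: "\<forall>j<p n. AE x in M n. \<bar>w n j x - \<mu>\<bar> < \<delta> n * sqrt (real n)"
    let ?R = "\<delta> n * sqrt (real n)"
    let ?m = "?R powr (2 * q - 4) * C"
    have bnd0: "AE x in M n. \<bar>w n 0 x - \<mu>\<bar> < ?R" using bnd p_pos[OF n] by simp
    interpret prob_space "M n" using iid[OF n] by (simp add: iid_positive_def)
    have meas: "(\<lambda>x. w n 0 x - \<mu>) \<in> borel_measurable (M n)"
      using iid_positive_measurable[OF iid[OF n] p_pos[OF n]] by measurable
    note tm = truncated_moment[OF meas bnd0 _ fourth[OF n] C[OF n], of "2 * q"]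
    interpret positive_sample "M n" "p n" "w n" \<mu> q "\<sigma>\<^sup>2" C ?m
      by (intro iid_positive_sample iid p_pos n mu_pos q mean_int mean variance C) (use tm q in auto)
    have N: "1 \<le> real n" using n by simp
    have p1: "c1 * real n \<le> real (p n)" using c1(2)[OF n] n by (simp add: field_simps)
    have p2: "real (p n) \<le> c2 * real n" using c2[of n] n by (simp add: field_simps)
    have dn: "\<delta> n \<le> d" using d[of n] by simp
    note rb = truncated_rate_bounds[OF q N c1(1) p1 p2 c0(1) c0(2)[OF n] delta_pos dn C0,
        folded b_def X_def, folded Y_def]
    let ?T = "real n powr (- q) * (real (p n) powr (q / 2) + (1 + ?m) * real (p n))"
    have "?o * (1 + real (p n) powr (1 - q) * ?m) * ?T
        \<le> \<bar>?o\<bar> * X * (Y * (real n powr (- 1) * \<delta> n powr (2 * q - 4)))"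
      using C0 X0 by (intro mult_mono[OF mult_mono[OF abs_ge_self rb(1)] rb(2)]) auto
    also have "\<dots> \<le> K * real n powr (- 1) * \<delta> n powr (2 * q - 4)"
    proof -
      have "\<bar>?o\<bar> * X * Y * (real n powr (- 1) * \<delta> n powr (2 * q - 4))
          \<le> K * (real n powr (- 1) * \<delta> n powr (2 * q - 4))"
        by (intro mult_right_mono) (auto simp: K_def)
      then show ?thesis by (simp only: mult.assoc)
    qed
    finally have "?o * (1 + real (p n) powr (1 - q) * ?m) * ?T \<le> K * real n powr (- 1) * \<delta> n powr (2 * q - 4)" .
    moreover have "spectral_norm A \<le> L" using sn L by simp
    ultimately show "(\<integral>\<^sup>+x. ennreal (cmod (quad_dev (M n) n (p n) (w n) A x) powr q) \<partial>M n)
        \<le> ennreal (K * real n powr (- 1) * \<delta> n powr (2*q - 4))"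
      by (intro order_trans[OF quad_dev_operator[OF A n _ L(1)] ennreal_leI])
  qed
qed

theorem lemma4p4:
  fixes M :: "nat \<Rightarrow> 'a measure"
    and w :: "nat \<Rightarrow> nat \<Rightarrow> 'a \<Rightarrow> real"
    and p :: "nat \<Rightarrow> nat"
    and \<delta> :: "nat \<Rightarrow> real"
    and c \<mu> \<sigma> :: real
  assumes c_pos: "0 < c"
    and p_pos: "\<And>n. 1 \<le> n \<Longrightarrow> 1 \<le> p n"
    and ratio: "(\<lambda>n. real (p n) / real n) \<longlonglongrightarrow> c"
    and delta_pos: "\<And>n. 0 < \<delta> n"
    and delta_lim: "\<delta> \<longlonglongrightarrow> 0"
    and delta_rate: "filterlim (\<lambda>n. \<delta> n * real n powr (1/4)) at_top sequentially"
    and mu_pos: "0 < \<mu>"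
    and sigma_pos: "0 < \<sigma>"
    and iid: "\<And>n. 1 \<le> n \<Longrightarrow> iid_positive (M n) (p n) (w n)"
    and mean_int: "\<And>n. 1 \<le> n \<Longrightarrow> integrable (M n) (w n 0)"
    and mean: "\<And>n. 1 \<le> n \<Longrightarrow> (\<integral>x. w n 0 x \<partial>M n) = \<mu>"
    and variance: "\<And>n. 1 \<le> n \<Longrightarrow> (\<integral>x. (w n 0 x - \<mu>)\<^sup>2 \<partial>M n) = \<sigma>\<^sup>2"
    and fourth: "\<And>n. 1 \<le> n \<Longrightarrow> integrable (M n) (\<lambda>x. \<bar>w n 0 x - \<mu>\<bar> ^ 4)"
  shows
    "((\<exists>D. \<forall>n\<ge>1. distr (M n) borel (w n 0) = D) \<longrightarrow>
       (\<forall>\<epsilon>>0. \<forall>q\<ge>2. \<exists>K>0. \<forall>n\<ge>1. \<forall>A \<in> carrier_mat (p n) (p n).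
          (\<integral>\<^sup>+x. ennreal (cmod (quad_dev (M n) n (p n) (w n) A x) powr q) \<partial>M n)
          \<le> ennreal K *
             (ennreal (real n powr (- q)) *
                (ennreal (((\<integral>x. \<bar>w n 0 x\<bar> ^ 4 \<partial>M n) * Re (mtrace (A * mat_adjoint A))) powr (q/2))
                 + abs_moment (M n) (w n 0) (2*q)
                     * ennreal (Re (mtrace (psd_power (A * mat_adjoint A) (q/2)))))
              + ennreal (real n powr q * prob_Bc (M n) (p n) (w n) \<mu> \<epsilon> * spectral_norm A powr q)
              + ennreal (real n powr (- q) * spectral_norm A powr q * \<bar>h1 (M n) (w n) \<mu> \<sigma>\<bar> powr q)))
       \<and>
       (\<forall>k>0. \<forall>q1>0. \<exists>K>0. \<forall>\<epsilon>>0. \<forall>n\<ge>1.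
          ennreal (prob_Bc (M n) (p n) (w n) \<mu> \<epsilon>)
          \<le> ennreal (K * \<epsilon> powr (- (k*q1))) *
             (ennreal (\<sigma> powr (k*q1) * real (p n) powr (- (k*q1) / 2))
              + ennreal (real (p n) powr (- (k*q1) + 1)) * abs_moment (M n) (w n 0) (k*q1))))
     \<and>
     (\<forall>C K\<^sub>A. (\<forall>n\<ge>1. (\<integral>x. \<bar>w n 0 x - \<mu>\<bar> ^ 4 \<partial>M n) \<le> C) \<longrightarrow>
       (\<forall>q\<ge>2. \<exists>K>0. \<forall>n\<ge>1. \<forall>A \<in> carrier_mat (p n) (p n).
          spectral_norm A \<le> K\<^sub>A \<longrightarrow>
          (\<forall>j<p n. AE x in M n. \<bar>w n j x - \<mu>\<bar> < \<delta> n * sqrt (real n)) \<longrightarrow>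
          (\<integral>\<^sup>+x. ennreal (cmod (quad_dev (M n) n (p n) (w n) A x) powr q) \<partial>M n)
          \<le> ennreal (K * real n powr (- 1) * \<delta> n powr (2*q - 4))))"
proof -
  interpret sample_array M w p \<mu> \<sigma>
    by unfold_locales (fact p_pos mu_pos iid mean_int mean variance fourth)+
  show ?thesis
  proof (intro conjI impI allI, goal_cases)
    case (1 \<epsilon> q)
    from 1(1) obtain D where "\<And>n. 1 \<le> n \<Longrightarrow> distr (M n) borel (w n 0) = D" by blast
    then interpret fixed_law_array M w p \<mu> \<sigma> D by unfold_locales
    from fixed_law_quad_dev[OF 1(3)]
    obtain K where K: "0 < K" and le: "\<And>n A. 1 \<le> n \<Longrightarrow> A \<in> carrier_mat (p n) (p n) \<Longrightarrow>
      (\<integral>\<^sup>+x. ennreal (cmod (quad_dev (M n) n (p n) (w n) A x) powr q) \<partial>M n)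
      \<le> ennreal K * (ennreal (real n powr (- q)) *
         (ennreal (((\<integral>x. \<bar>w n 0 x\<bar> ^ 4 \<partial>M n) * Re (mtrace (A * mat_adjoint A))) powr (q/2))
          + abs_moment (M n) (w n 0) (2*q) * ennreal (Re (mtrace (psd_power (A * mat_adjoint A) (q/2))))))"
      by blast
    show ?case
      by (intro exI[of _ K] conjI allI impI ballI K order_trans[OF le] mult_left_mono)
         (simp_all add: add.assoc)
  next
    case (2 k q1)
    from 2(1) obtain D where "\<And>n. 1 \<le> n \<Longrightarrow> distr (M n) borel (w n 0) = D" by blast
    then interpret fixed_law_array M w p \<mu> \<sigma> D by unfold_locales
    show ?case by (rule fixed_law_tail[OF sigma_pos mult_pos_pos[OF 2(2,3)]])
  next
    case (3 C K\<^sub>A q)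
    then have "(\<integral>x. \<bar>w n 0 x - \<mu>\<bar> ^ 4 \<partial>M n) \<le> C" if "1 \<le> n" for n using that by blast
    from truncated_quad_dev[OF c_pos ratio delta_pos delta_lim delta_rate this 3(2)] show ?case .
  qed
qed

end
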